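(* Let $E$ be a second countable topological graph. There is a bijection between the set of rays of non-zero extremal invariant boundary measures on $\partial E$ and the set of vertices $v\in E^0_{sng}$ satisfying the following condition: for any $w\in E^0$ there exists an open neighbourhood $V_w\subseteq E^0$ of $w$ satisfying $|V_wE^*v|<\infty$. The ray of extremal invariant boundary measures corresponding to such a $v\in E^0_{sng}$ is of the form $\{r\cdot\nu\;|\;r>0\}$, where $$\nu=\sum_{\alpha\in E^*v}\delta_\alpha .$$
   Context: A topological graph $E=(E^0,E^1,r,s)$ consists of locally compact Hausdorff spaces $E^0$, $E^1$, a local homeomorphism $s:E^1\to E^0$ and a continuous map $r:E^1\to E^0$; it is second countable if $E^0$ and $E^1$ are. For $n\ge1$, $E^n$ is the set of paths $\alpha=\alpha_1\cdots\alpha_n$ of edges with $s(\alpha_i)=r(\alpha_{i+1})$, topologised as a subspace of $\prod_{i=1}^nE^1$; vertices are paths of length $0$; $|\alpha|$ is the length. $E^*=\bigsqcup_{n\ge0}E^n$ (disjoint union topology), and $E^\infty$ is the set of infinite paths $\alpha_1\alpha_2\cdots$ with $s(\alpha_i)=r(\alpha_{i+1})$, $|\alpha|=\infty$. One extends $r(\alpha)=r(\alpha_1)$, $s(\alpha)=s(\alpha_{|\alpha|})$ (finite paths), $r(v)=s(v)=v$ for vertices. $E^*v=\{\alpha\in E^*: s(\alpha)=v\}$ and $VE^*v=\{\alpha\in E^*v: r(\alpha)\in V\}$ for $V\subseteq E^0$. $E^0_{reg}$ is the set of $v\in E^0$ having an open neighbourhood $W$ with $\overline W$ compact, $r^{-1}(\overline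 W)\subseteq E^1$ compact and $r(r^{-1}(W))=W$; $E^0_{sng}=E^0\setminus E^0_{reg}$; $E^*_{sng}=\{\alpha\in E^*: s(\alpha)\in E^0_{sng}\}$. As a set the boundary path space is $\partial E=E^*_{sng}\sqcup E^\infty$. For $S\subseteq E^*$, $Z(S)=\{\alpha\in\partial E: r(\alpha)\in S\text{ or }\alpha_1\cdots\alpha_n\in S\text{ for some }1\le n\le|\alpha|\}$. The sets $Z(U)\setminus Z(K)$ ($U\subseteq E^*$ open, $K\subseteq E^*$ compact) form a basis of a locally compact Hausdorff topology on $\partial E$. The shift $\sigma:\partial E\setminus E^0\to\partial E$ removes the first edge ($\sigma(\alpha)=s(\alpha_1)$ if $|\alpha|=1$); it is a local homeomorphism. An invariant measure on $\partial E$ is a regular (i.e. finite on compact sets) Borel measure $\nu$ with $\nu(\sigma(A))=\nu(A)$ for all Borel $A\subseteq\partial E\setminus E^0$ on which $\sigma$ is injective. It is extremal if any decomposition $\nu=\nu_1+\nu_2$ into invariant measures satisfies $\nu_1,\nu_2\in\{\lambda\nu:\lambda\ge0\}$. It is a boundary measure if it is concentrated on $E^*_{sng}$, i.e. $\nu(\partial E\setminus E^*_{sng})=0$. A ray of measures is a set of the form $\{r\nu: r>0\}$ with $\nu$ a measure. $\delta_\alpha$ is the Dirac measure at $\alpha$. *)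

theory Defs
  imports "HOL-Probability.Probability" "HOL-Library.Extended_Nat"
begin

section \<open>Topological graphs\<close>

definition local_homeomorphism :: "'a topology \<Rightarrow> 'b topology \<Rightarrow> ('a \<Rightarrow> 'b) \<Rightarrow> bool" where
  "local_homeomorphism X Y f \<longleftrightarrow>
     (\<forall>x\<in>topspace X. \<exists>U. openin X U \<and> x \<in> U \<and> openin Y (f ` U) \<and>
        homeomorphic_map (subtopology X U) (subtopology Y (f ` U)) f)"

record ('v, 'e) topgraph =
  vspace :: "'v topology"
  espace :: "'e topology"
  rng :: "'e \<Rightarrow> 'v"
  src :: "'e \<Rightarrow> 'v"

definition topological_graph :: "('v, 'e) topgraph \<Rightarrow> bool" where
  "topological_graph E \<longleftrightarrow>
     locally_compact_space (vspace E) \<and> Hausdorff_space (vspace E) \<and>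
     locally_compact_space (espace E) \<and> Hausdorff_space (espace E) \<and>
     local_homeomorphism (espace E) (vspace E) (src E) \<and>
     continuous_map (espace E) (vspace E) (rng E)"

definition second_countable_graph :: "('v, 'e) topgraph \<Rightarrow> bool" where
  "second_countable_graph E \<longleftrightarrow> second_countable (vspace E) \<and> second_countable (espace E)"

section \<open>Paths\<close>

text \<open>Paths of length 0 are \<open>Vtx v\<close>. Finite paths of positive length are \<open>Edges xs\<close> with
  \<open>xs \<noteq> []\<close>; \<open>Edges []\<close> is a junk value that belongs to none of the path spaces below.\<close>

datatype ('v, 'e) gpath =
    Vtx (the_vtx: 'v)
  | Edges (the_edges: "'e list")
  | Inf_path (the_inf: "nat \<Rightarrow> 'e")

fun plen :: "('v, 'e) gpath \<Rightarrow> enat" where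
  "plen (Vtx v) = 0"
| "plen (Edges xs) = enat (length xs)"
| "plen (Inf_path f) = \<infinity>"

definition vertex_paths :: "('v, 'e) topgraph \<Rightarrow> ('v, 'e) gpath set" where
  "vertex_paths E = Vtx ` topspace (vspace E)"

definition edge_paths :: "('v, 'e) topgraph \<Rightarrow> nat \<Rightarrow> ('v, 'e) gpath set" where
  "edge_paths E n = {Edges xs | xs. length xs = n \<and> set xs \<subseteq> topspace (espace E) \<and>
     (\<forall>i. Suc i < n \<longrightarrow> src E (xs ! i) = rng E (xs ! Suc i))}"

definition paths_of_length :: "('v, 'e) topgraph \<Rightarrow> nat \<Rightarrow> ('v, 'e) gpath set" where
  "paths_of_length E n = (if n = 0 then vertex_paths E else edge_paths E n)"

definition fin_paths :: "('v, 'e) topgraph \<Rightarrow> ('v, 'e) gpath set" where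
  "fin_paths E = (\<Union>n. paths_of_length E n)"

definition inf_paths :: "('v, 'e) topgraph \<Rightarrow> ('v, 'e) gpath set" where
  "inf_paths E = {Inf_path f | f. (\<forall>i. f i \<in> topspace (espace E)) \<and>
     (\<forall>i. src E (f i) = rng E (f (Suc i)))}"

fun path_rng :: "('v, 'e) topgraph \<Rightarrow> ('v, 'e) gpath \<Rightarrow> 'v" where
  "path_rng E (Vtx v) = v"
| "path_rng E (Edges xs) = rng E (hd xs)"
| "path_rng E (Inf_path f) = rng E (f 0)"

text \<open>An infinite path has no source; the value there is unspecified.\<close>

fun path_src :: "('v, 'e) topgraph \<Rightarrow> ('v, 'e) gpath \<Rightarrow> 'v" where
  "path_src E (Vtx v) = v"
| "path_src E (Edges xs) = src E (last xs)"

text \<open>The initial segment consisting of the first \<open>n\<close> edges; only meaningful for \<open>1 \<le> n \<le> |\<alpha>|\<close>.\<close>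

fun initial_segment :: "nat \<Rightarrow> ('v, 'e) gpath \<Rightarrow> ('v, 'e) gpath" where
  "initial_segment n (Vtx v) = Vtx v"
| "initial_segment n (Edges xs) = Edges (take n xs)"
| "initial_segment n (Inf_path f) = Edges (map f [0..<n])"

definition paths_to :: "('v, 'e) topgraph \<Rightarrow> 'v \<Rightarrow> ('v, 'e) gpath set" where
  "paths_to E v = {\<alpha> \<in> fin_paths E. path_src E \<alpha> = v}"

definition paths_from_to :: "('v, 'e) topgraph \<Rightarrow> 'v set \<Rightarrow> 'v \<Rightarrow> ('v, 'e) gpath set" where
  "paths_from_to E V v = {\<alpha> \<in> paths_to E v. path_rng E \<alpha> \<in> V}"

text \<open>For \<open>n \<ge> 1\<close> this is the subspace topology of the \<open>n\<close>-fold product of the edge space,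
  transported along the identification of a list of length \<open>n\<close> with a function on \<open>{..<n}\<close>.\<close>

definition path_topology :: "('v, 'e) topgraph \<Rightarrow> nat \<Rightarrow> ('v, 'e) gpath topology" where
  "path_topology E n =
     (if n = 0 then pullback_topology (vertex_paths E) the_vtx (vspace E)
      else pullback_topology (edge_paths E n) (\<lambda>\<alpha>. restrict (nth (the_edges \<alpha>)) {..<n})
             (product_topology (\<lambda>_. espace E) {..<n}))"

text \<open>The paths of different lengths are already disjoint, so the disjoint union topology is
  obtained from \<open>sum_topology\<close> by tagging a path with its length.\<close>

definition fin_path_topology :: "('v, 'e) topgraph \<Rightarrow> ('v, 'e) gpath topology" where
  "fin_path_topology E =
     pullback_topology (fin_paths E) (\<lambda>\<alpha>. (the_enat (plen \<alpha>), \<alpha>))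
       (sum_topology (path_topology E) UNIV)"

section \<open>Regular and singular vertices\<close>

definition regular_vertices :: "('v, 'e) topgraph \<Rightarrow> 'v set" where
  "regular_vertices E = {v \<in> topspace (vspace E). \<exists>W. openin (vspace E) W \<and> v \<in> W \<and>
     compactin (vspace E) (vspace E closure_of W) \<and>
     compactin (espace E) {e \<in> topspace (espace E). rng E e \<in> vspace E closure_of W} \<and>
     rng E ` {e \<in> topspace (espace E). rng E e \<in> W} = W}"

definition singular_vertices :: "('v, 'e) topgraph \<Rightarrow> 'v set" where
  "singular_vertices E = topspace (vspace E) - regular_vertices E"

definition sing_paths :: "('v, 'e) topgraph \<Rightarrow> ('v, 'e) gpath set" where
  "sing_paths E = {\<alpha> \<in> fin_paths E. path_src E \<alpha> \<in> singular_vertices E}"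

section \<open>The boundary path space\<close>

definition boundary_paths :: "('v, 'e) topgraph \<Rightarrow> ('v, 'e) gpath set" where
  "boundary_paths E = sing_paths E \<union> inf_paths E"

definition cylinder :: "('v, 'e) topgraph \<Rightarrow> ('v, 'e) gpath set \<Rightarrow> ('v, 'e) gpath set" where
  "cylinder E S = {\<alpha> \<in> boundary_paths E. Vtx (path_rng E \<alpha>) \<in> S \<or>
     (\<exists>n\<ge>1. enat n \<le> plen \<alpha> \<and> initial_segment n \<alpha> \<in> S)}"

text \<open>The generating sets form a basis, so generating by unions and finite intersections gives
  the same topology as taking unions only.\<close>

definition boundary_topology :: "('v, 'e) topgraph \<Rightarrow> ('v, 'e) gpath topology" where
  "boundary_topology E = topology_generated_by
     {cylinder E U - cylinder E K | U K.
        openin (fin_path_topology E) U \<and> compactin (fin_path_topology E) K}"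

text \<open>The shift is unspecified on paths of length 0.\<close>

fun shift :: "('v, 'e) topgraph \<Rightarrow> ('v, 'e) gpath \<Rightarrow> ('v, 'e) gpath" where
  "shift E (Edges xs) = (if length xs = 1 then Vtx (src E (hd xs)) else Edges (tl xs))"
| "shift E (Inf_path f) = Inf_path (\<lambda>n. f (Suc n))"

section \<open>Invariant measures\<close>

definition borel_of :: "'a topology \<Rightarrow> 'a measure" where
  "borel_of X = sigma (topspace X) {U. openin X U}"

abbreviation boundary_borel :: "('v, 'e) topgraph \<Rightarrow> ('v, 'e) gpath measure" where
  "boundary_borel E \<equiv> borel_of (boundary_topology E)"

definition invariant_measure :: "('v, 'e) topgraph \<Rightarrow> ('v, 'e) gpath measure \<Rightarrow> bool" where
  "invariant_measure E \<nu> \<longleftrightarrow>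
     sets \<nu> = sets (boundary_borel E) \<and>
     (\<forall>K. compactin (boundary_topology E) K \<longrightarrow> emeasure \<nu> K < \<infinity>) \<and>
     (\<forall>A\<in>sets (boundary_borel E). A \<subseteq> boundary_paths E - vertex_paths E \<longrightarrow> inj_on (shift E) A \<longrightarrow>
        emeasure \<nu> (shift E ` A) = emeasure \<nu> A)"

definition extremal_measure :: "('v, 'e) topgraph \<Rightarrow> ('v, 'e) gpath measure \<Rightarrow> bool" where
  "extremal_measure E \<nu> \<longleftrightarrow>
     (\<forall>\<nu>1 \<nu>2. invariant_measure E \<nu>1 \<longrightarrow> invariant_measure E \<nu>2 \<longrightarrow>
        (\<forall>A\<in>sets (boundary_borel E). emeasure \<nu> A = emeasure \<nu>1 A + emeasure \<nu>2 A) \<longrightarrow>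
        {\<nu>1, \<nu>2} \<subseteq> {scale_measure (ennreal c) \<nu> | c. 0 \<le> c})"

definition boundary_measure :: "('v, 'e) topgraph \<Rightarrow> ('v, 'e) gpath measure \<Rightarrow> bool" where
  "boundary_measure E \<nu> \<longleftrightarrow> emeasure \<nu> (boundary_paths E - sing_paths E) = 0"

definition measure_ray :: "'a measure \<Rightarrow> 'a measure set" where
  "measure_ray \<nu> = {scale_measure (ennreal c) \<nu> | c. 0 < c}"

definition extremal_boundary_rays :: "('v, 'e) topgraph \<Rightarrow> ('v, 'e) gpath measure set set" where
  "extremal_boundary_rays E = {measure_ray \<nu> | \<nu>. invariant_measure E \<nu> \<and> extremal_measure E \<nu> \<and>
     boundary_measure E \<nu> \<and> emeasure \<nu> (space \<nu>) \<noteq> 0}"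

definition locally_finite_singular_vertices :: "('v, 'e) topgraph \<Rightarrow> 'v set" where
  "locally_finite_singular_vertices E = {v \<in> singular_vertices E.
     \<forall>w\<in>topspace (vspace E). \<exists>V. openin (vspace E) V \<and> w \<in> V \<and> finite (paths_from_to E V v)}"

text \<open>The sum of a family of measures on the measurable space \<open>M\<close>; the integral against
  counting measure is the unordered sum of the (extended nonnegative) values.\<close>

definition sum_measures :: "'a measure \<Rightarrow> ('i \<Rightarrow> 'a measure) \<Rightarrow> 'i set \<Rightarrow> 'a measure" where
  "sum_measures M \<mu> I =
     measure_of (space M) (sets M) (\<lambda>A. \<integral>\<^sup>+ i. emeasure (\<mu> i) A \<partial>count_space I)"

definition vertex_measure :: "('v, 'e) topgraph \<Rightarrow> 'v \<Rightarrow> ('v, 'e) gpath measure" where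
  "vertex_measure E v =
     sum_measures (boundary_borel E) (\<lambda>\<alpha>. return (boundary_borel E) \<alpha>) (paths_to E v)"

section \<open>Consistency of the encodings\<close>

lemma emeasure_sum_measures:
  fixes M :: "'a measure"
  assumes "\<And>i. i \<in> I \<Longrightarrow> sets (\<mu> i) = sets M" "A \<in> sets M"
  shows "emeasure (sum_measures M \<mu> I) A = (\<integral>\<^sup>+ i. emeasure (\<mu> i) A \<partial>count_space I)"
proof (rule emeasure_measure_of[OF sum_measures_def])
  show "countably_additive (sets (sum_measures M \<mu> I))
          (\<lambda>A. \<integral>\<^sup>+ i. emeasure (\<mu> i) A \<partial>count_space I)"
  proof (rule countably_additiveI)
    fix F :: "nat \<Rightarrow> 'a set"
    assume F: "range F \<subseteq> sets (sum_measures M \<mu> I)" "disjoint_family F"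
    have "range F \<subseteq> sets M"
      using F(1) by (simp add: sum_measures_def)
    then have "(\<integral>\<^sup>+ i. emeasure (\<mu> i) (\<Union>j. F j) \<partial>count_space I) =
        (\<integral>\<^sup>+ i. (\<Sum>j. emeasure (\<mu> i) (F j)) \<partial>count_space I)"
      using F(2) assms(1) by (intro nn_integral_cong) (auto simp: suminf_emeasure)
    then show "(\<Sum>j. \<integral>\<^sup>+ i. emeasure (\<mu> i) (F j) \<partial>count_space I) =
        (\<integral>\<^sup>+ i. emeasure (\<mu> i) (\<Union>j. F j) \<partial>count_space I)"
      by (simp add: nn_integral_suminf)
  qed
qed (use assms(2) sets.space_closed in \<open>auto simp: positive_def sum_measures_def\<close>)

lemma topspace_path_topology: "topspace (path_topology E n) = paths_of_length E n"
  by (force simp: path_topology_def paths_of_length_def topspace_pullback_topology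
      vertex_paths_def edge_paths_def PiE_def)

lemma plen_paths_of_length: "\<alpha> \<in> paths_of_length E n \<Longrightarrow> plen \<alpha> = enat n"
  by (auto simp: paths_of_length_def vertex_paths_def edge_paths_def zero_enat_def split: if_splits)

lemma openin_fin_path_topology:
  "openin (fin_path_topology E) S \<longleftrightarrow>
     S \<subseteq> fin_paths E \<and> (\<forall>n. openin (path_topology E n) (S \<inter> paths_of_length E n))"
proof
  assume "openin (fin_path_topology E) S"
  then obtain U where U: "openin (sum_topology (path_topology E) UNIV) U"
    and S: "S = (\<lambda>\<alpha>. (the_enat (plen \<alpha>), \<alpha>)) -` U \<inter> fin_paths E"
    by (auto simp: fin_path_topology_def openin_pullback_topology)
  have "S \<inter> paths_of_length E n = {x. (n, x) \<in> U}" for n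
  proof -
    have "{x. (n, x) \<in> U} \<subseteq> paths_of_length E n"
      using U by (auto simp: openin_sum_topology topspace_path_topology)
    moreover have "the_enat (plen x) = n" if "x \<in> paths_of_length E n" for x
      using plen_paths_of_length[OF that] by simp
    ultimately show ?thesis
      by (fastforce simp: S fin_paths_def)
  qed
  with U S show "S \<subseteq> fin_paths E \<and> (\<forall>n. openin (path_topology E n) (S \<inter> paths_of_length E n))"
    by (auto simp: openin_sum_topology)
next
  assume S: "S \<subseteq> fin_paths E \<and> (\<forall>n. openin (path_topology E n) (S \<inter> paths_of_length E n))"
  have "S = (\<lambda>\<alpha>. (the_enat (plen \<alpha>), \<alpha>)) -` (SIGMA n:UNIV. S \<inter> paths_of_length E n) \<inter> fin_paths E"
  proof -
    have "x \<in> paths_of_length E (the_enat (plen x))" if x: "x \<in> fin_paths E" for x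
    proof -
      obtain n where n: "x \<in> paths_of_length E n"
        using x by (auto simp: fin_paths_def)
      then show ?thesis
        using plen_paths_of_length[OF n] by simp
    qed
    then show ?thesis
      using S by auto
  qed
  moreover have "openin (sum_topology (path_topology E) UNIV) (SIGMA n:UNIV. S \<inter> paths_of_length E n)"
    using S by (auto simp: openin_sum_topology_alt)
  ultimately show "openin (fin_path_topology E) S"
    unfolding fin_path_topology_def openin_pullback_topology by blast
qed

lemma topspace_fin_path_topology: "topspace (fin_path_topology E) = fin_paths E"
proof (rule antisym)
  have "paths_of_length E n \<subseteq> fin_paths E" for n
    by (auto simp: fin_paths_def)
  then have "openin (fin_path_topology E) (fin_paths E)"
    by (simp add: openin_fin_path_topology Int_absorb1 flip: topspace_path_topology)
  then show "fin_paths E \<subseteq> topspace (fin_path_topology E)"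
    by (rule openin_subset)
  show "topspace (fin_path_topology E) \<subseteq> fin_paths E"
    using openin_fin_path_topology openin_topspace by blast
qed

end

theory Submission
  imports Defs "HOL-Library.Diagonal_Subsequence"
begin

text \<open>
  Restricting an extremal invariant boundary measure to the paths whose source lies in an open set
  of vertices gives an invariant measure again, so by extremality the source map pushes the measure
  forward to one that takes only the values zero and full. As the vertex space is second countable,
  such a measure lives on the paths \<open>E\<^sup>*v\<close> to a single vertex \<open>v\<close>. This set is countable because
  the source map is a local homeomorphism, and shifting a path of \<open>E\<^sup>*v\<close> edge by edge down to \<open>v\<close>
  shows that all its points have the same mass. Hence the measure is a multiple of
  \<open>\<Sum>\<^sub>\<alpha> \<delta>\<^sub>\<alpha>\<close>, and the same computation shows that this sum is extremal.

  It is finite on compact sets iff \<open>v\<close> is locally finite. If there were infinitely many paths to \<open>v\<close>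
  with range in a compact set, a diagonal argument would extract a sequence whose edges converge one
  after the other, either forever or up to a stage after which they leave every compact set. The limit
  of the edges is a boundary path, so the sequence and its limit form a compact set of infinite measure.
\<close>

section \<open>Finite paths\<close>

text \<open>Invariance compares the mass of a Borel set with that of its shift, so restricting a
  measure to a shift-invariant set, or testing the sum of Dirac measures, requires the shifted set
  to be Borel again. This obstacle forces the topological work. The boundary topology is generated
  by sets Z(U) minus Z(K), so one has to see how the shift acts on them. On paths whose first edge
  lies in a small open V it turns Z(U) into Z(U') and Z(K) into Z(K'). Openness of U' rests on
  \<open>src\<close> being an open map; compactness of K' is the reason why V is enclosed in a
  compact set on which \<open>src\<close> is injective.

  Singularity of v enters through compactness: if the edges of a sequence of paths escape after
  stage N, the limit has length N, and it is a boundary path only if its source is singular.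

  The factor between an extremal measure and the sum is the mass of v itself, seen as a path of
  length 0; it is finite because a point is compact.\<close>

lemma Edges_in_edge_paths_iff:
  "Edges xs \<in> edge_paths E n \<longleftrightarrow> length xs = n \<and> (\<forall>i<n. xs ! i \<in> topspace (espace E)) \<and>
     (\<forall>i. Suc i < n \<longrightarrow> src E (xs ! i) = rng E (xs ! Suc i))"
  by (auto simp: edge_paths_def in_set_conv_nth subset_iff)

lemma edge_pathsE:
  assumes "\<alpha> \<in> edge_paths E n"
  obtains xs where "\<alpha> = Edges xs" "Edges xs \<in> edge_paths E n" "length xs = n"
  using assms by (auto simp: edge_paths_def)

lemma paths_of_length_disjoint:
  "\<alpha> \<in> paths_of_length E m \<Longrightarrow> \<alpha> \<in> paths_of_length E n \<Longrightarrow> m = n"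
  using plen_paths_of_length by (metis enat.inject)

lemma paths_of_length_0: "paths_of_length E 0 = vertex_paths E"
  and paths_of_length_pos: "n > 0 \<Longrightarrow> paths_of_length E n = edge_paths E n"
  by (auto simp: paths_of_length_def)

lemma paths_of_length_Suc: "paths_of_length E (Suc n) = edge_paths E (Suc n)"
  by (simp add: paths_of_length_def)

section \<open>Open sets of finite paths\<close>

lemma openin_path_topology_0:
  "openin (path_topology E 0) S \<longleftrightarrow> (\<exists>U. openin (vspace E) U \<and> S = Vtx ` U)"
proof -
  have *: "the_vtx -` U \<inter> vertex_paths E = Vtx ` U" if "openin (vspace E) U" for U
    using openin_subset[OF that] by (auto simp: vertex_paths_def)
  show ?thesis
    by (auto simp: path_topology_def openin_pullback_topology *)
       (metis *)
qed

text \<open>A path of length n has only n coordinates, so boxes with open sides form a neighbourhood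
  base. This removes the function encoding behind \<open>path_topology\<close>: later openness
  proofs only exhibit a box \<open>B\<close> around each list.\<close>

lemma openin_path_topology_pos:
  assumes "n > 0"
  shows "openin (path_topology E n) S \<longleftrightarrow> S \<subseteq> edge_paths E n \<and>
    (\<forall>xs. Edges xs \<in> S \<longrightarrow> (\<exists>B. (\<forall>i<n. openin (espace E) (B i) \<and> xs ! i \<in> B i) \<and>
       (\<forall>ys. Edges ys \<in> edge_paths E n \<longrightarrow> (\<forall>i<n. ys ! i \<in> B i) \<longrightarrow> Edges ys \<in> S)))"
    (is "?L \<longleftrightarrow> _ \<and> ?R S")
proof
  let ?f = "\<lambda>\<alpha>::('a,'b) gpath. restrict (nth (the_edges \<alpha>)) {..<n}"
  assume ?L
  then obtain U where U: "openin (product_topology (\<lambda>_. espace E) {..<n}) U"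
    and S: "S = ?f -` U \<inter> edge_paths E n"
    using assms by (auto simp: path_topology_def openin_pullback_topology)
  have "?R S"
  proof (intro allI impI)
    fix xs assume "Edges xs \<in> S"
    then have "?f (Edges xs) \<in> U" by (auto simp: S)
    then obtain B where B: "\<forall>i\<in>{..<n}. openin (espace E) (B i)" "?f (Edges xs) \<in> PiE {..<n} B"
      "PiE {..<n} B \<subseteq> U"
      using U unfolding openin_product_topology_alt by blast
    show "\<exists>B. (\<forall>i<n. openin (espace E) (B i) \<and> xs ! i \<in> B i) \<and>
       (\<forall>ys. Edges ys \<in> edge_paths E n \<longrightarrow> (\<forall>i<n. ys ! i \<in> B i) \<longrightarrow> Edges ys \<in> S)"
    proof (intro exI[of _ B] conjI allI impI)
      fix i assume "i < n" then show "openin (espace E) (B i)" "xs ! i \<in> B i"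
        using B by (auto simp: PiE_iff)
    next
      fix ys :: "'b list" assume "Edges ys \<in> edge_paths E n" "\<forall>i<n. ys ! i \<in> B i"
      moreover from this have "restrict ((!) ys) {..<n} \<in> U"
        by (intro subsetD[OF B(3)]) auto
      ultimately show "Edges ys \<in> S" by (simp add: S)
    qed
  qed
  then show "S \<subseteq> edge_paths E n \<and> ?R S" by (auto simp: S)
next
  let ?f = "\<lambda>\<alpha>::('a,'b) gpath. restrict (nth (the_edges \<alpha>)) {..<n}"
  assume R: "S \<subseteq> edge_paths E n \<and> ?R S"
  have "\<exists>B. \<forall>xs. Edges xs \<in> S \<longrightarrow> ((\<forall>i<n. openin (espace E) (B xs i) \<and> xs ! i \<in> B xs i) \<and>
       (\<forall>ys. Edges ys \<in> edge_paths E n \<longrightarrow> (\<forall>i<n. ys ! i \<in> B xs i) \<longrightarrow> Edges ys \<in> S))"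
    using R by (intro choice) blast
  then obtain B where B: "\<And>xs i. Edges xs \<in> S \<Longrightarrow> i < n \<Longrightarrow> openin (espace E) (B xs i) \<and> xs ! i \<in> B xs i"
    "\<And>xs ys. Edges xs \<in> S \<Longrightarrow> Edges ys \<in> edge_paths E n \<Longrightarrow> (\<forall>i<n. ys ! i \<in> B xs i) \<Longrightarrow> Edges ys \<in> S"
    by blast
  \<comment> \<open>The union of the chosen boxes is an open set of functions that pulls back to
    \<open>S\<close>.\<close>
  define U where "U = (\<Union>xs\<in>{xs. Edges xs \<in> S}. PiE {..<n} (B xs))"
  have "openin (product_topology (\<lambda>_. espace E) {..<n}) U"
    unfolding U_def using B(1) by (intro openin_Union) (auto simp: openin_PiE_gen)
  moreover have "S = ?f -` U \<inter> edge_paths E n"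
  proof (intro set_eqI iffI)
    fix \<alpha> assume a: "\<alpha> \<in> S"
    then obtain xs where xs: "\<alpha> = Edges xs" "\<alpha> \<in> edge_paths E n" using R by (auto elim: edge_pathsE)
    then show "\<alpha> \<in> ?f -` U \<inter> edge_paths E n"
      using B(1)[of xs] a unfolding U_def by (auto intro!: exI[of _ xs])
  next
    fix \<alpha> assume a: "\<alpha> \<in> ?f -` U \<inter> edge_paths E n"
    then obtain ys where ys: "\<alpha> = Edges ys" "Edges ys \<in> edge_paths E n" by (auto elim: edge_pathsE)
    from a obtain xs where xs: "Edges xs \<in> S" "?f \<alpha> \<in> PiE {..<n} (B xs)" unfolding U_def by blast
    then have "\<forall>i<n. ys ! i \<in> B xs i" by (auto simp: ys)
    then show "\<alpha> \<in> S" using B(2) xs ys by blast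
  qed
  ultimately show ?L
    using assms by (auto simp: path_topology_def openin_pullback_topology)
qed

lemma openin_fin_path_topology_of_length:
  assumes "openin (path_topology E n) S"
  shows "openin (fin_path_topology E) S"
  unfolding openin_fin_path_topology
proof (intro conjI allI)
  have S: "S \<subseteq> paths_of_length E n"
    using openin_subset[OF assms] by (simp add: topspace_path_topology)
  then show "S \<subseteq> fin_paths E" by (auto simp: fin_paths_def)
  fix m show "openin (path_topology E m) (S \<inter> paths_of_length E m)"
  proof (cases "m = n")
    case False
    then have "S \<inter> paths_of_length E m = {}"
      using S paths_of_length_disjoint by blast
    then show ?thesis by simp
  qed (use assms S in \<open>simp add: Int_absorb2\<close>)
qed

lemma openin_paths_of_length: "openin (fin_path_topology E) (paths_of_length E n)"
  by (intro openin_fin_path_topology_of_length[of _ n]) (simp flip: topspace_path_topology)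

lemma openin_Vtx_image: "openin (vspace E) U \<Longrightarrow> openin (fin_path_topology E) (Vtx ` U)"
  by (intro openin_fin_path_topology_of_length[of _ 0]) (auto simp: openin_path_topology_0)

lemma openin_Vtx_vimage:
  assumes "openin (fin_path_topology E) S"
  shows "openin (vspace E) {v. Vtx v \<in> S}"
proof -
  obtain U where U: "openin (vspace E) U" "S \<inter> vertex_paths E = Vtx ` U"
    using assms by (metis openin_fin_path_topology openin_path_topology_0 paths_of_length_0)
  have "S \<subseteq> fin_paths E" using assms openin_fin_path_topology by blast
  then have "Vtx v \<in> vertex_paths E" if "Vtx v \<in> S" for v
    using that by (auto simp: fin_paths_def paths_of_length_def edge_paths_def split: if_splits)
  then have "{v. Vtx v \<in> S} = U"
    using U by blast
  with U show ?thesis by simp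
qed

lemma openin_edge_paths_nth:
  assumes "openin (espace E) B" "i < n"
  shows "openin (fin_path_topology E) {\<alpha> \<in> edge_paths E n. the_edges \<alpha> ! i \<in> B}"
proof (rule openin_fin_path_topology_of_length)
  show "openin (path_topology E n) {\<alpha> \<in> edge_paths E n. the_edges \<alpha> ! i \<in> B}"
    unfolding openin_path_topology_pos[OF le_less_trans[OF le0 assms(2)]]
  proof (intro conjI allI impI)
    fix xs assume xs: "Edges xs \<in> {\<alpha> \<in> edge_paths E n. the_edges \<alpha> ! i \<in> B}"
    show "\<exists>C. (\<forall>i<n. openin (espace E) (C i) \<and> xs ! i \<in> C i) \<and>
       (\<forall>ys. Edges ys \<in> edge_paths E n \<longrightarrow> (\<forall>i<n. ys ! i \<in> C i) \<longrightarrow> Edges ys \<in> {\<alpha> \<in> edge_paths E n. the_edges \<alpha> ! i \<in> B})"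
      using assms xs
      by (intro exI[of _ "\<lambda>j. if j = i then B else topspace (espace E)"])
         (auto simp: Edges_in_edge_paths_iff)
  qed auto
qed

locale top_graph =
  fixes E :: "('v, 'e) topgraph"
  assumes topological_graph: "topological_graph E"
begin

section \<open>The source map and the separation of finite paths\<close>

lemma Hausdorff_vspace: "Hausdorff_space (vspace E)"
  and Hausdorff_espace: "Hausdorff_space (espace E)"
  and locally_compact_vspace: "locally_compact_space (vspace E)"
  and locally_compact_espace: "locally_compact_space (espace E)"
  and continuous_rng: "continuous_map (espace E) (vspace E) (rng E)"
  and local_homeo_src: "local_homeomorphism (espace E) (vspace E) (src E)"
  using topological_graph by (auto simp: topological_graph_def)

text \<open>Continuity on U and openness of images inside U are the local facts from which
  \<open>continuous_src\<close> and \<open>open_map_src\<close> are glued. Injectivity on U later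
  makes the shift locally injective.\<close>

lemma src_locally_injective:
  assumes "e \<in> topspace (espace E)"
  obtains U where "openin (espace E) U" "e \<in> U" "inj_on (src E) U"
    "continuous_map (subtopology (espace E) U) (vspace E) (src E)"
    "\<And>W. openin (espace E) W \<Longrightarrow> W \<subseteq> U \<Longrightarrow> openin (vspace E) (src E ` W)"
proof -
  from local_homeo_src assms obtain U where U: "openin (espace E) U" "e \<in> U" "openin (vspace E) (src E ` U)"
    "homeomorphic_map (subtopology (espace E) U) (subtopology (vspace E) (src E ` U)) (src E)"
    unfolding local_homeomorphism_def by blast
  have UE: "topspace (subtopology (espace E) U) = U"
    using openin_subset[OF U(1)] by auto
  have "inj_on (src E) U"
    using homeomorphic_imp_injective_map[OF U(4)] UE by simp
  moreover have "continuous_map (subtopology (espace E) U) (vspace E) (src E)"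
    using homeomorphic_imp_continuous_map[OF U(4)] continuous_map_in_subtopology by blast
  moreover have "openin (vspace E) (src E ` W)" if W: "openin (espace E) W" "W \<subseteq> U" for W
  proof -
    have "openin (subtopology (espace E) U) W"
      using W by (simp add: openin_open_subtopology U)
    then have "openin (subtopology (vspace E) (src E ` U)) (src E ` W)"
      using homeomorphic_imp_open_map[OF U(4)] by (simp add: open_map_def)
    then show ?thesis using U(3) by (simp add: openin_open_subtopology)
  qed
  ultimately show ?thesis using that U by blast
qed

lemma continuous_src: "continuous_map (espace E) (vspace E) (src E)"
  unfolding continuous_map_def
proof (intro conjI allI impI)
  show "src E \<in> topspace (espace E) \<rightarrow> topspace (vspace E)"
  proof
    fix e assume "e \<in> topspace (espace E)"
    then obtain U where "openin (espace E) U" "e \<in> U"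
      "\<And>W. openin (espace E) W \<Longrightarrow> W \<subseteq> U \<Longrightarrow> openin (vspace E) (src E ` W)"
      by (rule src_locally_injective) blast
    then show "src E e \<in> topspace (vspace E)"
      using openin_subset[of "vspace E" "src E ` U"] by blast
  qed
  fix B assume B: "openin (vspace E) B"
  show "openin (espace E) {x \<in> topspace (espace E). src E x \<in> B}"
  proof (subst openin_subopen, intro ballI)
    fix e assume e: "e \<in> {x \<in> topspace (espace E). src E x \<in> B}"
    then obtain U where U: "openin (espace E) U" "e \<in> U"
      "continuous_map (subtopology (espace E) U) (vspace E) (src E)"
      by (metis (no_types, lifting) mem_Collect_eq src_locally_injective)
    have "openin (subtopology (espace E) U) {x \<in> topspace (subtopology (espace E) U). src E x \<in> B}"
      using U(3) B by (rule openin_continuous_map_preimage)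
    then show "\<exists>T. openin (espace E) T \<and> e \<in> T \<and> T \<subseteq> {x \<in> topspace (espace E). src E x \<in> B}"
      using U e by (intro exI[of _ "{x \<in> topspace (subtopology (espace E) U). src E x \<in> B}"])
        (auto simp: openin_open_subtopology)
  qed
qed

lemma open_map_src: "open_map (espace E) (vspace E) (src E)"
  unfolding open_map_def
proof (intro allI impI)
  fix B assume B: "openin (espace E) B"
  show "openin (vspace E) (src E ` B)"
  proof (subst openin_subopen, intro ballI)
    fix v assume "v \<in> src E ` B"
    then obtain e where e: "e \<in> B" "v = src E e" by blast
    have "e \<in> topspace (espace E)" using e openin_subset[OF B] by blast
    then obtain U where U: "openin (espace E) U" "e \<in> U"
      "\<And>W. openin (espace E) W \<Longrightarrow> W \<subseteq> U \<Longrightarrow> openin (vspace E) (src E ` W)"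
      by (rule src_locally_injective) blast
    show "\<exists>T. openin (vspace E) T \<and> v \<in> T \<and> T \<subseteq> src E ` B"
      using e U B by (intro exI[of _ "src E ` (U \<inter> B)"]) (auto simp: openin_Int)
  qed
qed

text \<open>The source of a path of positive length depends on its last edge only, so the preimage
  is an open condition on one coordinate.\<close>

lemma openin_edge_paths_src:
  assumes "openin (vspace E) B"
  shows "openin (fin_path_topology E) {\<alpha> \<in> paths_of_length E n. path_src E \<alpha> \<in> B}"
proof (cases n)
  case 0
  have "{\<alpha> \<in> paths_of_length E 0. path_src E \<alpha> \<in> B} = Vtx ` B"
    using openin_subset[OF assms] by (auto simp: paths_of_length_0 vertex_paths_def)
  then show ?thesis using 0 assms openin_Vtx_image by simp
next
  case (Suc m)
  let ?B = "{e \<in> topspace (espace E). src E e \<in> B}"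
  have "openin (espace E) ?B"
    using continuous_src assms by (rule openin_continuous_map_preimage)
  then have "openin (fin_path_topology E) {\<alpha> \<in> edge_paths E n. the_edges \<alpha> ! m \<in> ?B}"
    using Suc by (intro openin_edge_paths_nth) auto
  also have "{\<alpha> \<in> edge_paths E n. the_edges \<alpha> ! m \<in> ?B} = {\<alpha> \<in> paths_of_length E n. path_src E \<alpha> \<in> B}"
  proof -
    have "the_edges \<alpha> ! m \<in> ?B \<longleftrightarrow> path_src E \<alpha> \<in> B" if "\<alpha> \<in> edge_paths E n" for \<alpha>
    proof -
      from that obtain xs where xs: "\<alpha> = Edges xs" "length xs = Suc m" "\<forall>i<n. xs ! i \<in> topspace (espace E)"
        using Suc by (metis Edges_in_edge_paths_iff edge_pathsE)
      then have "last xs = xs ! m" by (cases xs rule: rev_cases) auto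
      then show ?thesis using xs Suc by auto
    qed
    then show ?thesis using Suc by (auto simp: paths_of_length_Suc)
  qed
  finally show ?thesis .
qed

text \<open>Different lengths are separated by the open layers \<open>paths_of_length\<close>, equal
  lengths by a coordinate in which the paths differ.\<close>

lemma Hausdorff_fin_path_topology: "Hausdorff_space (fin_path_topology E)"
  unfolding Hausdorff_space_def topspace_fin_path_topology
proof (intro allI impI)
  fix \<alpha> \<beta> assume ab: "\<alpha> \<in> fin_paths E \<and> \<beta> \<in> fin_paths E \<and> \<alpha> \<noteq> \<beta>"
  then obtain m n where mn: "\<alpha> \<in> paths_of_length E m" "\<beta> \<in> paths_of_length E n"
    by (auto simp: fin_paths_def)
  show "\<exists>U V. openin (fin_path_topology E) U \<and> openin (fin_path_topology E) V \<and> \<alpha> \<in> U \<and> \<beta> \<in> V \<and> disjnt U V"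
  proof (cases "m = n")
    case False
    then have "disjnt (paths_of_length E m) (paths_of_length E n)"
      unfolding disjnt_iff using paths_of_length_disjoint by blast
    then show ?thesis using mn openin_paths_of_length by blast
  next
    case mn': True
    show ?thesis
    proof (cases "n = 0")
      case True
      then obtain v w where vw: "\<alpha> = Vtx v" "\<beta> = Vtx w" "v \<in> topspace (vspace E)" "w \<in> topspace (vspace E)"
        using mn mn' by (auto simp: paths_of_length_0 vertex_paths_def)
      then obtain U V where "openin (vspace E) U" "openin (vspace E) V" "v \<in> U" "w \<in> V" "disjnt U V"
        using Hausdorff_vspace ab unfolding Hausdorff_space_def by blast
      then show ?thesis
        using vw by (intro exI[of _ "Vtx ` U"] exI[of _ "Vtx ` V"]) (auto simp: openin_Vtx_image disjnt_def)
    next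
      case False
      then obtain xs ys where xy: "\<alpha> = Edges xs" "\<beta> = Edges ys" "\<alpha> \<in> edge_paths E n" "\<beta> \<in> edge_paths E n"
        using mn mn' by (metis edge_pathsE paths_of_length_pos bot_nat_0.not_eq_extremum)
      then obtain i where i: "i < n" "xs ! i \<noteq> ys ! i"
        using ab by (metis Edges_in_edge_paths_iff nth_equalityI)
      moreover have "xs ! i \<in> topspace (espace E)" "ys ! i \<in> topspace (espace E)"
        using xy i by (auto simp: Edges_in_edge_paths_iff)
      ultimately obtain U V where "openin (espace E) U" "openin (espace E) V" "xs ! i \<in> U" "ys ! i \<in> V" "disjnt U V"
        using Hausdorff_espace unfolding Hausdorff_space_def by blast
      then show ?thesis
        using xy i by (intro exI[of _ "{\<alpha> \<in> edge_paths E n. the_edges \<alpha> ! i \<in> U}"]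
          exI[of _ "{\<alpha> \<in> edge_paths E n. the_edges \<alpha> ! i \<in> V}"]) (auto simp: openin_edge_paths_nth disjnt_def)
    qed
  qed
qed

section \<open>The shift on finite paths\<close>

lemma shift_paths_of_length:
  assumes "\<alpha> \<in> paths_of_length E (Suc n)"
  shows "shift E \<alpha> \<in> paths_of_length E n"
proof -
  obtain xs where xs: "\<alpha> = Edges xs" "Edges xs \<in> edge_paths E (Suc n)"
    using assms unfolding paths_of_length_Suc by (rule edge_pathsE)
  then obtain y ys where "xs = y # ys" by (cases xs) (auto simp: Edges_in_edge_paths_iff)
  then show ?thesis
    using xs continuous_map_funspace[OF continuous_src]
    by (force simp: paths_of_length_def vertex_paths_def Edges_in_edge_paths_iff)
qed

text \<open>Dropping the first edge of a box leaves a box and one extra condition: the range of the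
  new first edge lies in the image of \<open>B 0\<close> under \<open>src\<close>, which is open
  because \<open>src\<close> is an open map. For paths of length one only this image
  remains.\<close>

lemma openin_shift_image:
  assumes S: "openin (fin_path_topology E) S" "S \<inter> vertex_paths E = {}"
  shows "openin (fin_path_topology E) (shift E ` S)"
proof -
  have "openin (path_topology E n) (shift E ` (S \<inter> paths_of_length E (Suc n)))" for n
  proof -
    have S': "openin (path_topology E (Suc n)) (S \<inter> paths_of_length E (Suc n))"
      using S(1) openin_fin_path_topology by blast
    let ?S = "S \<inter> paths_of_length E (Suc n)"
    note * = S'[unfolded openin_path_topology_pos[OF zero_less_Suc], THEN conjunct2, rule_format]
    show ?thesis
    proof (subst openin_subopen, intro ballI)
      fix \<beta> assume "\<beta> \<in> shift E ` ?S"
      then obtain xs where xs: "\<beta> = shift E (Edges xs)" "Edges xs \<in> ?S" "Edges xs \<in> edge_paths E (Suc n)"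
        unfolding paths_of_length_Suc by (auto simp: edge_paths_def)
      obtain B where B: "\<And>i. i < Suc n \<Longrightarrow> openin (espace E) (B i) \<and> xs ! i \<in> B i"
        "\<And>ys. Edges ys \<in> edge_paths E (Suc n) \<Longrightarrow> (\<forall>i<Suc n. ys ! i \<in> B i) \<Longrightarrow> Edges ys \<in> ?S"
        using *[OF xs(2)] by blast
      obtain x xs' where x: "xs = x # xs'" "length xs' = n" using xs by (cases xs) (auto simp: Edges_in_edge_paths_iff)
      have s0: "openin (vspace E) (src E ` B 0)"
        using open_map_src B(1)[of 0] by (auto simp: open_map_def)
      show "\<exists>T. openin (path_topology E n) T \<and> \<beta> \<in> T \<and> T \<subseteq> shift E ` ?S"
      proof (cases n)
        case 0
        have "Edges [e] \<in> ?S" if "e \<in> B 0" for e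
        proof -
          have "e \<in> topspace (espace E)" using B(1)[of 0] that openin_subset by blast
          then show ?thesis using 0 B(2)[of "[e]"] that by (simp add: Edges_in_edge_paths_iff)
        qed
        moreover have "Vtx (src E e) = shift E (Edges [e])" for e by simp
        ultimately have "Vtx ` src E ` B 0 \<subseteq> shift E ` ?S"
          by (metis (no_types, lifting) image_eqI image_image image_subsetI)
        moreover have "openin (path_topology E n) (Vtx ` src E ` B 0)"
          using s0 0 by (auto simp: openin_path_topology_0)
        ultimately show ?thesis using B(1)[of 0] x xs 0 by (intro exI[of _ "Vtx ` src E ` B 0"]) auto
      next
        case (Suc m)
        have n: "n > 0" using Suc by simp
        have r0: "openin (espace E) {e \<in> topspace (espace E). rng E e \<in> src E ` B 0}"
          using continuous_rng s0 by (rule openin_continuous_map_preimage)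
        \<comment> \<open>The shifts of the paths in the box; what survives of the dropped edge is
          the condition on the range of the new first edge.\<close>
        define T where "T = {\<alpha> \<in> edge_paths E n. (\<forall>i<n. the_edges \<alpha> ! i \<in> B (Suc i)) \<and> rng E (the_edges \<alpha> ! 0) \<in> src E ` B 0}"
        have "openin (path_topology E n) T"
          unfolding openin_path_topology_pos[OF n]
        proof (intro conjI allI impI)
          fix zs assume "Edges zs \<in> T"
          then show "\<exists>C. (\<forall>i<n. openin (espace E) (C i) \<and> zs ! i \<in> C i) \<and>
               (\<forall>ys. Edges ys \<in> edge_paths E n \<longrightarrow> (\<forall>i<n. ys ! i \<in> C i) \<longrightarrow> Edges ys \<in> T)"
            using r0 B(1)[of "Suc i" for i] n
            by (intro exI[of _ "\<lambda>i. if i = 0 then B (Suc i) \<inter> {e \<in> topspace (espace E). rng E e \<in> src E ` B 0} else B (Suc i)"])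
              (auto simp: T_def openin_Int Edges_in_edge_paths_iff)
        qed (auto simp: T_def)
        moreover have "\<beta> \<in> T"
        proof -
          have "\<beta> = Edges xs'" using xs x n by auto
          moreover have "Edges xs' \<in> edge_paths E n"
            using xs(3) x by (force simp: Edges_in_edge_paths_iff)
          moreover have "xs' ! i \<in> B (Suc i)" if "i < n" for i
            using B(1)[of "Suc i"] that x by simp
          moreover have "rng E (xs' ! 0) \<in> src E ` B 0"
          proof -
            have "src E x = rng E (xs' ! 0)"
              using xs(3) x n by (auto simp: Edges_in_edge_paths_iff)
            then show ?thesis using B(1)[of 0] x by (auto intro: image_eqI[of _ _ x])
          qed
          ultimately show ?thesis by (auto simp: T_def)
        qed
        moreover have "T \<subseteq> shift E ` ?S"
        proof
          fix \<gamma> assume g: "\<gamma> \<in> T"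
          then have "\<gamma> \<in> edge_paths E n" by (simp add: T_def)
          then obtain ys where ys: "\<gamma> = Edges ys" "Edges ys \<in> edge_paths E n" "length ys = n"
            by (rule edge_pathsE)
          \<comment> \<open>An edge of \<open>B 0\<close> whose source is the range of
            \<open>ys\<close> can be put in front, and the longer path lies in the box.\<close>
          obtain e where e: "e \<in> B 0" "rng E (ys ! 0) = src E e"
            using g ys by (auto simp: T_def)
          have "e \<in> topspace (espace E)" using B(1)[of 0] e openin_subset by fastforce
          then have "Edges (e # ys) \<in> edge_paths E (Suc n)"
            using ys e by (auto simp: Edges_in_edge_paths_iff nth_Cons split: nat.split)
          moreover have "\<forall>i<Suc n. (e # ys) ! i \<in> B i"
            using g ys e by (auto simp: T_def nth_Cons split: nat.split)
          ultimately have "Edges (e # ys) \<in> ?S" using B(2) by blast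
          then show "\<gamma> \<in> shift E ` ?S"
            using ys n by (intro image_eqI[of _ _ "Edges (e # ys)"]) auto
        qed
        ultimately show ?thesis by blast
      qed
    qed
  qed
  then have "openin (fin_path_topology E) (\<Union>n. shift E ` (S \<inter> paths_of_length E (Suc n)))"
    by (intro openin_Union) (auto intro: openin_fin_path_topology_of_length)
  also have "(\<Union>n. shift E ` (S \<inter> paths_of_length E (Suc n))) = shift E ` S"
  proof -
    have "\<exists>n. \<alpha> \<in> paths_of_length E (Suc n)" if \<alpha>: "\<alpha> \<in> S" for \<alpha>
    proof -
      have "\<alpha> \<in> fin_paths E"
        using openin_subset[OF S(1)] \<alpha> by (auto simp: topspace_fin_path_topology)
      then obtain n where "\<alpha> \<in> paths_of_length E n"
        by (auto simp: fin_paths_def)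
      moreover have "n \<noteq> 0" using calculation S(2) \<alpha> by (metis disjoint_iff paths_of_length_0)
      ultimately show ?thesis by (metis not0_implies_Suc)
    qed
    then show ?thesis by blast
  qed
  finally show ?thesis .
qed

text \<open>On paths of length one the shift is \<open>src\<close> followed by \<open>Vtx\<close>,
  on longer ones it forgets the first coordinate; the layers are open, so each can be treated alone.
  Continuity is what pushes compact sets of finite paths forward.\<close>

lemma continuous_map_shift:
  "continuous_map (subtopology (fin_path_topology E) (fin_paths E - vertex_paths E)) (fin_path_topology E) (shift E)"
proof -
  have ex: "\<exists>n. \<alpha> \<in> paths_of_length E (Suc n)" if \<alpha>: "\<alpha> \<in> fin_paths E - vertex_paths E" for \<alpha>
  proof -
    obtain n where "\<alpha> \<in> paths_of_length E n" using \<alpha> by (auto simp: fin_paths_def)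
    moreover have "n \<noteq> 0" using calculation \<alpha> by (metis DiffD2 paths_of_length_0)
    ultimately show ?thesis by (metis not0_implies_Suc)
  qed
  have main: "openin (fin_path_topology E) {\<alpha> \<in> paths_of_length E (Suc n). shift E \<alpha> \<in> S}"
    if S: "openin (fin_path_topology E) S" for S n
  proof (cases n)
    case 0
    let ?B = "{e \<in> topspace (espace E). src E e \<in> {v. Vtx v \<in> S}}"
    have "openin (espace E) ?B"
      using continuous_src openin_Vtx_vimage[OF S] by (rule openin_continuous_map_preimage)
    then have "openin (fin_path_topology E) {\<alpha> \<in> edge_paths E (Suc 0). the_edges \<alpha> ! 0 \<in> ?B}"
      by (intro openin_edge_paths_nth) auto
    also have "{\<alpha> \<in> edge_paths E (Suc 0). the_edges \<alpha> ! 0 \<in> ?B} = {\<alpha> \<in> paths_of_length E (Suc n). shift E \<alpha> \<in> S}"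
    proof -
      have "the_edges \<alpha> ! 0 \<in> ?B \<longleftrightarrow> shift E \<alpha> \<in> S" if "\<alpha> \<in> edge_paths E (Suc 0)" for \<alpha>
        using that by (auto simp: edge_paths_def length_Suc_conv)
      then show ?thesis by (auto simp: 0 paths_of_length_Suc)
    qed
    finally show ?thesis .
  next
    case (Suc m)
    then have n: "n > 0" by simp
    have S': "openin (path_topology E n) (S \<inter> paths_of_length E n)"
      using S openin_fin_path_topology by blast
    note * = S'[unfolded openin_path_topology_pos[OF n], THEN conjunct2, rule_format]
    show ?thesis
    proof (rule openin_fin_path_topology_of_length[of _ "Suc n"], unfold openin_path_topology_pos[OF zero_less_Suc], intro conjI allI impI)
      fix xs assume xs: "Edges xs \<in> {\<alpha> \<in> paths_of_length E (Suc n). shift E \<alpha> \<in> S}"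
      then have "shift E (Edges xs) \<in> S \<inter> paths_of_length E n"
        using shift_paths_of_length by blast
      moreover from xs have len: "length xs = Suc n" "set xs \<subseteq> topspace (espace E)"
        by (auto simp: paths_of_length_Suc edge_paths_def)
      ultimately have "Edges (tl xs) \<in> S \<inter> paths_of_length E n" using n by simp
      from *[OF this] obtain B where B: "\<And>i. i < n \<Longrightarrow> openin (espace E) (B i) \<and> tl xs ! i \<in> B i"
        "\<And>ys. Edges ys \<in> edge_paths E n \<Longrightarrow> (\<forall>i<n. ys ! i \<in> B i) \<Longrightarrow> Edges ys \<in> S \<inter> paths_of_length E n"
        by blast
      show "\<exists>C. (\<forall>i<Suc n. openin (espace E) (C i) \<and> xs ! i \<in> C i) \<and>
           (\<forall>ys. Edges ys \<in> edge_paths E (Suc n) \<longrightarrow> (\<forall>i<Suc n. ys ! i \<in> C i) \<longrightarrow>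
              Edges ys \<in> {\<alpha> \<in> paths_of_length E (Suc n). shift E \<alpha> \<in> S})"
      proof (intro exI[of _ "\<lambda>i. if i = 0 then topspace (espace E) else B (i - 1)"] conjI allI impI)
        fix i assume i: "i < Suc n"
        show "openin (espace E) (if i = 0 then topspace (espace E) else B (i - 1))"
          using B(1)[of "i - 1"] i by auto
        show "xs ! i \<in> (if i = 0 then topspace (espace E) else B (i - 1))"
          using B(1)[of "i - 1"] i len by (auto simp: nth_tl)
      next
        fix ys assume ys: "Edges ys \<in> edge_paths E (Suc n)" "\<forall>i<Suc n. ys ! i \<in> (if i = 0 then topspace (espace E) else B (i - 1))"
        then have yl: "length ys = Suc n" by (simp add: Edges_in_edge_paths_iff)
        have "shift E (Edges ys) \<in> paths_of_length E n"
          using ys(1) by (intro shift_paths_of_length) (simp add: paths_of_length_Suc)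
        then have "Edges (tl ys) \<in> edge_paths E n" using n yl by (simp add: paths_of_length_pos)
        moreover have "\<forall>i<n. tl ys ! i \<in> B i"
          using ys(2) yl by (auto simp: nth_tl)
        ultimately have "Edges (tl ys) \<in> S" using B(2) by blast
        then show "Edges ys \<in> {\<alpha> \<in> paths_of_length E (Suc n). shift E \<alpha> \<in> S}"
          using ys yl n by (auto simp: paths_of_length_Suc)
      qed
    qed (auto simp: paths_of_length_Suc)
  qed
  show ?thesis
    unfolding continuous_map_def
  proof (intro conjI allI impI)
    show "shift E \<in> topspace (subtopology (fin_path_topology E) (fin_paths E - vertex_paths E)) \<rightarrow> topspace (fin_path_topology E)"
      using ex shift_paths_of_length by (fastforce simp: topspace_fin_path_topology fin_paths_def)
    fix S assume S: "openin (fin_path_topology E) S"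
    have "{\<alpha> \<in> topspace (subtopology (fin_path_topology E) (fin_paths E - vertex_paths E)). shift E \<alpha> \<in> S} =
      (\<Union>n. {\<alpha> \<in> paths_of_length E (Suc n). shift E \<alpha> \<in> S}) \<inter> (fin_paths E - vertex_paths E)"
      using ex by (auto simp: topspace_fin_path_topology)
    also have "openin (subtopology (fin_path_topology E) (fin_paths E - vertex_paths E)) \<dots>"
      using main[OF S] by (intro openin_subtopology_Int openin_Union) auto
    finally show "openin (subtopology (fin_path_topology E) (fin_paths E - vertex_paths E))
       {\<alpha> \<in> topspace (subtopology (fin_path_topology E) (fin_paths E - vertex_paths E)). shift E \<alpha> \<in> S}" .
  qed
qed

end

section \<open>Cylinder sets and the shift\<close>

text \<open>Extends \<open>initial_segment\<close> to n = 0, where the segment is the range vertex.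
  The two alternatives in \<open>cylinder\<close> then merge into one existential over n.\<close>

definition segment :: "('v, 'e) topgraph \<Rightarrow> nat \<Rightarrow> ('v, 'e) gpath \<Rightarrow> ('v, 'e) gpath" where
  "segment E n \<alpha> = (if n = 0 then Vtx (path_rng E \<alpha>) else initial_segment n \<alpha>)"

lemma cylinder_iff:
  "\<alpha> \<in> cylinder E S \<longleftrightarrow> \<alpha> \<in> boundary_paths E \<and> (\<exists>n. enat n \<le> plen \<alpha> \<and> segment E n \<alpha> \<in> S)"
proof
  assume "\<alpha> \<in> cylinder E S"
  then consider "\<alpha> \<in> boundary_paths E" "Vtx (path_rng E \<alpha>) \<in> S"
    | n where "\<alpha> \<in> boundary_paths E" "n \<ge> 1" "enat n \<le> plen \<alpha>" "initial_segment n \<alpha> \<in> S"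
    unfolding cylinder_def by blast
  then show "\<alpha> \<in> boundary_paths E \<and> (\<exists>n. enat n \<le> plen \<alpha> \<and> segment E n \<alpha> \<in> S)"
  proof cases
    case 1 then show ?thesis by (intro conjI exI[of _ 0]) (simp_all add: segment_def flip: zero_enat_def)
  next
    case (2 n) then show ?thesis by (intro conjI exI[of _ n]) (simp_all add: segment_def)
  qed
next
  assume "\<alpha> \<in> boundary_paths E \<and> (\<exists>n. enat n \<le> plen \<alpha> \<and> segment E n \<alpha> \<in> S)"
  then obtain n where n: "\<alpha> \<in> boundary_paths E" "enat n \<le> plen \<alpha>" "segment E n \<alpha> \<in> S" by blast
  then show "\<alpha> \<in> cylinder E S"
    unfolding cylinder_def segment_def by (cases n) (auto intro: exI[of _ n])
qed

lemma cylinder_subset: "cylinder E S \<subseteq> boundary_paths E"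
  by (auto simp: cylinder_def)

lemma cylinder_mono: "S \<subseteq> T \<Longrightarrow> cylinder E S \<subseteq> cylinder E T"
  by (auto simp: cylinder_def)

lemma boundary_paths_cases:
  assumes "\<alpha> \<in> boundary_paths E"
  obtains (vertex) v where "\<alpha> = Vtx v" "v \<in> topspace (vspace E)" "v \<in> singular_vertices E"
  | (edges) x xs where "\<alpha> = Edges (x # xs)" "\<alpha> \<in> edge_paths E (Suc (length xs))" "path_src E \<alpha> \<in> singular_vertices E"
  | (infinite) f where "\<alpha> = Inf_path f" "\<And>i. f i \<in> topspace (espace E)" "\<And>i. src E (f i) = rng E (f (Suc i))"
proof -
  consider "\<alpha> \<in> inf_paths E" | "\<alpha> \<in> sing_paths E"
    using assms by (auto simp: boundary_paths_def)
  then show ?thesis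
  proof cases
    case 1 then show ?thesis using infinite by (auto simp: inf_paths_def)
  next
    case 2
    then obtain n where n: "\<alpha> \<in> paths_of_length E n" "path_src E \<alpha> \<in> singular_vertices E"
      by (auto simp: sing_paths_def fin_paths_def)
    show ?thesis
    proof (cases n)
      case 0
      then show ?thesis using n vertex by (auto simp: paths_of_length_0 vertex_paths_def)
    next
      case (Suc m)
      then obtain xs where xs: "\<alpha> = Edges xs" "\<alpha> \<in> edge_paths E (Suc m)" "length xs = Suc m"
        using n by (metis edge_pathsE paths_of_length_Suc)
      then show ?thesis using edges n by (cases xs) auto
    qed
  qed
qed

lemma fin_paths_cases:
  assumes "\<alpha> \<in> fin_paths E"
  obtains (vertex) v where "\<alpha> = Vtx v" "v \<in> topspace (vspace E)"
  | (edges) x xs where "\<alpha> = Edges (x # xs)" "\<alpha> \<in> edge_paths E (Suc (length xs))"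
proof -
  obtain n where n: "\<alpha> \<in> paths_of_length E n"
    using assms by (auto simp: fin_paths_def)
  show ?thesis
  proof (cases n)
    case 0
    then show ?thesis using n vertex by (auto simp: paths_of_length_0 vertex_paths_def)
  next
    case (Suc m)
    then obtain xs where xs: "\<alpha> = Edges xs" "\<alpha> \<in> edge_paths E (Suc m)" "length xs = Suc m"
      using n by (metis edge_pathsE paths_of_length_Suc)
    then show ?thesis using edges n by (cases xs) auto
  qed
qed

lemma Edges_Cons_in_edge_paths_iff:
  "Edges (x # xs) \<in> edge_paths E n \<longleftrightarrow> n = Suc (length xs) \<and> x \<in> topspace (espace E) \<and>
     (xs \<noteq> [] \<longrightarrow> src E x = rng E (hd xs) \<and> Edges xs \<in> edge_paths E (length xs))"
  (is "?L \<longleftrightarrow> ?R")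
proof
  assume L: ?L
  have "\<forall>i<length xs. xs ! i \<in> topspace (espace E)"
  proof (intro allI impI)
    fix i assume "i < length xs"
    then show "xs ! i \<in> topspace (espace E)"
      using L by (auto simp: Edges_in_edge_paths_iff dest!: spec[of _ "Suc i"])
  qed
  moreover have "src E (xs ! i) = rng E (xs ! Suc i)" if "Suc i < length xs" for i
    using L that by (auto simp: Edges_in_edge_paths_iff dest!: spec[of _ "Suc i"])
  ultimately show ?R
    using L by (force simp: Edges_in_edge_paths_iff hd_conv_nth)
next
  assume ?R
  then show ?L
    by (auto simp: Edges_in_edge_paths_iff nth_Cons hd_conv_nth split: nat.split)
qed

lemma edge_paths_subset_fin_paths: "n > 0 \<Longrightarrow> edge_paths E n \<subseteq> fin_paths E"
  unfolding fin_paths_def by (metis UN_upper UNIV_I paths_of_length_pos)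

lemma Edges_Cons_in_fin_paths_iff:
  "Edges (x # xs) \<in> fin_paths E \<longleftrightarrow> Edges (x # xs) \<in> edge_paths E (Suc (length xs))"
proof
  assume "Edges (x # xs) \<in> fin_paths E"
  then show "Edges (x # xs) \<in> edge_paths E (Suc (length xs))"
    by (cases rule: fin_paths_cases) auto
qed (use edge_paths_subset_fin_paths in blast)

lemma Vtx_in_fin_paths_iff: "Vtx v \<in> fin_paths E \<longleftrightarrow> v \<in> topspace (vspace E)"
proof
  assume "Vtx v \<in> fin_paths E"
  then show "v \<in> topspace (vspace E)"
    by (cases rule: fin_paths_cases) auto
next
  assume "v \<in> topspace (vspace E)"
  then have "Vtx v \<in> paths_of_length E 0" by (auto simp: paths_of_length_0 vertex_paths_def)
  then show "Vtx v \<in> fin_paths E" unfolding fin_paths_def by blast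
qed

lemma not_Edges_Nil: "Edges [] \<notin> fin_paths E"
proof
  assume "Edges [] \<in> fin_paths E"
  then show False by (cases rule: fin_paths_cases) auto
qed

lemma Inf_path_not_fin_path: "Inf_path f \<notin> fin_paths E"
proof
  assume "Inf_path f \<in> fin_paths E"
  then show False by (cases rule: fin_paths_cases) auto
qed

lemma Edges_not_vertex: "Edges xs \<notin> vertex_paths E"
  by (auto simp: vertex_paths_def)

text \<open>A right inverse of the shift. The vertex of a path of length 0 is forgotten, because it
  is the source of \<open>e\<close> whenever prepending gives a path.\<close>

fun cons_path :: "'e \<Rightarrow> ('v, 'e) gpath \<Rightarrow> ('v, 'e) gpath" where
  "cons_path e (Vtx v) = Edges [e]"
| "cons_path e (Edges xs) = Edges (e # xs)"
| "cons_path e (Inf_path f) = Inf_path (case_nat e f)"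

context top_graph
begin

section \<open>Segments of boundary paths\<close>

lemma rng_in_vspace: "e \<in> topspace (espace E) \<Longrightarrow> rng E e \<in> topspace (vspace E)"
  and src_in_vspace: "e \<in> topspace (espace E) \<Longrightarrow> src E e \<in> topspace (vspace E)"
  using continuous_map_funspace[OF continuous_rng] continuous_map_funspace[OF continuous_src] by auto

lemma path_rng_in_vspace: "\<alpha> \<in> boundary_paths E \<Longrightarrow> path_rng E \<alpha> \<in> topspace (vspace E)"
  by (erule boundary_paths_cases) (auto simp: Edges_Cons_in_edge_paths_iff rng_in_vspace)

lemma segment_in_paths_of_length:
  assumes "\<alpha> \<in> boundary_paths E" "enat n \<le> plen \<alpha>"
  shows "segment E n \<alpha> \<in> paths_of_length E n"
proof (cases "n = 0")
  case True
  then show ?thesis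
    using path_rng_in_vspace assms by (auto simp: segment_def paths_of_length_0 vertex_paths_def)
next
  case False
  then have s: "segment E n \<alpha> = initial_segment n \<alpha>" "paths_of_length E n = edge_paths E n"
    by (auto simp: segment_def paths_of_length_def)
  show ?thesis using assms(1)
  proof (cases rule: boundary_paths_cases)
    case (vertex v)
    then show ?thesis using assms False by (simp add: zero_enat_def)
  next
    case (edges x xs)
    then show ?thesis using assms(2) unfolding s by (auto simp: Edges_in_edge_paths_iff)
  next
    case (infinite f)
    then show ?thesis using assms(2) unfolding s by (auto simp: Edges_in_edge_paths_iff)
  qed
qed

text \<open>Segments of different lengths lie in disjoint layers, so the existential in
  \<open>cylinder_iff\<close> can only be met at n.\<close>

lemma segment_in_cylinder_iff:
  assumes "S \<subseteq> paths_of_length E n" "\<alpha> \<in> boundary_paths E"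
  shows "\<alpha> \<in> cylinder E S \<longleftrightarrow> enat n \<le> plen \<alpha> \<and> segment E n \<alpha> \<in> S"
proof
  assume "\<alpha> \<in> cylinder E S"
  then obtain m where m: "enat m \<le> plen \<alpha>" "segment E m \<alpha> \<in> S" by (auto simp: cylinder_iff)
  then have "m = n"
    using segment_in_paths_of_length[OF assms(2)] assms(1) paths_of_length_disjoint by blast
  then show "enat n \<le> plen \<alpha> \<and> segment E n \<alpha> \<in> S" using m by simp
qed (use assms in \<open>auto simp: cylinder_iff\<close>)

lemma cylinder_paths_of_length:
  "cylinder E (paths_of_length E n) = {\<alpha> \<in> boundary_paths E. enat n \<le> plen \<alpha>}"
  using segment_in_cylinder_iff[OF order_refl] segment_in_paths_of_length cylinder_subset by blast

lemma shift_boundary_path: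
  assumes "\<alpha> \<in> boundary_paths E" "\<alpha> \<notin> vertex_paths E"
  shows "shift E \<alpha> \<in> boundary_paths E"
  using assms(1)
proof (cases rule: boundary_paths_cases)
  case (vertex v)
  then show ?thesis using assms by (auto simp: vertex_paths_def)
next
  case (edges x xs)
  show ?thesis
  proof (cases xs)
    case Nil
    then show ?thesis
      using edges by (auto simp: boundary_paths_def sing_paths_def Vtx_in_fin_paths_iff
        Edges_Cons_in_edge_paths_iff src_in_vspace)
  next
    case (Cons y ys)
    then show ?thesis
      using edges by (auto simp: boundary_paths_def sing_paths_def Edges_Cons_in_fin_paths_iff
        Edges_Cons_in_edge_paths_iff)
  qed
next
  case (infinite f)
  then show ?thesis by (auto simp: boundary_paths_def inf_paths_def)
qed

lemma plen_shift:
  assumes "\<alpha> \<in> boundary_paths E" "\<alpha> \<notin> vertex_paths E"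
  shows "enat (Suc n) \<le> plen \<alpha> \<longleftrightarrow> enat n \<le> plen (shift E \<alpha>)"
  using assms(1)
proof (cases rule: boundary_paths_cases)
  case (vertex v)
  then show ?thesis using assms by (auto simp: vertex_paths_def)
next
  case (edges x xs)
  then show ?thesis by (auto simp: zero_enat_def)
qed (use assms in auto)

lemma segment_shift:
  assumes "\<alpha> \<in> boundary_paths E" "enat (Suc n) \<le> plen \<alpha>"
  shows "segment E n (shift E \<alpha>) = shift E (segment E (Suc n) \<alpha>)"
  using assms(1)
proof (cases rule: boundary_paths_cases)
  case (vertex v)
  then show ?thesis using assms by (simp add: zero_enat_def)
next
  case (edges x xs)
  then show ?thesis using assms
    by (cases xs; cases n) (auto simp: segment_def Edges_Cons_in_edge_paths_iff)
next
  case (infinite f)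
  have "map f [0..<Suc n] = f 0 # map (\<lambda>n. f (Suc n)) [0..<n]"
    by (simp add: upt_conv_Cons map_Suc_upt[symmetric] del: upt_Suc)
  then show ?thesis using infinite by (cases n) (auto simp: segment_def simp del: upt_Suc)
qed

lemma path_rng_segment:
  assumes "\<alpha> \<in> boundary_paths E" "enat n \<le> plen \<alpha>"
  shows "path_rng E (segment E n \<alpha>) = path_rng E \<alpha>"
  using assms(1)
proof (cases rule: boundary_paths_cases)
  case (vertex v)
  then show ?thesis using assms by (simp add: segment_def)
next
  case (edges x xs)
  then show ?thesis using assms by (auto simp: segment_def)
next
  case (infinite f)
  then show ?thesis using assms by (auto simp: segment_def hd_map)
qed

lemma non_vertex_iff:
  assumes "\<alpha> \<in> boundary_paths E"
  shows "\<alpha> \<notin> vertex_paths E \<longleftrightarrow> enat 1 \<le> plen \<alpha>"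
  using assms(1)
  by (cases rule: boundary_paths_cases) (auto simp: vertex_paths_def zero_enat_def)

lemma path_rng_cons_path: "path_rng E (cons_path e \<beta>) = rng E e"
  by (cases \<beta>) auto

lemma cons_path_boundary:
  assumes "\<beta> \<in> boundary_paths E" "e \<in> topspace (espace E)" "src E e = path_rng E \<beta>"
  shows "cons_path e \<beta> \<in> boundary_paths E - vertex_paths E" "shift E (cons_path e \<beta>) = \<beta>"
    "segment E 1 (cons_path e \<beta>) = Edges [e]"
proof -
  have "cons_path e \<beta> \<in> boundary_paths E - vertex_paths E \<and> shift E (cons_path e \<beta>) = \<beta> \<and>
    segment E 1 (cons_path e \<beta>) = Edges [e]" (is ?Q)
    using assms(1)
  proof (cases rule: boundary_paths_cases)
    case (vertex v)
    then show ?Q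
      using assms by (auto simp: segment_def boundary_paths_def sing_paths_def vertex_paths_def
          Edges_Cons_in_fin_paths_iff Edges_Cons_in_edge_paths_iff)
  next
    case (edges x xs)
    then show ?Q
      using assms by (auto simp: segment_def boundary_paths_def sing_paths_def vertex_paths_def
          Edges_Cons_in_fin_paths_iff Edges_Cons_in_edge_paths_iff[of e])
  next
    case (infinite f)
    then show ?Q
      using assms by (auto simp: segment_def boundary_paths_def inf_paths_def vertex_paths_def split: nat.split)
  qed
  then show "cons_path e \<beta> \<in> boundary_paths E - vertex_paths E" "shift E (cons_path e \<beta>) = \<beta>"
    "segment E 1 (cons_path e \<beta>) = Edges [e]" by blast+
qed

text \<open>A path is recovered by prepending its first edge to its shift; \<open>cons_path\<close>
  turns this into an equation.\<close>

lemma shift_first_edge_inj: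
  assumes "\<alpha> \<in> boundary_paths E - vertex_paths E" "\<beta> \<in> boundary_paths E - vertex_paths E"
    "segment E 1 \<alpha> = segment E 1 \<beta>" "shift E \<alpha> = shift E \<beta>"
  shows "\<alpha> = \<beta>"
proof -
  have "\<gamma> = cons_path (hd (the_edges (segment E 1 \<gamma>))) (shift E \<gamma>)"
    if "\<gamma> \<in> boundary_paths E - vertex_paths E" for \<gamma>
  proof -
    from that have "\<gamma> \<in> boundary_paths E" by blast
    then show ?thesis
    proof (cases rule: boundary_paths_cases)
      case (vertex v)
      then show ?thesis using that by (auto simp: vertex_paths_def)
    next
      case (edges x xs)
      then show ?thesis by (auto simp: segment_def)
    next
      case (infinite f)
      then show ?thesis by (auto simp: segment_def fun_eq_iff split: nat.split)
    qed
  qed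
  then show ?thesis using assms by metis
qed

text \<open>The boundary paths with first edge in V. They serve as charts for the shift, which is
  injective on them as soon as \<open>src\<close> is injective on V.\<close>

definition edge_cylinder :: "'e set \<Rightarrow> ('v, 'e) gpath set" where
  "edge_cylinder V = cylinder E ((\<lambda>e. Edges [e]) ` V)"

lemma edge_cylinder_iff:
  assumes "V \<subseteq> topspace (espace E)"
  shows "\<alpha> \<in> edge_cylinder V \<longleftrightarrow> \<alpha> \<in> boundary_paths E - vertex_paths E \<and> (\<exists>e\<in>V. segment E 1 \<alpha> = Edges [e])"
proof -
  have "(\<lambda>e. Edges [e]) ` V \<subseteq> paths_of_length E 1"
    using assms by (auto simp: paths_of_length_pos Edges_in_edge_paths_iff)
  then show ?thesis
    unfolding edge_cylinder_def
    using cylinder_subset[of E "(\<lambda>e. Edges [e]) ` V"] segment_in_cylinder_iff[of _ 1 \<alpha>] non_vertex_iff[of \<alpha>]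
    by blast
qed

lemma first_edge_src:
  assumes "\<alpha> \<in> boundary_paths E - vertex_paths E" "segment E 1 \<alpha> = Edges [e]"
  shows "src E e = path_rng E (shift E \<alpha>)" "rng E e = path_rng E \<alpha>"
proof -
  have "segment E 0 (shift E \<alpha>) = shift E (segment E 1 \<alpha>)"
    using segment_shift[of \<alpha> 0] assms non_vertex_iff by auto
  then show "src E e = path_rng E (shift E \<alpha>)" using assms by (simp add: segment_def)
  show "rng E e = path_rng E \<alpha>"
    using path_rng_segment[of \<alpha> 1] assms non_vertex_iff by auto
qed

lemma segment_first_edge:
  assumes "\<alpha> \<in> boundary_paths E" "enat (Suc n) \<le> plen \<alpha>" "segment E 1 \<alpha> = Edges [e]"
  obtains xs where "segment E (Suc n) \<alpha> = Edges (e # xs)"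
  using assms(1)
proof (cases rule: boundary_paths_cases)
  case (vertex v)
  then show ?thesis using assms by (simp add: zero_enat_def)
next
  case (edges x xs)
  then show ?thesis using assms that by (auto simp: segment_def)
next
  case (infinite f)
  then show ?thesis using assms that by (auto simp: segment_def upt_conv_Cons simp del: upt_Suc)
qed

lemma shift_Edges_Cons_eq_iff:
  "shift E (Edges (x # xs)) = shift E (Edges (x # ys)) \<longleftrightarrow> xs = ys"
  by auto

text \<open>The finite paths whose cylinder is the shift of Z(S) cut down to first edges in V. A
  vertex of \<open>S\<close> constrains a path only through the range of its first edge e; after the
  shift what is left is that the path has range \<open>src E e\<close>, hence the second
  part.\<close>

definition shift_cylinder :: "'e set \<Rightarrow> ('v, 'e) gpath set \<Rightarrow> ('v, 'e) gpath set" where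
  "shift_cylinder V S = shift E ` {\<delta> \<in> S - vertex_paths E. hd (the_edges \<delta>) \<in> V} \<union>
     Vtx ` src E ` {e \<in> V. Vtx (rng E e) \<in> S}"

text \<open>By \<open>segment_shift\<close>, a segment of length n + 1 in \<open>S\<close> becomes a
  segment of length n of the shifted path, and the vertices account for segments of length 0.
  Conversely \<open>cons_path\<close> restores the dropped edge.\<close>

lemma shift_image_cylinder:
  assumes S: "S \<subseteq> fin_paths E" and V: "V \<subseteq> topspace (espace E)"
  shows "shift E ` (edge_cylinder V \<inter> cylinder E S) = cylinder E (shift_cylinder V S)"
proof (intro set_eqI iffI)
  fix \<beta> assume "\<beta> \<in> shift E ` (edge_cylinder V \<inter> cylinder E S)"
  then obtain \<alpha> e n where a: "\<beta> = shift E \<alpha>" "\<alpha> \<in> boundary_paths E - vertex_paths E" "e \<in> V"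
    "segment E 1 \<alpha> = Edges [e]" "enat n \<le> plen \<alpha>" "segment E n \<alpha> \<in> S"
    by (auto simp: edge_cylinder_iff[OF V] cylinder_iff)
  have bd: "\<beta> \<in> boundary_paths E" using a shift_boundary_path by blast
  show "\<beta> \<in> cylinder E (shift_cylinder V S)"
  proof (cases n)
    case 0
    then have "Vtx (rng E e) \<in> S"
      using a first_edge_src[OF a(2,4)] by (simp add: segment_def)
    then have "Vtx (src E e) \<in> shift_cylinder V S"
      using a(3) unfolding shift_cylinder_def by blast
    then have "segment E 0 \<beta> \<in> shift_cylinder V S"
      using a first_edge_src[OF a(2,4)] by (simp add: segment_def)
    then show ?thesis using bd by (auto simp: cylinder_iff zero_enat_def[symmetric] intro!: exI[of _ 0])
  next
    case (Suc m)
    obtain xs where "segment E n \<alpha> = Edges (e # xs)"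
      using segment_first_edge[of \<alpha> m e] a Suc by blast
    then have "hd (the_edges (segment E n \<alpha>)) = e" by simp
    moreover have "segment E n \<alpha> \<notin> vertex_paths E"
      using \<open>segment E n \<alpha> = Edges (e # xs)\<close> by (simp add: Edges_not_vertex)
    ultimately have "shift E (segment E n \<alpha>) \<in> shift_cylinder V S"
      unfolding shift_cylinder_def using a by blast
    then have "segment E m \<beta> \<in> shift_cylinder V S"
      using segment_shift[of \<alpha> m] a Suc by simp
    moreover have "enat m \<le> plen \<beta>" using a Suc plen_shift by blast
    ultimately show ?thesis using bd by (auto simp: cylinder_iff)
  qed
next
  fix \<beta> assume "\<beta> \<in> cylinder E (shift_cylinder V S)"
  then obtain n where n: "\<beta> \<in> boundary_paths E" "enat n \<le> plen \<beta>" "segment E n \<beta> \<in> shift_cylinder V S"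
    by (auto simp: cylinder_iff)
  have sn: "segment E n \<beta> \<in> paths_of_length E n" using n segment_in_paths_of_length by blast
  show "\<beta> \<in> shift E ` (edge_cylinder V \<inter> cylinder E S)"
  proof (cases "segment E n \<beta> \<in> shift E ` {\<delta> \<in> S - vertex_paths E. hd (the_edges \<delta>) \<in> V}")
    case True
    then obtain \<delta> where d: "\<delta> \<in> S" "\<delta> \<notin> vertex_paths E" "hd (the_edges \<delta>) \<in> V" "segment E n \<beta> = shift E \<delta>"
      by blast
    then obtain e xs where xs: "\<delta> = Edges (e # xs)" "Edges (e # xs) \<in> edge_paths E (Suc (length xs))"
      using S by (metis fin_paths_cases image_eqI subsetD vertex_paths_def)
    then have eV: "e \<in> V" "e \<in> topspace (espace E)" using d V by auto
    \<comment> \<open>So \<open>e\<close> may be prepended to \<open>\<beta>\<close>: the range of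
      \<open>shift E \<delta>\<close> is the source of the dropped edge.\<close>
    have src: "src E e = path_rng E \<beta>"
    proof -
      have "path_rng E \<beta> = path_rng E (shift E \<delta>)" using path_rng_segment[OF n(1,2)] d by simp
      also have "\<dots> = src E e" using xs by (auto simp: Edges_Cons_in_edge_paths_iff)
      finally show ?thesis by simp
    qed
    note c = cons_path_boundary[OF n(1) eV(2) src]
    have len: "enat (Suc n) \<le> plen (cons_path e \<beta>)" using plen_shift[of "cons_path e \<beta>" n] c n by auto
    \<comment> \<open>The segment and \<open>\<delta>\<close> both begin with \<open>e\<close>, so
      equality of their shifts makes them equal.\<close>
    have "shift E (segment E (Suc n) (cons_path e \<beta>)) = shift E \<delta>"
      using segment_shift[OF _ len] c d by auto
    moreover obtain ys where "segment E (Suc n) (cons_path e \<beta>) = Edges (e # ys)"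
      using segment_first_edge[OF _ len c(3)] c(1) by blast
    ultimately have "segment E (Suc n) (cons_path e \<beta>) = \<delta>"
      unfolding xs(1) by (simp only: shift_Edges_Cons_eq_iff)
    then have "cons_path e \<beta> \<in> cylinder E S" using d len c by (auto simp: cylinder_iff)
    moreover have "cons_path e \<beta> \<in> edge_cylinder V"
      using c eV by (auto simp: edge_cylinder_iff[OF V])
    ultimately show ?thesis using c(2) by (intro image_eqI[of _ _ "cons_path e \<beta>"]) auto
  next
    case False
    then obtain e where e: "e \<in> V" "Vtx (rng E e) \<in> S" "segment E n \<beta> = Vtx (src E e)"
      using n unfolding shift_cylinder_def by blast
    then have eE: "e \<in> topspace (espace E)" using V by blast
    have "src E e = path_rng E \<beta>"
      using path_rng_segment[OF n(1,2)] e by simp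
    note c = cons_path_boundary[OF n(1) eE this]
    have "cons_path e \<beta> \<in> cylinder E S"
      using e c by (auto simp: cylinder_iff segment_def path_rng_cons_path zero_enat_def[symmetric] intro!: exI[of _ 0])
    moreover have "cons_path e \<beta> \<in> edge_cylinder V"
      using c e by (auto simp: edge_cylinder_iff[OF V])
    ultimately show ?thesis using c(2) by (intro image_eqI[of _ _ "cons_path e \<beta>"]) auto
  qed
qed

text \<open>The range of the shifted path is the source of the dropped edge, and injectivity of
  \<open>src\<close> recovers that edge from it.\<close>

lemma inj_on_shift_edge_cylinder:
  assumes "V \<subseteq> topspace (espace E)" "inj_on (src E) V"
  shows "inj_on (shift E) (edge_cylinder V)"
proof (rule inj_onI)
  fix \<alpha> \<beta> assume ab: "\<alpha> \<in> edge_cylinder V" "\<beta> \<in> edge_cylinder V" "shift E \<alpha> = shift E \<beta>"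
  then obtain e f where e: "\<alpha> \<in> boundary_paths E - vertex_paths E" "e \<in> V" "segment E 1 \<alpha> = Edges [e]"
    and f: "\<beta> \<in> boundary_paths E - vertex_paths E" "f \<in> V" "segment E 1 \<beta> = Edges [f]"
    unfolding edge_cylinder_iff[OF assms(1)] by blast
  have "src E e = src E f"
    using first_edge_src(1)[OF e(1,3)] first_edge_src(1)[OF f(1,3)] ab(3) by simp
  then have "e = f" using assms(2) e(2) f(2) by (auto dest: inj_onD)
  then show "\<alpha> = \<beta>" using shift_first_edge_inj[OF e(1) f(1)] e f ab by simp
qed

lemma edge_cylinder_mono: "V \<subseteq> W \<Longrightarrow> edge_cylinder V \<subseteq> edge_cylinder W"
  unfolding edge_cylinder_def by (intro cylinder_mono) auto

text \<open>
  On the right-hand side the set \<open>K\<close> is shifted along the larger set \<open>C\<close>, because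
  \<open>shift_cylinder C K\<close> is compact when \<open>C\<close> and \<open>K\<close> are, while \<open>V\<close> will only be open.
\<close>

lemma shift_image_basic:
  assumes "S \<subseteq> fin_paths E" "K \<subseteq> fin_paths E" "V \<subseteq> C" "C \<subseteq> topspace (espace E)" "inj_on (src E) C"
  shows "shift E ` (edge_cylinder V \<inter> (cylinder E S - cylinder E K)) =
    cylinder E (shift_cylinder V S) - cylinder E (shift_cylinder C K)"
proof -
  \<comment> \<open>A first edge in \<open>V\<close> also lies in \<open>C\<close>, so the
    subtracted set may be cut down by \<open>C\<close> in place of \<open>V\<close>.\<close>
  have "edge_cylinder V \<inter> (cylinder E S - cylinder E K) =
      (edge_cylinder V \<inter> cylinder E S) - (edge_cylinder C \<inter> cylinder E K)"
    using edge_cylinder_mono[OF assms(3)] by blast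
  then have "shift E ` (edge_cylinder V \<inter> (cylinder E S - cylinder E K)) =
      shift E ` (edge_cylinder V \<inter> cylinder E S) - shift E ` (edge_cylinder C \<inter> cylinder E K)"
    using inj_on_image_set_diff[OF inj_on_shift_edge_cylinder[OF assms(4,5)],
        of "edge_cylinder V \<inter> cylinder E S" "edge_cylinder C \<inter> cylinder E K"]
      edge_cylinder_mono[OF assms(3)] by auto
  then show ?thesis
    using shift_image_cylinder[OF assms(1), of V] shift_image_cylinder[OF assms(2,4)] assms by auto
qed

lemma openin_first_edge:
  assumes "openin (espace E) V"
  shows "openin (fin_path_topology E) {\<delta> \<in> fin_paths E - vertex_paths E. hd (the_edges \<delta>) \<in> V}"
proof -
  have "{\<delta> \<in> fin_paths E - vertex_paths E. hd (the_edges \<delta>) \<in> V} =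
      (\<Union>n. {\<delta> \<in> edge_paths E (Suc n). the_edges \<delta> ! 0 \<in> V})"
  proof (intro set_eqI iffI)
    fix \<delta> assume d: "\<delta> \<in> {\<delta> \<in> fin_paths E - vertex_paths E. hd (the_edges \<delta>) \<in> V}"
    then have "\<delta> \<in> fin_paths E" by blast
    then show "\<delta> \<in> (\<Union>n. {\<delta> \<in> edge_paths E (Suc n). the_edges \<delta> ! 0 \<in> V})"
      by (cases rule: fin_paths_cases) (use d in \<open>auto simp: vertex_paths_def\<close>)
  next
    fix \<delta> assume "\<delta> \<in> (\<Union>n. {\<delta> \<in> edge_paths E (Suc n). the_edges \<delta> ! 0 \<in> V})"
    then obtain n where n: "\<delta> \<in> edge_paths E (Suc n)" "the_edges \<delta> ! 0 \<in> V" by blast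
    from n(1) obtain xs where xs: "\<delta> = Edges xs" "length xs = Suc n" by (rule edge_pathsE)
    then have "hd xs = xs ! 0" by (cases xs) auto
    moreover have "\<delta> \<in> fin_paths E" using n(1) edge_paths_subset_fin_paths[of "Suc n" E] by blast
    ultimately show "\<delta> \<in> {\<delta> \<in> fin_paths E - vertex_paths E. hd (the_edges \<delta>) \<in> V}"
      using n xs by (simp add: Edges_not_vertex)
  qed
  then show ?thesis using openin_edge_paths_nth[OF assms] by auto
qed

text \<open>The first part is open because the shift on finite paths is open, the second because
  \<open>src\<close> is.\<close>

lemma openin_shift_cylinder:
  assumes V: "openin (espace E) V" and S: "openin (fin_path_topology E) S"
  shows "openin (fin_path_topology E) (shift_cylinder V S)"
  unfolding shift_cylinder_def
proof (intro openin_Un)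
  have "S \<subseteq> fin_paths E" using openin_subset[OF S] by (simp add: topspace_fin_path_topology)
  then have eq: "{\<delta> \<in> S - vertex_paths E. hd (the_edges \<delta>) \<in> V} =
     S \<inter> {\<delta> \<in> fin_paths E - vertex_paths E. hd (the_edges \<delta>) \<in> V}" by blast
  show "openin (fin_path_topology E) (shift E ` {\<delta> \<in> S - vertex_paths E. hd (the_edges \<delta>) \<in> V})"
    unfolding eq using S openin_first_edge[OF V] by (intro openin_shift_image) auto
  have "openin (espace E) {e \<in> topspace (espace E). rng E e \<in> {v. Vtx v \<in> S}}"
    using continuous_rng openin_Vtx_vimage[OF S] by (rule openin_continuous_map_preimage)
  then have "openin (espace E) (V \<inter> {e \<in> topspace (espace E). rng E e \<in> {v. Vtx v \<in> S}})"
    using V by blast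
  also have "V \<inter> {e \<in> topspace (espace E). rng E e \<in> {v. Vtx v \<in> S}} = {e \<in> V. Vtx (rng E e) \<in> S}"
    using openin_subset[OF V] by blast
  finally have "openin (vspace E) (src E ` {e \<in> V. Vtx (rng E e) \<in> S})"
    using open_map_src by (simp add: open_map_def)
  then show "openin (fin_path_topology E) (Vtx ` src E ` {e \<in> V. Vtx (rng E e) \<in> S})"
    by (rule openin_Vtx_image)
qed

lemma continuous_map_Vtx: "continuous_map (vspace E) (fin_path_topology E) Vtx"
  unfolding continuous_map_def
proof (intro conjI allI impI)
  show "Vtx \<in> topspace (vspace E) \<rightarrow> topspace (fin_path_topology E)"
    by (auto simp: topspace_fin_path_topology Vtx_in_fin_paths_iff)
  fix U :: "('v, 'e) gpath set" assume U: "openin (fin_path_topology E) U"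
  have "{v \<in> topspace (vspace E). Vtx v \<in> U} = {v. Vtx v \<in> U}"
    using openin_subset[OF openin_Vtx_vimage[OF U]] by blast
  then show "openin (vspace E) {v \<in> topspace (vspace E). Vtx v \<in> U}"
    using openin_Vtx_vimage[OF U] by simp
qed

lemma closedin_vertex_paths: "closedin (fin_path_topology E) (vertex_paths E)"
proof -
  have "fin_paths E - vertex_paths E = (\<Union>n. paths_of_length E (Suc n))"
  proof -
    have "paths_of_length E (Suc n) \<inter> vertex_paths E = {}" for n
      by (auto simp: paths_of_length_Suc edge_paths_def vertex_paths_def)
    moreover have "fin_paths E = vertex_paths E \<union> (\<Union>n. paths_of_length E (Suc n))"
      unfolding fin_paths_def by (subst UNIV_nat_eq) (simp add: paths_of_length_0)
    ultimately show ?thesis by blast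
  qed
  moreover have "openin (fin_path_topology E) (\<Union>n. paths_of_length E (Suc n))"
    using openin_paths_of_length by auto
  moreover have "vertex_paths E \<subseteq> fin_paths E"
    by (auto simp: vertex_paths_def Vtx_in_fin_paths_iff)
  ultimately show ?thesis by (auto simp: closedin_def topspace_fin_path_topology)
qed

lemma continuous_map_the_vtx:
  "continuous_map (subtopology (fin_path_topology E) (vertex_paths E)) (vspace E) the_vtx"
  unfolding continuous_map_def
proof (intro conjI allI impI)
  show "the_vtx \<in> topspace (subtopology (fin_path_topology E) (vertex_paths E)) \<rightarrow> topspace (vspace E)"
    by (auto simp: vertex_paths_def)
  fix U assume U: "openin (vspace E) U"
  have "{\<alpha> \<in> topspace (subtopology (fin_path_topology E) (vertex_paths E)). the_vtx \<alpha> \<in> U} = Vtx ` U"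
    using openin_subset[OF U] by (auto simp: vertex_paths_def topspace_fin_path_topology Vtx_in_fin_paths_iff)
  moreover have "openin (subtopology (fin_path_topology E) (vertex_paths E)) (Vtx ` U)"
    using openin_Vtx_image[OF U] openin_subset[OF U]
    by (intro openin_subtopology_Int[of _ "Vtx ` U" "vertex_paths E", THEN back_subst[of "openin _"]]) (auto simp: vertex_paths_def)
  ultimately show "openin (subtopology (fin_path_topology E) (vertex_paths E))
     {\<alpha> \<in> topspace (subtopology (fin_path_topology E) (vertex_paths E)). the_vtx \<alpha> \<in> U}" by simp
qed

lemma compactin_Vtx_vimage:
  assumes K: "compactin (fin_path_topology E) K"
  shows "compactin (vspace E) {v. Vtx v \<in> K}"
proof -
  have "compactin (fin_path_topology E) (K \<inter> vertex_paths E)"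
    using K closedin_vertex_paths by (rule compact_Int_closedin)
  then have "compactin (subtopology (fin_path_topology E) (vertex_paths E)) (K \<inter> vertex_paths E)"
    by (simp add: compactin_subtopology)
  then have "compactin (vspace E) (the_vtx ` (K \<inter> vertex_paths E))"
    using continuous_map_the_vtx by (rule image_compactin)
  moreover have "the_vtx ` (K \<inter> vertex_paths E) = {v. Vtx v \<in> K}"
  proof -
    have "v \<in> topspace (vspace E)" if "Vtx v \<in> K" for v
      using compactin_subset_topspace[OF K] that Vtx_in_fin_paths_iff
      by (metis subsetD topspace_fin_path_topology)
    then show ?thesis by (force simp: vertex_paths_def)
  qed
  ultimately show ?thesis by simp
qed

text \<open>Both parts are continuous images of closed subsets of compact sets: of the paths in
  \<open>K\<close> with first edge in \<open>C\<close>, and of the edges in \<open>C\<close> with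
  range in \<open>K\<close>.\<close>

lemma compactin_shift_cylinder:
  assumes C: "compactin (espace E) C" and K: "compactin (fin_path_topology E) K"
  shows "compactin (fin_path_topology E) (shift_cylinder C K)"
  unfolding shift_cylinder_def
proof (intro compactin_Un)
  have KE: "K \<subseteq> fin_paths E" using compactin_subset_topspace[OF K] by (simp add: topspace_fin_path_topology)
  have CE: "C \<subseteq> topspace (espace E)" using compactin_subset_topspace[OF C] .
  have "closedin (espace E) C" using Hausdorff_espace C by (rule compactin_imp_closedin)
  then have "openin (espace E) (topspace (espace E) - C)" by blast
  then have "openin (fin_path_topology E) {\<delta> \<in> fin_paths E - vertex_paths E. hd (the_edges \<delta>) \<in> topspace (espace E) - C}"
    by (rule openin_first_edge)
  \<comment> \<open>The complement of the paths with first edge in \<open>C\<close>: the vertices,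
    and the paths whose first edge misses the closed set \<open>C\<close>.\<close>
  then have "openin (fin_path_topology E) (vertex_paths E \<union> {\<delta> \<in> fin_paths E - vertex_paths E. hd (the_edges \<delta>) \<in> topspace (espace E) - C})"
    using openin_paths_of_length[of E 0] by (intro openin_Un) (simp_all add: paths_of_length_0)
  then have "closedin (fin_path_topology E) (fin_paths E - (vertex_paths E \<union> {\<delta> \<in> fin_paths E - vertex_paths E. hd (the_edges \<delta>) \<in> topspace (espace E) - C}))"
    by (metis closedin_diff closedin_topspace topspace_fin_path_topology)
  then have "compactin (fin_path_topology E) (K \<inter> (fin_paths E - (vertex_paths E \<union> {\<delta> \<in> fin_paths E - vertex_paths E. hd (the_edges \<delta>) \<in> topspace (espace E) - C})))"
    using K by (rule compact_Int_closedin[rotated])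
  also have "K \<inter> (fin_paths E - (vertex_paths E \<union> {\<delta> \<in> fin_paths E - vertex_paths E. hd (the_edges \<delta>) \<in> topspace (espace E) - C})) =
      {\<delta> \<in> K - vertex_paths E. hd (the_edges \<delta>) \<in> C}"
  proof -
    have "hd (the_edges \<delta>) \<in> topspace (espace E)" if d: "\<delta> \<in> fin_paths E" "\<delta> \<notin> vertex_paths E" for \<delta>
      using d(1) by (cases rule: fin_paths_cases) (use d(2) in \<open>auto simp: vertex_paths_def Edges_Cons_in_edge_paths_iff\<close>)
    then show ?thesis using KE by blast
  qed
  finally have "compactin (fin_path_topology E) {\<delta> \<in> K - vertex_paths E. hd (the_edges \<delta>) \<in> C}" .
  then have "compactin (subtopology (fin_path_topology E) (fin_paths E - vertex_paths E)) {\<delta> \<in> K - vertex_paths E. hd (the_edges \<delta>) \<in> C}"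
    using KE by (auto simp: compactin_subtopology)
  then show "compactin (fin_path_topology E) (shift E ` {\<delta> \<in> K - vertex_paths E. hd (the_edges \<delta>) \<in> C})"
    using continuous_map_shift by (rule image_compactin)
  have "closedin (vspace E) {v. Vtx v \<in> K}"
    using Hausdorff_vspace compactin_Vtx_vimage[OF K] by (rule compactin_imp_closedin)
  then have "closedin (espace E) {e \<in> topspace (espace E). rng E e \<in> {v. Vtx v \<in> K}}"
    using continuous_rng by (rule closedin_continuous_map_preimage[rotated])
  then have "compactin (espace E) (C \<inter> {e \<in> topspace (espace E). rng E e \<in> {v. Vtx v \<in> K}})"
    using C by (rule compact_Int_closedin[rotated])
  also have "C \<inter> {e \<in> topspace (espace E). rng E e \<in> {v. Vtx v \<in> K}} = {e \<in> C. Vtx (rng E e) \<in> K}"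
    using CE by blast
  finally show "compactin (fin_path_topology E) (Vtx ` src E ` {e \<in> C. Vtx (rng E e) \<in> K})"
    by (intro image_compactin[OF _ continuous_map_Vtx] image_compactin[OF _ continuous_src])
qed

section \<open>The boundary topology and local openness of the shift\<close>

lemma topspace_boundary_topology: "topspace (boundary_topology E) = boundary_paths E"
proof -
  have "cylinder E (fin_paths E) - cylinder E {} = boundary_paths E"
    using path_rng_in_vspace by (auto simp: cylinder_def Vtx_in_fin_paths_iff)
  moreover have "openin (fin_path_topology E) (fin_paths E)"
    by (metis openin_topspace topspace_fin_path_topology)
  moreover have "compactin (fin_path_topology E) {}" by simp
  ultimately show ?thesis
    unfolding boundary_topology_def topology_generated_by_topspace using cylinder_subset by blast
qed

lemma openin_boundary_cylinder_Diff:
  "openin (fin_path_topology E) U \<Longrightarrow> compactin (fin_path_topology E) K \<Longrightarrow>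
    openin (boundary_topology E) (cylinder E U - cylinder E K)"
  unfolding boundary_topology_def by (rule topology_generated_by_Basis) blast

lemma openin_cylinder: "openin (fin_path_topology E) U \<Longrightarrow> openin (boundary_topology E) (cylinder E U)"
  using openin_boundary_cylinder_Diff[of U "{}"] by (simp add: cylinder_def)

text \<open>Induction over the generation of \<open>Q\<close>: generators are covered by
  \<open>shift_image_basic\<close>, images commute with unions, and they commute with intersections
  because the shift is injective on \<open>edge_cylinder V\<close>.\<close>

lemma openin_shift_image_edge_cylinder:
  assumes V: "openin (espace E) V" "V \<subseteq> C" and C: "compactin (espace E) C" "inj_on (src E) C"
    and O: "openin (boundary_topology E) Q"
  shows "openin (boundary_topology E) (shift E ` (edge_cylinder V \<inter> Q))"
proof -
  have CE: "C \<subseteq> topspace (espace E)" using compactin_subset_topspace[OF C(1)] .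
  have inj: "inj_on (shift E) (edge_cylinder V)"
    using V C CE by (intro inj_on_shift_edge_cylinder) (auto intro: inj_on_subset)
  from O have "generate_topology_on {cylinder E U - cylinder E K | U K.
        openin (fin_path_topology E) U \<and> compactin (fin_path_topology E) K} Q"
    by (simp add: boundary_topology_def openin_topology_generated_by_iff)
  then show ?thesis
  proof induction
    case Empty
    then show ?case by simp
  next
    case (Int a b)
    have "shift E ` (edge_cylinder V \<inter> (a \<inter> b)) = shift E ` (edge_cylinder V \<inter> a) \<inter> shift E ` (edge_cylinder V \<inter> b)"
      using inj_on_image_Int[OF inj, of "edge_cylinder V \<inter> a" "edge_cylinder V \<inter> b"]
      by (simp add: Int_ac)
    then show ?case using Int by auto
  next
    case (UN K)
    have "shift E ` (edge_cylinder V \<inter> \<Union>K) = (\<Union>k\<in>K. shift E ` (edge_cylinder V \<inter> k))" by blast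
    then show ?case using UN by auto
  next
    case (Basis s)
    then obtain U K where UK: "s = cylinder E U - cylinder E K"
      "openin (fin_path_topology E) U" "compactin (fin_path_topology E) K" by blast
    have "shift E ` (edge_cylinder V \<inter> s) = cylinder E (shift_cylinder V U) - cylinder E (shift_cylinder C K)"
      unfolding UK(1) using UK V C CE openin_subset[OF UK(2)] compactin_subset_topspace[OF UK(3)]
      by (intro shift_image_basic) (auto simp: topspace_fin_path_topology)
    then show ?case
      using openin_boundary_cylinder_Diff[OF openin_shift_cylinder[OF V(1) UK(2)] compactin_shift_cylinder[OF C(1) UK(3)]]
      by simp
  qed
qed

lemma edge_neighbourhood:
  assumes e: "e \<in> topspace (espace E)"
  obtains V C where "openin (espace E) V" "e \<in> V" "V \<subseteq> C" "compactin (espace E) C" "inj_on (src E) C"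
proof -
  obtain U where U: "openin (espace E) U" "e \<in> U" "inj_on (src E) U"
    using e by (rule src_locally_injective)
  have "neighbourhood_base_of (compactin (espace E)) (espace E)"
    using locally_compact_espace Hausdorff_espace locally_compact_space_neighbourhood_base by blast
  then obtain V C where "openin (espace E) V" "compactin (espace E) C" "e \<in> V" "V \<subseteq> C" "C \<subseteq> U"
    using U unfolding neighbourhood_base_of by meson
  then show ?thesis using that U by (meson inj_on_subset)
qed

end

section \<open>Countability and Borel sets\<close>

lemma space_borel_of: "space (borel_of X) = topspace X"
  unfolding borel_of_def by (rule space_measure_of) (auto dest: openin_subset)

lemma sets_borel_of: "sets (borel_of X) = sigma_sets (topspace X) {U. openin X U}"
  unfolding borel_of_def by (rule sets_measure_of) (auto dest: openin_subset)

lemma borel_of_openin: "openin X U \<Longrightarrow> U \<in> sets (borel_of X)"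
  unfolding sets_borel_of by (rule sigma_sets.Basic) simp

lemma openin_delete:
  assumes "Hausdorff_space X" "openin X U"
  shows "openin X (U - {x})"
proof (cases "x \<in> topspace X")
  case True
  then have "closedin X {x}" using assms(1) by (simp add: closedin_Hausdorff_sing_eq)
  then show ?thesis using assms(2) by (rule openin_diff[rotated])
next
  case False
  then show ?thesis using assms(2) openin_subset by (metis Diff_empty Diff_insert0 subsetD)
qed

locale second_countable_top_graph = top_graph E for E :: "('v, 'e) topgraph" +
  assumes second_countable_graph: "second_countable_graph E"
begin

section \<open>Countability of the paths with a given source\<close>

lemma countable_edge_cover:
  obtains \<V> where "countable \<V>" "\<Union>\<V> = topspace (espace E)" "\<And>V. V \<in> \<V> \<Longrightarrow> openin (espace E) V"
    "\<And>V. V \<in> \<V> \<Longrightarrow> \<exists>C. V \<subseteq> C \<and> compactin (espace E) C \<and> inj_on (src E) C"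
proof -
  let ?\<U> = "{V. openin (espace E) V \<and> (\<exists>C. V \<subseteq> C \<and> compactin (espace E) C \<and> inj_on (src E) C)}"
  have "Lindelof_space (espace E)"
    using second_countable_graph second_countable_imp_Lindelof_space by (auto simp: second_countable_graph_def)
  moreover have "topspace (espace E) \<subseteq> \<Union>?\<U>"
  proof
    fix e assume "e \<in> topspace (espace E)"
    then obtain V C where "openin (espace E) V" "e \<in> V" "V \<subseteq> C" "compactin (espace E) C" "inj_on (src E) C"
      by (rule edge_neighbourhood)
    then show "e \<in> \<Union>?\<U>" by blast
  qed
  ultimately obtain \<V> where V: "countable \<V>" "\<V> \<subseteq> ?\<U>" "topspace (espace E) \<subseteq> \<Union>\<V>"
    unfolding Lindelof_space_alt by (metis (no_types, lifting) mem_Collect_eq)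
  show thesis
  proof (rule that[OF V(1)])
    show "\<Union>\<V> = topspace (espace E)"
    proof
      show "\<Union>\<V> \<subseteq> topspace (espace E)" using V(2) openin_subset by blast
    qed (rule V(3))
  qed (use V(2) in blast)+
qed

text \<open>Each member of the countable cover contains at most one edge with source u.\<close>

lemma countable_edges_to: "countable {e \<in> topspace (espace E). src E e = u}"
proof -
  obtain \<V> where V: "countable \<V>" "\<Union>\<V> = topspace (espace E)"
    "\<And>V. V \<in> \<V> \<Longrightarrow> \<exists>C. V \<subseteq> C \<and> compactin (espace E) C \<and> inj_on (src E) C"
    using countable_edge_cover by metis
  have "{e \<in> topspace (espace E). src E e = u} = (\<Union>V\<in>\<V>. {e \<in> V. src E e = u})"
    using V(2) by blast
  moreover have "countable {e \<in> V. src E e = u}" if "V \<in> \<V>" for V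
  proof -
    have "inj_on (src E) V" using V(3)[OF that] inj_on_subset by blast
    then have "\<exists>x. {e \<in> V. src E e = u} \<subseteq> {x}"
      unfolding inj_on_def by blast
    then show ?thesis by (meson countable_empty countable_insert countable_subset)
  qed
  ultimately show ?thesis using V(1) by simp
qed

text \<open>Paths grow at their range end: an edge put in front of \<open>xs\<close> has source
  \<open>rng E (hd xs)\<close>, and only countably many edges do.\<close>

lemma countable_paths_to: "countable (paths_to E v)"
proof -
  define T where "T n = {xs. Edges xs \<in> (edge_paths E (Suc n) :: ('v, 'e) gpath set) \<and> src E (last xs) = v}" for n
  have "countable (T n)" for n
  proof (induction n)
    case 0
    have "T 0 \<subseteq> (\<lambda>e. [e]) ` {e \<in> topspace (espace E). src E e = v}"
      unfolding T_def by (auto simp: Edges_in_edge_paths_iff length_Suc_conv)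
    then show ?case using countable_edges_to by (meson countable_image countable_subset)
  next
    case (Suc n)
    have "T (Suc n) \<subseteq> (\<Union>xs\<in>T n. (\<lambda>e. e # xs) ` {e \<in> topspace (espace E). src E e = rng E (hd xs)})"
    proof
      fix ys assume ys: "ys \<in> T (Suc n)"
      then obtain e xs where "ys = e # xs" "xs \<noteq> []"
        unfolding T_def by (auto simp: Edges_in_edge_paths_iff length_Suc_conv)
      then show "ys \<in> (\<Union>xs\<in>T n. (\<lambda>e. e # xs) ` {e \<in> topspace (espace E). src E e = rng E (hd xs)})"
        using ys unfolding T_def by (auto simp: Edges_Cons_in_edge_paths_iff)
    qed
    moreover have "countable (\<Union>xs\<in>T n. (\<lambda>e. e # xs) ` {e \<in> topspace (espace E). src E e = rng E (hd xs)})"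
      using Suc countable_edges_to by blast
    ultimately show ?case by (rule countable_subset)
  qed
  then have "countable (insert (Vtx v) (\<Union>n. Edges ` T n))" by blast
  moreover have "paths_to E v \<subseteq> insert (Vtx v) (\<Union>n. Edges ` T n)"
  proof
    fix \<alpha> assume a: "\<alpha> \<in> paths_to E v"
    then have "\<alpha> \<in> fin_paths E" by (simp add: paths_to_def)
    then show "\<alpha> \<in> insert (Vtx v) (\<Union>n. Edges ` T n)"
    proof (cases rule: fin_paths_cases)
      case (edges x xs)
      then have "x # xs \<in> T (length xs)" using a by (auto simp: paths_to_def T_def)
      then show ?thesis using edges(1) by blast
    qed (use a in \<open>simp add: paths_to_def\<close>)
  qed
  ultimately show ?thesis by (rule countable_subset[rotated])
qed

section \<open>Borel sets of boundary paths\<close>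

abbreviation "\<B> \<equiv> boundary_borel E"

lemma space_boundary_borel: "space \<B> = boundary_paths E"
  by (simp add: space_borel_of topspace_boundary_topology)

lemma boundary_paths_borel: "boundary_paths E \<in> sets \<B>"
  using sets.top[of \<B>] by (simp add: space_boundary_borel)

lemma cylinder_borel: "openin (fin_path_topology E) U \<Longrightarrow> cylinder E U \<in> sets \<B>"
  by (intro borel_of_openin openin_cylinder)

lemma length_ge_borel: "{\<alpha> \<in> boundary_paths E. enat n \<le> plen \<alpha>} \<in> sets \<B>"
  using cylinder_borel[OF openin_paths_of_length] by (simp add: cylinder_paths_of_length)

lemma plen_inf_path: "\<alpha> \<in> inf_paths E \<Longrightarrow> plen \<alpha> = \<infinity>"
  by (auto simp: inf_paths_def)

lemma plen_fin_path: "\<alpha> \<in> fin_paths E \<Longrightarrow> plen \<alpha> \<noteq> \<infinity>"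
  unfolding fin_paths_def using plen_paths_of_length by fastforce

text \<open>For each n, the singular paths of length exactly n with source in B form a difference of
  two open sets: a cylinder over paths of length n, minus the paths of length at least n +
  1.\<close>

lemma source_vimage_borel:
  assumes "openin (vspace E) B"
  shows "{\<alpha> \<in> sing_paths E. path_src E \<alpha> \<in> B} \<in> sets \<B>"
proof -
  let ?C = "\<lambda>n. cylinder E {\<alpha> \<in> paths_of_length E n. path_src E \<alpha> \<in> B} - {\<alpha> \<in> boundary_paths E. enat (Suc n) \<le> plen \<alpha>}"
  have seg: "segment E n \<alpha> = \<alpha>" if a: "\<alpha> \<in> sing_paths E" "plen \<alpha> = enat n" for \<alpha> n
  proof -
    have "\<alpha> \<in> fin_paths E" using a(1) by (simp add: sing_paths_def)
    then show ?thesis by (cases rule: fin_paths_cases) (use a(2) in \<open>auto simp: segment_def zero_enat_def\<close>)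
  qed
  have "\<alpha> \<in> ?C n \<longleftrightarrow> \<alpha> \<in> sing_paths E \<and> plen \<alpha> = enat n \<and> path_src E \<alpha> \<in> B" for \<alpha> n
  proof (cases "\<alpha> \<in> boundary_paths E")
    case True
    have "\<alpha> \<in> ?C n \<longleftrightarrow> (enat n \<le> plen \<alpha> \<and> segment E n \<alpha> \<in> {\<alpha> \<in> paths_of_length E n. path_src E \<alpha> \<in> B}) \<and> \<not> enat (Suc n) \<le> plen \<alpha>"
      using segment_in_cylinder_iff[OF _ True, of "{\<alpha> \<in> paths_of_length E n. path_src E \<alpha> \<in> B}" n] True by auto
    also have "\<dots> \<longleftrightarrow> plen \<alpha> = enat n \<and> path_src E (segment E n \<alpha>) \<in> B"
      using segment_in_paths_of_length[OF True] by (cases "plen \<alpha>") auto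
    \<comment> \<open>A boundary path of finite length n is a singular path and equals its own
      segment of length n.\<close>
    also have "\<dots> \<longleftrightarrow> \<alpha> \<in> sing_paths E \<and> plen \<alpha> = enat n \<and> path_src E \<alpha> \<in> B"
      using True seg plen_inf_path unfolding boundary_paths_def by fastforce
    finally show ?thesis .
  next
    case False
    then show ?thesis using cylinder_subset by (auto simp: boundary_paths_def)
  qed
  moreover have "\<exists>n. plen \<alpha> = enat n" if "\<alpha> \<in> sing_paths E" for \<alpha>
    using that plen_fin_path by (auto simp: sing_paths_def)
  ultimately have "{\<alpha> \<in> sing_paths E. path_src E \<alpha> \<in> B} = (\<Union>n. ?C n)"
    by (intro set_eqI) (simp only: UN_iff mem_Collect_eq, blast)
  moreover have "?C n \<in> sets \<B>" for n
    using cylinder_borel[OF openin_edge_paths_src[OF assms]] length_ge_borel by blast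
  ultimately show ?thesis by auto
qed

lemma sing_paths_borel: "sing_paths E \<in> sets \<B>"
proof -
  have "{\<alpha> \<in> sing_paths E. path_src E \<alpha> \<in> topspace (vspace E)} = sing_paths E"
    by (auto simp: sing_paths_def singular_vertices_def)
  then show ?thesis using source_vimage_borel[OF openin_topspace] by simp
qed

text \<open>A path of finite length is one of its own segments, and an infinite path is read off
  from its segments edge by edge.\<close>

lemma boundary_path_eqI:
  assumes "\<alpha> \<in> boundary_paths E" "\<beta> \<in> boundary_paths E"
    and len: "\<And>n. enat n \<le> plen \<alpha> \<longleftrightarrow> enat n \<le> plen \<beta>"
    and seg: "\<And>n. enat n \<le> plen \<alpha> \<Longrightarrow> segment E n \<alpha> = segment E n \<beta>"
  shows "\<alpha> = \<beta>"
proof -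
  have fin: "segment E n \<gamma> = \<gamma>" if "plen \<gamma> = enat n" "\<gamma> \<in> boundary_paths E" for \<gamma> n
    using that(2) by (cases rule: boundary_paths_cases) (use that(1) in \<open>auto simp: segment_def zero_enat_def\<close>)
  have len': "plen \<alpha> = plen \<beta>"
  proof (rule order_antisym)
    show "plen \<alpha> \<le> plen \<beta>"
      using len by (cases "plen \<alpha>"; cases "plen \<beta>") (auto, use Suc_n_not_le_n in blast)
    show "plen \<beta> \<le> plen \<alpha>"
      using len by (cases "plen \<alpha>"; cases "plen \<beta>") (auto, use Suc_n_not_le_n in blast)
  qed
  show ?thesis
  proof (cases "plen \<alpha>")
    case (enat n)
    have "\<alpha> = segment E n \<alpha>" using fin[OF enat assms(1)] by simp
    also have "\<dots> = segment E n \<beta>" by (rule seg) (simp add: enat)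
    also have "\<dots> = \<beta>" using fin[OF _ assms(2)] enat len' by metis
    finally show ?thesis .
  next
    case infinity
    then obtain f where f: "\<alpha> = Inf_path f" using assms(1) by (cases \<alpha>) (auto simp: zero_enat_def)
    obtain g where g: "\<beta> = Inf_path g" using assms(2) infinity len' by (cases \<beta>) (auto simp: zero_enat_def)
    have "f n = g n" for n
      using seg[of "Suc n"] f g by (simp add: segment_def)
    then show ?thesis using f g by auto
  qed
qed

text \<open>By \<open>boundary_path_eqI\<close> a path is pinned down by countably many conditions
  on lengths and segments, each of which is Borel.\<close>

lemma singleton_borel:
  assumes \<alpha>: "\<alpha> \<in> boundary_paths E"
  shows "{\<alpha>} \<in> sets \<B>"
proof -
  \<comment> \<open>The condition at n: either the segment of length n agrees with that of
    \<open>\<alpha>\<close>, or, beyond the end of \<open>\<alpha>\<close>, the path is shorter than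
    n. The cylinder removed is open, since deleting a point from the open layer keeps it
    open.\<close>
  define A where "A n = (if enat n \<le> plen \<alpha>
     then {\<beta> \<in> boundary_paths E. enat n \<le> plen \<beta>} - cylinder E (paths_of_length E n - {segment E n \<alpha>})
     else boundary_paths E - {\<beta> \<in> boundary_paths E. enat n \<le> plen \<beta>})" for n
  have "A n \<in> sets \<B>" for n
    unfolding A_def using length_ge_borel boundary_paths_borel
      cylinder_borel[OF openin_delete[OF Hausdorff_fin_path_topology openin_paths_of_length]] by auto
  then have "(\<Inter>n. A n) \<in> sets \<B>" by blast
  moreover have "(\<Inter>n. A n) = {\<alpha>}"
  proof (intro set_eqI iffI)
    fix \<beta> assume b: "\<beta> \<in> (\<Inter>n. A n)"
    then have "\<beta> \<in> A 0" by blast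
    then have bd: "\<beta> \<in> boundary_paths E" by (auto simp: A_def split: if_splits)
    have len: "enat n \<le> plen \<alpha> \<longleftrightarrow> enat n \<le> plen \<beta>" for n
    proof -
      have "\<beta> \<in> A n" using b by blast
      then show ?thesis using bd by (auto simp: A_def split: if_splits)
    qed
    have "segment E n \<alpha> = segment E n \<beta>" if n: "enat n \<le> plen \<alpha>" for n
    proof -
      have "\<beta> \<in> A n" using b by blast
      then have "\<beta> \<notin> cylinder E (paths_of_length E n - {segment E n \<alpha>})" using n by (simp add: A_def)
      then have "segment E n \<beta> \<notin> paths_of_length E n - {segment E n \<alpha>}"
        using bd n len by (auto simp: cylinder_iff)
      moreover have "segment E n \<beta> \<in> paths_of_length E n"
        using segment_in_paths_of_length[OF bd] n len by simp
      ultimately show ?thesis by simp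
    qed
    then show "\<beta> \<in> {\<alpha>}" using boundary_path_eqI[OF \<alpha> bd] len by blast
  next
    fix \<beta> assume "\<beta> \<in> {\<alpha>}"
    then have "\<beta> \<in> A n" for n
      using \<alpha> segment_in_cylinder_iff[OF Diff_subset \<alpha>] by (simp add: A_def)
    then show "\<beta> \<in> (\<Inter>n. A n)" by blast
  qed
  ultimately show ?thesis by simp
qed

text \<open>On an edge cylinder from the countable cover the shift is injective and takes open sets
  to open sets, so induction over the sigma-algebra applies there; countably many pieces are then
  united.\<close>

lemma shift_image_borel:
  assumes A: "A \<in> sets \<B>" "A \<subseteq> boundary_paths E - vertex_paths E"
  shows "shift E ` A \<in> sets \<B>"
proof -
  obtain \<V> where V: "countable \<V>" "\<Union>\<V> = topspace (espace E)" "\<And>V. V \<in> \<V> \<Longrightarrow> openin (espace E) V"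
    "\<And>V. V \<in> \<V> \<Longrightarrow> \<exists>C. V \<subseteq> C \<and> compactin (espace E) C \<and> inj_on (src E) C"
    using countable_edge_cover by metis
  have cyl: "shift E ` (edge_cylinder V \<inter> A) \<in> sets \<B>" if VV: "V \<in> \<V>" for V
  proof -
    obtain C where C: "V \<subseteq> C" "compactin (espace E) C" "inj_on (src E) C" using V(4)[OF VV] by blast
    have Vo: "openin (espace E) V" using V(3)[OF VV] .
    have inj: "inj_on (shift E) (edge_cylinder V)"
      using inj_on_shift_edge_cylinder[OF openin_subset[OF Vo]] C inj_on_subset by blast
    have op: "shift E ` (edge_cylinder V \<inter> U) \<in> sets \<B>" if "openin (boundary_topology E) U" for U
      by (intro borel_of_openin openin_shift_image_edge_cylinder[OF Vo C that])
    from A(1) have "A \<in> sigma_sets (topspace (boundary_topology E)) {U. openin (boundary_topology E) U}"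
      by (simp add: sets_borel_of)
    then show ?thesis
    proof induction
      case (Basic a)
      then show ?case using op by blast
    next
      case Empty
      then show ?case by simp
    next
      case (Compl a)
      \<comment> \<open>Taking complements commutes with the image because the shift is injective on
        the edge cylinder.\<close>
      have "edge_cylinder V \<inter> (topspace (boundary_topology E) - a) =
         (edge_cylinder V \<inter> topspace (boundary_topology E)) - (edge_cylinder V \<inter> a)" by blast
      then have "shift E ` (edge_cylinder V \<inter> (topspace (boundary_topology E) - a)) =
         shift E ` (edge_cylinder V \<inter> topspace (boundary_topology E)) - shift E ` (edge_cylinder V \<inter> a)"
        using inj_on_image_set_diff[OF inj, of "edge_cylinder V \<inter> topspace (boundary_topology E)" "edge_cylinder V \<inter> a"]
        by auto
      then show ?case using op[OF openin_topspace] Compl by auto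
    next
      case (Union a)
      have "shift E ` (edge_cylinder V \<inter> (\<Union>i. a i)) = (\<Union>i. shift E ` (edge_cylinder V \<inter> a i))" by blast
      then show ?case using Union by auto
    qed
  qed
  have "A \<subseteq> (\<Union>V\<in>\<V>. edge_cylinder V)"
  proof
    fix \<alpha> assume a: "\<alpha> \<in> A"
    then have bd: "\<alpha> \<in> boundary_paths E" "enat 1 \<le> plen \<alpha>" "\<alpha> \<notin> vertex_paths E" using A non_vertex_iff by auto
    then have "segment E 1 \<alpha> \<in> edge_paths E 1" using segment_in_paths_of_length[of \<alpha> 1] by (simp add: paths_of_length_pos)
    then obtain e where e: "segment E 1 \<alpha> = Edges [e]" "e \<in> topspace (espace E)"
      by (auto simp: edge_paths_def length_Suc_conv)
    then obtain V' where "V' \<in> \<V>" "e \<in> V'" using V(2) by blast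
    then show "\<alpha> \<in> (\<Union>V\<in>\<V>. edge_cylinder V)"
      using bd e edge_cylinder_iff[OF openin_subset[OF V(3)]] by blast
  qed
  then have "shift E ` A = (\<Union>V\<in>\<V>. shift E ` (edge_cylinder V \<inter> A))" by blast
  then show ?thesis using V(1) cyl by auto
qed

end

section \<open>Convergent sequences of boundary paths\<close>

text \<open>Compactness gives a cluster point, second countability a countable decreasing
  neighbourhood base at it, along which increasing indices are picked.\<close>

lemma compactin_convergent_subsequence:
  assumes X: "second_countable X" and K: "compactin X K" and x: "\<And>j::nat. x j \<in> K"
  obtains l r where "l \<in> K" "strict_mono (r :: nat \<Rightarrow> nat)" "limitin X (x \<circ> r) l sequentially"
proof -
  \<comment> \<open>If every point of \<open>K\<close> had an open neighbourhood visited only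
    finitely often, a finite subcover would leave finitely many indices.\<close>
  have "\<exists>l\<in>K. \<forall>U. openin X U \<longrightarrow> l \<in> U \<longrightarrow> infinite {j. x j \<in> U}"
  proof (rule ccontr)
    assume "\<not> ?thesis"
    then have "K \<subseteq> \<Union>{U. openin X U \<and> finite {j. x j \<in> U}}" by blast
    then obtain \<F> where F: "finite \<F>" "\<F> \<subseteq> {U. openin X U \<and> finite {j. x j \<in> U}}" "K \<subseteq> \<Union>\<F>"
      using compactinD[OF K, of "{U. openin X U \<and> finite {j. x j \<in> U}}"] by auto
    have "(UNIV :: nat set) = (\<Union>U\<in>\<F>. {j. x j \<in> U})" using x F(3) by blast
    moreover have "finite (\<Union>U\<in>\<F>. {j. x j \<in> U})" using F by blast
    ultimately show False by (metis infinite_UNIV_nat)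
  qed
  then obtain l where l: "l \<in> K" "\<And>U. openin X U \<Longrightarrow> l \<in> U \<Longrightarrow> infinite {j. x j \<in> U}" by blast
  obtain \<B> where B: "countable \<B>" "\<And>V. V \<in> \<B> \<Longrightarrow> openin X V"
    "\<And>U x. openin X U \<Longrightarrow> x \<in> U \<Longrightarrow> \<exists>V\<in>\<B>. x \<in> V \<and> V \<subseteq> U"
    using X unfolding second_countable_def by meson
  have lX: "l \<in> topspace X" using l(1) compactin_subset_topspace[OF K] by blast
  define \<C> where "\<C> = {V \<in> \<B>. l \<in> V}"
  have C: "countable \<C>" "\<C> \<noteq> {}" using B(1) B(3)[OF openin_topspace lX] by (auto simp: \<C>_def)
  define b where "b = from_nat_into \<C>"
  have b: "openin X (b i)" "l \<in> b i" for i
    using from_nat_into[OF C(2), of i] B(2) by (auto simp: \<C>_def b_def)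
  \<comment> \<open>Intersecting makes the base decreasing, so that \<open>x (r n)\<close> lies in
    \<open>b i\<close> for all n \<ge> i.\<close>
  define W where "W n = (\<Inter>i\<le>n. b i)" for n
  have W: "openin X (W n)" "l \<in> W n" for n
    unfolding W_def using b by (auto intro!: openin_Inter)
  have "\<exists>r. \<forall>n. x (r n) \<in> W n \<and> r n < r (Suc n)"
  proof (rule dependent_nat_choice)
    show "\<exists>j. x j \<in> W 0" using l(2)[OF W, of 0] not_finite_existsD by blast
    fix j n
    have "infinite {j. x j \<in> W (Suc n)}" using l(2)[OF W] .
    then show "\<exists>k. x k \<in> W (Suc n) \<and> j < k"
      unfolding infinite_nat_iff_unbounded by blast
  qed
  then obtain r where r: "\<And>n. x (r n) \<in> W n" "\<And>n. r n < r (Suc n)" by blast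
  have "limitin X (x \<circ> r) l sequentially"
    unfolding limitin_sequentially
  proof (intro conjI allI impI)
    fix U assume U: "openin X U \<and> l \<in> U"
    then obtain V where V: "V \<in> \<C>" "V \<subseteq> U" using B(3)[of U l] by (auto simp: \<C>_def)
    then obtain i where i: "b i = V" using from_nat_into_surj[OF C(1)] unfolding b_def by blast
    have "(x \<circ> r) n \<in> U" if "i \<le> n" for n
      using r(1)[of n] that V i by (auto simp: W_def)
    then show "\<exists>N. \<forall>n. N \<le> n \<longrightarrow> (x \<circ> r) n \<in> U" by blast
  qed (rule lX)
  then show thesis using that l(1) r(2) by (meson strict_mono_Suc_iff)
qed

text \<open>Eventual membership survives finite intersections and arbitrary unions, so convergence
  can be tested on the generators.\<close>

lemma limitin_topology_generated_by:
  assumes "l \<in> \<Union>\<S>" "\<And>U. U \<in> \<S> \<Longrightarrow> l \<in> U \<Longrightarrow> eventually (\<lambda>x. f x \<in> U) F"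
  shows "limitin (topology_generated_by \<S>) f l F"
  unfolding limitin_def topology_generated_by_topspace
proof (intro conjI allI impI)
  fix U assume U: "openin (topology_generated_by \<S>) U \<and> l \<in> U"
  then have "generate_topology_on \<S> U" by (simp add: openin_topology_generated_by_iff)
  then have "l \<in> U \<longrightarrow> eventually (\<lambda>x. f x \<in> U) F"
  proof induction
    case (UN K)
    show ?case
    proof
      assume "l \<in> \<Union>K"
      then obtain k where k: "k \<in> K" "l \<in> k" by blast
      then have "eventually (\<lambda>x. f x \<in> k) F" using UN by blast
      then show "eventually (\<lambda>x. f x \<in> \<Union>K) F" by (rule eventually_mono) (use k in blast)
    qed
  qed (use assms(2) in \<open>auto simp: eventually_conj_iff\<close>)
  then show "eventually (\<lambda>x. f x \<in> U) F" using U by blast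
qed (rule assms(1))

text \<open>Unless the entries at position k leave every compact set, infinitely many of them lie in
  one compact set and a subsequence of them converges. A list too short to have an entry at k counts
  as escaped. This alternative survives subsequences and depends on tails only, so a diagonal
  sequence satisfies it for all k.\<close>

lemma diagonal_subsequence_of_lists:
  fixes ys :: "nat \<Rightarrow> 'a list"
  assumes X: "second_countable X"
  obtains d where "strict_mono (d :: nat \<Rightarrow> nat)"
    "\<And>k. (\<exists>l. (\<forall>\<^sub>F j in sequentially. k < length (ys (d j))) \<and> limitin X (\<lambda>j. ys (d j) ! k) l sequentially) \<or>
      (\<forall>C. compactin X C \<longrightarrow> (\<forall>\<^sub>F j in sequentially. \<not> (k < length (ys (d j)) \<and> ys (d j) ! k \<in> C)))"
proof -
  define P where "P k s \<longleftrightarrow>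
    (\<exists>l. (\<forall>\<^sub>F j in sequentially. k < length (ys (s j))) \<and> limitin X (\<lambda>j. ys (s j) ! k) l sequentially) \<or>
    (\<forall>C. compactin X C \<longrightarrow> (\<forall>\<^sub>F j in sequentially. \<not> (k < length (ys (s j)) \<and> ys (s j) ! k \<in> C)))"
    for k and s :: "nat \<Rightarrow> nat"
  interpret subseqs P
  proof
    fix k and s :: "nat \<Rightarrow> nat" assume "strict_mono s"
    show "\<exists>r'. strict_mono r' \<and> P k (s \<circ> r')"
    proof (cases "\<forall>C. compactin X C \<longrightarrow> (\<forall>\<^sub>F j in sequentially. \<not> (k < length (ys (s j)) \<and> ys (s j) ! k \<in> C))")
      case True
      then show ?thesis by (intro exI[of _ id]) (simp add: P_def strict_mono_id)
    next
      case False
      then obtain C where C: "compactin X C" "\<not> (\<forall>\<^sub>F j in sequentially. \<not> (k < length (ys (s j)) \<and> ys (s j) ! k \<in> C))"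
        by blast
      then have "infinite {j. k < length (ys (s j)) \<and> ys (s j) ! k \<in> C}"
        unfolding cofinite_eq_sequentially[symmetric] eventually_cofinite by simp
      from infinite_enumerate[OF this] obtain r where r: "strict_mono (r :: nat \<Rightarrow> nat)"
        "\<And>n. r n \<in> {j. k < length (ys (s j)) \<and> ys (s j) ! k \<in> C}" by blast
      then have "ys (s (r j)) ! k \<in> C" for j by blast
      then obtain l r' where l: "l \<in> C" "strict_mono (r' :: nat \<Rightarrow> nat)" "limitin X ((\<lambda>j. ys (s (r j)) ! k) \<circ> r') l sequentially"
        by (rule compactin_convergent_subsequence[OF X C(1)])
      have "P k (s \<circ> (r \<circ> r'))"
        unfolding P_def using l(3) r(2) by (intro disjI1 exI[of _ l]) (auto simp: o_def)
      then show ?thesis using strict_mono_o[OF r(1) l(2)] by blast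
    qed
  qed
  have stable: "P k (s \<circ> r)" if r: "strict_mono r" and P: "P k s" for k s r
    using P unfolding P_def
  proof (elim disjE exE conjE)
    fix l assume "\<forall>\<^sub>F j in sequentially. k < length (ys (s j))" "limitin X (\<lambda>j. ys (s j) ! k) l sequentially"
    then have "(\<forall>\<^sub>F j in sequentially. k < length (ys ((s \<circ> r) j))) \<and> limitin X (\<lambda>j. ys ((s \<circ> r) j) ! k) l sequentially"
      using limitin_subsequence[OF r, of X "\<lambda>j. ys (s j) ! k"] eventually_subseq[OF r, of "\<lambda>j. k < length (ys (s j))"]
      by (simp add: o_def)
    then show "(\<exists>l. (\<forall>\<^sub>F j in sequentially. k < length (ys ((s \<circ> r) j))) \<and> limitin X (\<lambda>j. ys ((s \<circ> r) j) ! k) l sequentially) \<or>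
      (\<forall>C. compactin X C \<longrightarrow> (\<forall>\<^sub>F j in sequentially. \<not> (k < length (ys ((s \<circ> r) j)) \<and> ys ((s \<circ> r) j) ! k \<in> C)))" by blast
  next
    assume "\<forall>C. compactin X C \<longrightarrow> (\<forall>\<^sub>F j in sequentially. \<not> (k < length (ys (s j)) \<and> ys (s j) ! k \<in> C))"
    then show "(\<exists>l. (\<forall>\<^sub>F j in sequentially. k < length (ys ((s \<circ> r) j))) \<and> limitin X (\<lambda>j. ys ((s \<circ> r) j) ! k) l sequentially) \<or>
      (\<forall>C. compactin X C \<longrightarrow> (\<forall>\<^sub>F j in sequentially. \<not> (k < length (ys ((s \<circ> r) j)) \<and> ys ((s \<circ> r) j) ! k \<in> C)))"
      using eventually_subseq[OF r, of "\<lambda>j. \<not> (k < length (ys (s j)) \<and> ys (s j) ! k \<in> C)" for C]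
      by (simp add: o_def)
  qed
  \<comment> \<open>The diagonal construction yields condition k once the first k + 1 terms are
    dropped, hence the offset; it is undone below, both alternatives being statements about
    tails.\<close>
  obtain d where d: "strict_mono (d :: nat \<Rightarrow> nat)" "\<And>k. P k (\<lambda>j. d (j + Suc k))"
  proof
    show "P k (\<lambda>j. diagseq (j + Suc k))" for k
      using diagseq_holds[OF stable, of k] by (simp add: o_def add.commute)
  qed (rule subseq_diagseq)
  have "P k d" for k
  proof -
    have "limitin X (\<lambda>j. ys (d j) ! k) l sequentially"
      if "limitin X (\<lambda>j. ys (d (j + Suc k)) ! k) l sequentially" for l
      using limitin_sequentially_offset_rev[of X "\<lambda>j. ys (d j) ! k" "Suc k"] that by simp
    then show ?thesis
      using d(2)[of k] unfolding P_def
      using eventually_sequentially_seg[of "\<lambda>j. k < length (ys (d j))" "Suc k"]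
        eventually_sequentially_seg[of "\<lambda>j. \<not> (k < length (ys (d j)) \<and> ys (d j) ! k \<in> C)" "Suc k" for C]
      by blast
  qed
  then show thesis using that[OF d(1)] unfolding P_def by blast
qed

context top_graph
begin

section \<open>Compact sets of finite paths and limits of paths\<close>

lemma compactin_finite_lengths:
  assumes K: "compactin (fin_path_topology E) K"
  obtains I where "finite I" "K \<subseteq> (\<Union>n\<in>I. paths_of_length E n)"
proof -
  have "K \<subseteq> \<Union>(range (paths_of_length E))"
    using compactin_subset_topspace[OF K] by (simp add: topspace_fin_path_topology fin_paths_def)
  then obtain \<F> where F: "finite \<F>" "\<F> \<subseteq> range (paths_of_length E)" "K \<subseteq> \<Union>\<F>"
    using compactinD[OF K, of "range (paths_of_length E)"] openin_paths_of_length by blast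
  then obtain I where "finite I" "\<F> = paths_of_length E ` I" by (meson finite_subset_image)
  then show thesis using that F(3) by blast
qed

text \<open>The paths longer than N form a closed set, their complement being a union of open
  layers, and the coordinate N is continuous on it. Edges that escape at position N eventually avoid
  this compact set.\<close>

lemma compactin_nth_edges:
  assumes K: "compactin (fin_path_topology E) K"
  shows "compactin (espace E) {xs ! N | xs. Edges xs \<in> K \<and> N < length xs}"
proof -
  let ?G = "\<Union>n\<in>{N<..}. paths_of_length E n"
  let ?T = "subtopology (fin_path_topology E) ?G"
  have G: "?G = (\<Union>n\<in>{N<..}. edge_paths E n)" by (auto simp: paths_of_length_pos)
  have GE: "?G \<subseteq> fin_paths E" by (auto simp: fin_paths_def)
  have "fin_paths E - ?G = (\<Union>n\<in>{..N}. paths_of_length E n)"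
  proof (intro set_eqI iffI)
    fix \<delta> assume d: "\<delta> \<in> fin_paths E - ?G"
    then obtain n where "\<delta> \<in> paths_of_length E n" by (auto simp: fin_paths_def)
    moreover from this have "n \<le> N" using d by (meson DiffD2 UN_I greaterThan_iff not_le_imp_less)
    ultimately show "\<delta> \<in> (\<Union>n\<in>{..N}. paths_of_length E n)" by blast
  next
    fix \<delta> assume "\<delta> \<in> (\<Union>n\<in>{..N}. paths_of_length E n)"
    then obtain n where n: "n \<le> N" "\<delta> \<in> paths_of_length E n" by blast
    then have "\<delta> \<in> fin_paths E" by (auto simp: fin_paths_def)
    moreover have "\<delta> \<notin> ?G"
    proof
      assume "\<delta> \<in> ?G"
      then obtain m where "N < m" "\<delta> \<in> paths_of_length E m" by blast
      then show False using n paths_of_length_disjoint[of \<delta> E m n] by simp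
    qed
    ultimately show "\<delta> \<in> fin_paths E - ?G" by simp
  qed
  moreover have "openin (fin_path_topology E) (\<Union>n\<in>{..N}. paths_of_length E n)"
    using openin_paths_of_length by blast
  ultimately have "closedin (fin_path_topology E) ?G"
    using GE by (simp add: closedin_def topspace_fin_path_topology)
  then have "compactin (fin_path_topology E) (K \<inter> ?G)" using K by (rule compact_Int_closedin[rotated])
  then have "compactin ?T (K \<inter> ?G)" by (simp add: compactin_subtopology)
  moreover have "continuous_map ?T (espace E) (\<lambda>\<delta>. the_edges \<delta> ! N)"
    unfolding continuous_map_def
  proof (intro conjI allI impI)
    show "(\<lambda>\<delta>. the_edges \<delta> ! N) \<in> topspace ?T \<rightarrow> topspace (espace E)"
      unfolding G by (auto simp: edge_paths_def subset_iff)
    fix B assume B: "openin (espace E) B"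
    have "{\<delta> \<in> topspace ?T. the_edges \<delta> ! N \<in> B} = (\<Union>n\<in>{N<..}. {\<delta> \<in> edge_paths E n. the_edges \<delta> ! N \<in> B}) \<inter> ?G"
      unfolding topspace_subtopology topspace_fin_path_topology using GE by (subst (2) G) (auto simp: G)
    also have "openin ?T \<dots>"
      using openin_edge_paths_nth[OF B] by (intro openin_subtopology_Int openin_Union) auto
    finally show "openin ?T {\<delta> \<in> topspace ?T. the_edges \<delta> ! N \<in> B}" .
  qed
  ultimately have "compactin (espace E) ((\<lambda>\<delta>. the_edges \<delta> ! N) ` (K \<inter> ?G))" by (rule image_compactin)
  also have "(\<lambda>\<delta>. the_edges \<delta> ! N) ` (K \<inter> ?G) = {xs ! N | xs. Edges xs \<in> K \<and> N < length xs}"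
  proof -
    have "Edges xs \<in> ?G" if "Edges xs \<in> K" "N < length xs" for xs
    proof -
      have "Edges xs \<in> fin_paths E"
        using that compactin_subset_topspace[OF K] by (auto simp: topspace_fin_path_topology)
      then have "Edges xs \<in> edge_paths E (length xs)" by (cases rule: fin_paths_cases) auto
      then show ?thesis using that unfolding G by blast
    qed
    moreover have "\<exists>xs. \<delta> = Edges xs \<and> N < length xs" if "\<delta> \<in> ?G" for \<delta>
      using that unfolding G by (auto simp: edge_paths_def)
    ultimately have "K \<inter> ?G = Edges ` {xs. Edges xs \<in> K \<and> N < length xs}" by blast
    then show ?thesis by (auto simp: image_image)
  qed
  finally show ?thesis .
qed

text \<open>A box around the limit segment inside \<open>U\<close> constrains finitely many
  coordinates, and each constraint is met eventually. For n = 0 the convergence of the ranges is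
  used instead.\<close>

lemma eventually_segment_in_open:
  fixes ys :: "nat \<Rightarrow> 'e list"
  assumes path: "\<And>j. Edges (ys j) \<in> fin_paths E"
    and rng: "limitin (vspace E) (\<lambda>j. rng E (hd (ys j))) w sequentially"
    and len: "\<And>k. k < n \<Longrightarrow> \<forall>\<^sub>F j in sequentially. k < length (ys j)"
    and lim: "\<And>k. k < n \<Longrightarrow> limitin (espace E) (\<lambda>j. ys j ! k) (e k) sequentially"
    and U: "openin (fin_path_topology E) U" "(if n = 0 then Vtx w else Edges (map e [0..<n])) \<in> U"
  shows "\<forall>\<^sub>F j in sequentially. n \<le> length (ys j) \<and> segment E n (Edges (ys j)) \<in> U"
proof (cases n)
  case 0
  then have "w \<in> {v. Vtx v \<in> U}" using U by simp
  then have "\<forall>\<^sub>F j in sequentially. rng E (hd (ys j)) \<in> {v. Vtx v \<in> U}"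
    using rng openin_Vtx_vimage[OF U(1)] by (auto simp: limitin_def)
  then show ?thesis using 0 by (simp add: segment_def)
next
  case (Suc m)
  then have n: "n > 0" by simp
  have "openin (path_topology E n) (U \<inter> paths_of_length E n)"
    using U(1) openin_fin_path_topology by blast
  note B = this[unfolded openin_path_topology_pos[OF n], THEN conjunct2, rule_format]
  have "Edges (map e [0..<n]) \<in> fin_paths E"
    using U n openin_subset[OF U(1)] by (auto simp: topspace_fin_path_topology)
  then have "Edges (map e [0..<n]) \<in> paths_of_length E n"
  proof (cases rule: fin_paths_cases)
    case (edges y zs)
    then have "length (map e [0..<n]) = Suc (length zs)" by (metis gpath.inject(2) length_Cons)
    then show ?thesis using edges by (simp add: paths_of_length_def)
  qed simp
  then have "Edges (map e [0..<n]) \<in> U \<inter> paths_of_length E n" using U n by simp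
  from B[OF this] obtain B where B: "\<And>i. i < n \<Longrightarrow> openin (espace E) (B i) \<and> e i \<in> B i"
    "\<And>zs. Edges zs \<in> edge_paths E n \<Longrightarrow> (\<forall>i<n. zs ! i \<in> B i) \<Longrightarrow> Edges zs \<in> U \<inter> paths_of_length E n"
    by auto
  have "\<forall>\<^sub>F j in sequentially. \<forall>i\<in>{..<n}. ys j ! i \<in> B i"
    using lim B(1) by (intro eventually_ball_finite) (auto simp: limitin_def)
  moreover have "\<forall>\<^sub>F j in sequentially. m < length (ys j)" using len[of m] Suc by simp
  ultimately show ?thesis
  proof eventually_elim
    case (elim j)
    then have le: "n \<le> length (ys j)" using Suc by simp
    have "Edges (ys j) \<in> edge_paths E (length (ys j))"
      using path[of j] by (cases rule: fin_paths_cases) auto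
    then have "Edges (take n (ys j)) \<in> edge_paths E n"
      using le by (auto simp: Edges_in_edge_paths_iff)
    moreover have "\<forall>i<n. take n (ys j) ! i \<in> B i" using elim by auto
    ultimately have "Edges (take n (ys j)) \<in> U" using B(2) by blast
    then show ?case using le n by (simp add: segment_def)
  qed
qed

text \<open>Consider a generator Z(U) minus Z(K) containing the limit. Some segment of the limit
  lies in U, and segments converge. In K only finitely many segment lengths occur: those up to the
  length of the limit are excluded because the complement of K is open, and a longer segment would
  contain an escaping edge inside the compact set from \<open>compactin_nth_edges\<close>.\<close>

lemma limit_of_singular_paths:
  fixes ys :: "nat \<Rightarrow> 'e list"
  assumes path: "\<And>j. Edges (ys j) \<in> paths_to E v" and v: "v \<in> singular_vertices E"
    and rng: "limitin (vspace E) (\<lambda>j. rng E (hd (ys j))) w sequentially"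
    and alt: "\<And>k. (\<exists>l. (\<forall>\<^sub>F j in sequentially. k < length (ys j)) \<and> limitin (espace E) (\<lambda>j. ys j ! k) l sequentially) \<or>
      (\<forall>C. compactin (espace E) C \<longrightarrow> (\<forall>\<^sub>F j in sequentially. \<not> (k < length (ys j) \<and> ys j ! k \<in> C)))"
  shows "\<exists>x. limitin (boundary_topology E) (\<lambda>j. Edges (ys j)) x sequentially"
proof -
  have fin: "Edges (ys j) \<in> fin_paths E" for j using path by (simp add: paths_to_def)
  have ne: "ys j \<noteq> []" for j using fin[of j] not_Edges_Nil by metis
  have bd: "Edges (ys j) \<in> boundary_paths E" for j
    using path[of j] v by (auto simp: boundary_paths_def sing_paths_def paths_to_def)
  have yE: "Edges (ys j) \<in> edge_paths E (length (ys j))" for j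
    using fin[of j] by (cases rule: fin_paths_cases) auto
  define good where "good k \<longleftrightarrow> (\<exists>l. (\<forall>\<^sub>F j in sequentially. k < length (ys j)) \<and> limitin (espace E) (\<lambda>j. ys j ! k) l sequentially)" for k
  \<comment> \<open>The limit path has length \<open>L\<close>, the first position at which the edges escape to infinity.\<close>
  define L where "L = (if \<forall>k. good k then \<infinity> else enat (LEAST k. \<not> good k))"
  define e where "e k = (SOME l. limitin (espace E) (\<lambda>j. ys j ! k) l sequentially)" for k
  \<comment> \<open>The vertex between the edges k - 1 and k of the limit, with \<open>w\<close> in
    front of the first edge. If the limit has length N, then \<open>u N\<close> is its
    source.\<close>
  define u where "u k = (if k = 0 then w else src E (e (k - 1)))" for k
  have goodL: "good k" if "enat k < L" for k
    using that not_less_Least[of k "\<lambda>k. \<not> good k"] unfolding L_def by (auto split: if_splits)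
  have len: "\<forall>\<^sub>F j in sequentially. k < length (ys j)" if "enat k < L" for k
    using goodL[OF that] by (auto simp: good_def)
  have lim: "limitin (espace E) (\<lambda>j. ys j ! k) (e k) sequentially" if "enat k < L" for k
    using goodL[OF that] unfolding e_def good_def by (metis (mono_tags, lifting) someI_ex)
  have eE: "e k \<in> topspace (espace E)" if "enat k < L" for k
    using lim[OF that] limitin_topspace by metis
  have esc: "\<forall>\<^sub>F j in sequentially. \<not> (N < length (ys j) \<and> ys j ! N \<in> C)" if "L = enat N" "compactin (espace E) C" for N C
  proof -
    have "\<not> good N" using that(1) LeastI_ex[of "\<lambda>k. \<not> good k"] unfolding L_def by (auto split: if_splits)
    then show ?thesis using alt[of N] that(2) unfolding good_def by blast
  qed
  \<comment> \<open>The same vertices on the given paths: \<open>t k\<close> tends to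
    \<open>u k\<close> even if the edges at position k are missing or escape.\<close>
  define t where "t k j = (if k = 0 then rng E (hd (ys j)) else src E (ys j ! (k - 1)))" for k j
  have limu: "limitin (vspace E) (t k) (u k) sequentially" if "enat k \<le> L" for k
  proof (cases k)
    case 0 then show ?thesis using rng by (simp add: t_def[abs_def] u_def)
  next
    case (Suc m)
    then have "enat m < L" using that by (cases L) auto
    then show ?thesis
      using continuous_map_limit[OF continuous_src lim, of m] Suc by (simp add: t_def[abs_def] u_def o_def)
  qed
  have rng_t: "rng E (ys j ! k) = t k j" if "k < length (ys j)" for j k
    using yE[of j] that by (cases k) (auto simp: t_def Edges_in_edge_paths_iff hd_conv_nth ne)
  \<comment> \<open>The ranges of the edges at k tend to \<open>rng E (e k)\<close> and to
    \<open>u k\<close>, and limits in a Hausdorff space are unique. So the limits of the edges fit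
    together to a path.\<close>
  have rng_e: "rng E (e k) = u k" if k: "enat k < L" for k
  proof -
    have "limitin (vspace E) (\<lambda>j. rng E (ys j ! k)) (rng E (e k)) sequentially"
      using continuous_map_limit[OF continuous_rng lim[OF k]] by (simp add: o_def)
    moreover have "\<forall>\<^sub>F j in sequentially. rng E (ys j ! k) = t k j"
      using len[OF k] by eventually_elim (rule rng_t)
    ultimately have "limitin (vspace E) (t k) (rng E (e k)) sequentially"
      by (rule limitin_transform_eventually[rotated])
    then show ?thesis
      using limitin_Hausdorff_unique[OF _ limu _ Hausdorff_vspace] k by simp
  qed
  define x where "x = (case L of \<infinity> \<Rightarrow> Inf_path e | enat N \<Rightarrow> if N = 0 then Vtx w else Edges (map e [0..<N]))"
  have plen_x: "plen x = L"
    by (auto simp: x_def zero_enat_def split: enat.split)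
  have path_e: "Edges (map e [0..<n]) \<in> edge_paths E n" if "enat n \<le> L" for n
  proof -
    have lt: "enat i < L" if "i < n" for i using that \<open>enat n \<le> L\<close> by (meson enat_ord_simps(2) less_le_trans)
    show ?thesis
      unfolding Edges_in_edge_paths_iff
    proof (intro conjI allI impI)
      fix i assume "Suc i < n"
      then show "src E (map e [0..<n] ! i) = rng E (map e [0..<n] ! Suc i)"
        using rng_e[OF lt, of "Suc i"] by (simp add: u_def)
    qed (use eE lt in auto)
  qed
  have w: "w \<in> topspace (vspace E)" using rng limitin_topspace by metis
  have seg_x: "segment E n x = (if n = 0 then Vtx w else Edges (map e [0..<n]))" if n: "enat n \<le> L" for n
  proof (cases L)
    case (enat N)
    show ?thesis
    proof (cases "N = 0")
      case True then show ?thesis using enat n by (simp add: x_def segment_def)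
    next
      case False
      \<comment> \<open>The segment of length 0 is the range vertex, and the first limit edge has
        range \<open>u 0\<close>, that is \<open>w\<close>.\<close>
      then have "rng E (hd (map e [0..<N])) = w" using rng_e[of 0] enat by (simp add: hd_map u_def)
      then show ?thesis using enat n False by (auto simp: x_def segment_def take_map)
    qed
  next
    case infinity
    then show ?thesis using rng_e[of 0] by (auto simp: x_def segment_def u_def)
  qed
  have xb: "x \<in> boundary_paths E"
  proof (cases L)
    case infinity
    then have "rng E (e (Suc i)) = src E (e i)" for i using rng_e[of "Suc i"] by (simp add: u_def)
    then show ?thesis using infinity eE by (auto simp: x_def boundary_paths_def inf_paths_def)
  next
    case (enat N)
    have xf: "x \<in> fin_paths E"
      using enat path_e[of N] w edge_paths_subset_fin_paths[of N E] by (auto simp: x_def Vtx_in_fin_paths_iff)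
    have xs: "path_src E x = u N"
      using enat by (auto simp: x_def u_def last_map)
    have uV: "u N \<in> topspace (vspace E)" using limu[of N] enat limitin_topspace by fastforce
    \<comment> \<open>At a regular vertex the edges at position \<open>N\<close> stay in a compact set, so the paths would have to
      end there, in a neighbourhood of regular vertices; but they end at the singular vertex \<open>v\<close>.\<close>
    have "u N \<notin> regular_vertices E"
    proof
      assume "u N \<in> regular_vertices E"
      then obtain W where W: "openin (vspace E) W" "u N \<in> W" "compactin (vspace E) (vspace E closure_of W)"
        "compactin (espace E) {e \<in> topspace (espace E). rng E e \<in> vspace E closure_of W}"
        "rng E ` {e \<in> topspace (espace E). rng E e \<in> W} = W"
        unfolding regular_vertices_def by blast
      let ?C = "{e \<in> topspace (espace E). rng E e \<in> vspace E closure_of W}"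
      have "\<forall>\<^sub>F j in sequentially. t N j \<in> W" using limu[of N] enat W by (auto simp: limitin_def)
      moreover have "\<forall>\<^sub>F j in sequentially. \<not> (N < length (ys j) \<and> ys j ! N \<in> ?C)"
        using esc enat W(4) by blast
      \<comment> \<open>Position N - 1 precedes the escape, so it exists eventually; for N = 0 there
        is nothing to show.\<close>
      moreover have "\<forall>\<^sub>F j in sequentially. N \<le> length (ys j)"
        using len[of "N - 1"] enat by (cases N) (auto elim: eventually_mono)
      ultimately have "\<forall>\<^sub>F j in sequentially. t N j \<in> W \<and> \<not> (N < length (ys j) \<and> ys j ! N \<in> ?C) \<and> N \<le> length (ys j)"
        by eventually_elim blast
      then obtain j where j: "t N j \<in> W" "\<not> (N < length (ys j) \<and> ys j ! N \<in> ?C)" "N \<le> length (ys j)"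
        using eventually_happens'[OF sequentially_bot] by blast
      show False
      proof (cases "N < length (ys j)")
        case True
        have "ys j ! N \<in> topspace (espace E)" using yE[of j] True by (auto simp: Edges_in_edge_paths_iff)
        moreover have "rng E (ys j ! N) \<in> vspace E closure_of W"
          using rng_t[OF True] j(1) closure_of_subset[OF openin_subset[OF W(1)]] by auto
        ultimately show False using j(2) True by blast
      next
        case False
        then have N: "length (ys j) = N" "N \<noteq> 0" using j(3) ne[of j] by auto
        then have "t N j = v" using path[of j] ne[of j] by (simp add: t_def paths_to_def last_conv_nth)
        then have "v \<in> W" using j(1) by simp
        then have "v \<in> regular_vertices E"
          using W openin_subset[OF W(1)] unfolding regular_vertices_def by blast
        then show False using v by (simp add: singular_vertices_def)
      qed
    qed
    then have "x \<in> sing_paths E" using xf xs uV by (simp add: sing_paths_def singular_vertices_def)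
    then show ?thesis by (simp add: boundary_paths_def)
  qed
  have seg_ev: "\<forall>\<^sub>F j in sequentially. n \<le> length (ys j) \<and> segment E n (Edges (ys j)) \<in> U"
    if "enat n \<le> L" "openin (fin_path_topology E) U" "segment E n x \<in> U" for n U
  proof -
    have lt: "enat i < L" if "i < n" for i using that \<open>enat n \<le> L\<close> by (meson enat_ord_simps(2) less_le_trans)
    have "(if n = 0 then Vtx w else Edges (map e [0..<n])) \<in> U" using that(3) seg_x[OF that(1)] by simp
    from eventually_segment_in_open[OF fin rng len[OF lt] lim[OF lt] that(2) this] show ?thesis .
  qed
  have "limitin (boundary_topology E) (\<lambda>j. Edges (ys j)) x sequentially"
    unfolding boundary_topology_def
  proof (rule limitin_topology_generated_by)
    show "x \<in> \<Union>{cylinder E U - cylinder E K |U K. openin (fin_path_topology E) U \<and> compactin (fin_path_topology E) K}"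
      using xb topspace_boundary_topology unfolding boundary_topology_def topology_generated_by_topspace by blast
    fix Q assume "Q \<in> {cylinder E U - cylinder E K |U K. openin (fin_path_topology E) U \<and> compactin (fin_path_topology E) K}"
      and xQ: "x \<in> Q"
    then obtain U K where Q: "Q = cylinder E U - cylinder E K"
      and U: "openin (fin_path_topology E) U" and K: "compactin (fin_path_topology E) K" by blast
    have "\<forall>\<^sub>F j in sequentially. Edges (ys j) \<in> cylinder E U"
    proof -
      obtain n where n: "enat n \<le> L" "segment E n x \<in> U"
        using xQ plen_x by (auto simp: Q cylinder_iff)
      from seg_ev[OF n(1) U n(2)] show ?thesis
        by eventually_elim (use bd in \<open>auto simp: cylinder_iff\<close>)
    qed
    moreover have "\<forall>\<^sub>F j in sequentially. Edges (ys j) \<notin> cylinder E K"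
    proof -
      obtain I where I: "finite I" "K \<subseteq> (\<Union>n\<in>I. paths_of_length E n)"
        using compactin_finite_lengths[OF K] .
      have "closedin (fin_path_topology E) K" using Hausdorff_fin_path_topology K by (rule compactin_imp_closedin)
      then have op: "openin (fin_path_topology E) (fin_paths E - K)"
        by (metis closedin_def topspace_fin_path_topology)
      \<comment> \<open>Lengths up to \<open>L\<close>: only those in the finite set
        \<open>I\<close> can occur in \<open>K\<close>, so finitely many eventual statements are
        combined.\<close>
      have "\<forall>\<^sub>F j in sequentially. \<forall>n\<in>{n\<in>I. enat n \<le> L}. segment E n (Edges (ys j)) \<notin> K"
      proof (rule eventually_ball_finite)
        show "\<forall>n\<in>{n \<in> I. enat n \<le> L}. \<forall>\<^sub>F j in sequentially. segment E n (Edges (ys j)) \<notin> K"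
        proof
          fix n assume n: "n \<in> {n \<in> I. enat n \<le> L}"
          then have "segment E n x \<in> paths_of_length E n" using segment_in_paths_of_length[OF xb] plen_x by simp
          then have "segment E n x \<in> fin_paths E - K"
            using xQ n plen_x xb by (auto simp: Q cylinder_iff fin_paths_def)
          with n have "\<forall>\<^sub>F j in sequentially. n \<le> length (ys j) \<and> segment E n (Edges (ys j)) \<in> fin_paths E - K"
            by (intro seg_ev op) auto
          then show "\<forall>\<^sub>F j in sequentially. segment E n (Edges (ys j)) \<notin> K" by eventually_elim blast
        qed
      qed (use I in simp)
      \<comment> \<open>Lengths beyond \<open>L\<close>: such a segment contains the edge at
        position N, which would then belong to the compact set of N-th edges of paths in
        \<open>K\<close>.\<close>
      moreover have "\<forall>\<^sub>F j in sequentially. \<forall>n. L < enat n \<longrightarrow> n \<le> length (ys j) \<longrightarrow> segment E n (Edges (ys j)) \<notin> K"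
      proof (cases L)
        case (enat N)
        let ?C = "{xs ! N | xs. Edges xs \<in> K \<and> N < length xs}"
        have "\<forall>\<^sub>F j in sequentially. \<not> (N < length (ys j) \<and> ys j ! N \<in> ?C)"
          using esc[OF enat] compactin_nth_edges[OF K] by blast
        then show ?thesis
        proof (eventually_elim, intro allI impI notI)
          fix j n assume *: "\<not> (N < length (ys j) \<and> ys j ! N \<in> ?C)" "L < enat n" "n \<le> length (ys j)"
            "segment E n (Edges (ys j)) \<in> K"
          then have "Edges (take n (ys j)) \<in> K" "N < n" using enat by (auto simp: segment_def)
          then have "take n (ys j) ! N \<in> ?C" using *(3) by (intro CollectI exI[of _ "take n (ys j)"]) auto
          then show False using * \<open>N < n\<close> by simp
        qed
      qed simp
      ultimately show ?thesis
      proof eventually_elim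
        case (elim j)
        show ?case
        proof
          assume "Edges (ys j) \<in> cylinder E K"
          then obtain n where n: "enat n \<le> plen (Edges (ys j) :: ('v, 'e) gpath)" "segment E n (Edges (ys j)) \<in> K"
            by (auto simp: cylinder_iff)
          then obtain m where "m \<in> I" "segment E n (Edges (ys j)) \<in> paths_of_length E m" using I by blast
          moreover have "segment E n (Edges (ys j)) \<in> paths_of_length E n"
            using segment_in_paths_of_length[OF bd n(1)] .
          ultimately have "n \<in> I" using paths_of_length_disjoint by blast
          then show False using elim n by (cases "enat n \<le> L") (auto simp: not_le)
        qed
      qed
    qed
    ultimately show "\<forall>\<^sub>F j in sequentially. Edges (ys j) \<in> Q"
      unfolding Q by eventually_elim blast
  qed
  then show ?thesis by blast
qed

end

context second_countable_top_graph
begin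

text \<open>The ranges are made to converge first, by compactness of \<open>K\<close>. They matter
  when already the first edges escape: the limit is then the path of length 0 at the limit of the
  ranges.\<close>

lemma convergent_subsequence_of_paths_to:
  fixes xs :: "nat \<Rightarrow> 'e list"
  assumes "\<And>j. Edges (xs j) \<in> paths_to E v" "v \<in> singular_vertices E"
    "compactin (vspace E) K" "\<And>j. rng E (hd (xs j)) \<in> K"
  obtains x r where "strict_mono (r :: nat \<Rightarrow> nat)" "limitin (boundary_topology E) (\<lambda>j. Edges (xs (r j))) x sequentially"
proof -
  have sc: "second_countable (vspace E)" "second_countable (espace E)"
    using second_countable_graph by (auto simp: second_countable_graph_def)
  obtain w r where r: "strict_mono (r :: nat \<Rightarrow> nat)" "limitin (vspace E) ((\<lambda>j. rng E (hd (xs j))) \<circ> r) w sequentially"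
    by (rule compactin_convergent_subsequence[OF sc(1) assms(3,4)])
  obtain d where d: "strict_mono (d :: nat \<Rightarrow> nat)"
    "\<And>k. (\<exists>l. (\<forall>\<^sub>F j in sequentially. k < length (xs (r (d j)))) \<and> limitin (espace E) (\<lambda>j. xs (r (d j)) ! k) l sequentially) \<or>
      (\<forall>C. compactin (espace E) C \<longrightarrow> (\<forall>\<^sub>F j in sequentially. \<not> (k < length (xs (r (d j))) \<and> xs (r (d j)) ! k \<in> C)))"
    by (rule diagonal_subsequence_of_lists[OF sc(2), of "\<lambda>j. xs (r j)"]) blast
  have "limitin (vspace E) (\<lambda>j. rng E (hd (xs (r (d j))))) w sequentially"
    using limitin_subsequence[OF d(1) r(2)] by (simp add: o_def)
  from limit_of_singular_paths[OF assms(1,2) this d(2)]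
  obtain x where "limitin (boundary_topology E) (\<lambda>j. Edges (xs (r (d j)))) x sequentially" by blast
  then show thesis using that[OF strict_mono_o[OF r(1) d(1)]] by (simp add: o_def)
qed

end

section \<open>Invariant measures\<close>


lemma measure_ray_scale_measure:
  assumes "0 < c"
  shows "measure_ray (scale_measure (ennreal c) M) = measure_ray M"
proof (intro set_eqI iffI)
  fix \<mu> assume "\<mu> \<in> measure_ray (scale_measure (ennreal c) M)"
  then obtain d where d: "0 < d" "\<mu> = scale_measure (ennreal d) (scale_measure (ennreal c) M)"
    by (auto simp: measure_ray_def)
  then have "\<mu> = scale_measure (ennreal (d * c)) M"
    using assms by (simp add: scale_scale_measure ennreal_mult)
  then show "\<mu> \<in> measure_ray M" using d assms unfolding measure_ray_def by (auto intro!: exI[of _ "d * c"])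
next
  fix \<mu> assume "\<mu> \<in> measure_ray M"
  then obtain d where d: "0 < d" "\<mu> = scale_measure (ennreal d) M" by (auto simp: measure_ray_def)
  then have "\<mu> = scale_measure (ennreal (d / c)) (scale_measure (ennreal c) M)"
    using assms by (simp add: scale_scale_measure flip: ennreal_mult)
  then show "\<mu> \<in> measure_ray (scale_measure (ennreal c) M)"
    using d assms unfolding measure_ray_def by (auto intro!: exI[of _ "d / c"])
qed

context second_countable_top_graph
begin

section \<open>Paths to a singular vertex under the shift\<close>

lemma paths_to_subset_sing_paths: "v \<in> singular_vertices E \<Longrightarrow> paths_to E v \<subseteq> sing_paths E"
  by (auto simp: paths_to_def sing_paths_def)

lemma sing_paths_subset: "sing_paths E \<subseteq> boundary_paths E"
  by (auto simp: boundary_paths_def)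

lemma countable_borel:
  assumes "countable S" "S \<subseteq> boundary_paths E"
  shows "S \<in> sets \<B>"
proof -
  have "(\<Union>\<alpha>\<in>S. {\<alpha>}) \<in> sets \<B>"
    using assms singleton_borel by (intro sets.countable_UN'') auto
  then show ?thesis by simp
qed

lemma Vtx_in_paths_to_iff: "Vtx u \<in> paths_to E v \<longleftrightarrow> u = v \<and> v \<in> topspace (vspace E)"
  by (auto simp: paths_to_def Vtx_in_fin_paths_iff)

lemma singular_in_vspace: "v \<in> singular_vertices E \<Longrightarrow> v \<in> topspace (vspace E)"
  by (simp add: singular_vertices_def)

lemma shift_in_paths_to_iff:
  assumes "\<alpha> \<in> boundary_paths E - vertex_paths E"
  shows "shift E \<alpha> \<in> paths_to E v \<longleftrightarrow> \<alpha> \<in> paths_to E v"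
proof -
  from assms have "\<alpha> \<in> boundary_paths E" by blast
  then show ?thesis
  proof (cases rule: boundary_paths_cases)
    case (vertex v)
    then show ?thesis using assms by (auto simp: vertex_paths_def)
  next
    case (edges x xs)
    have x: "x \<in> topspace (espace E)" using edges by (simp add: Edges_Cons_in_edge_paths_iff)
    show ?thesis
    proof (cases xs)
      case Nil
      then show ?thesis using edges x
        by (simp add: paths_to_def Vtx_in_fin_paths_iff Edges_Cons_in_fin_paths_iff src_in_vspace)
    next
      case (Cons y ys)
      then show ?thesis using edges
        by (simp add: paths_to_def Edges_Cons_in_fin_paths_iff Edges_Cons_in_edge_paths_iff[of x])
    qed
  next
    case (infinite f)
    then show ?thesis by (simp add: paths_to_def Inf_path_not_fin_path)
  qed
qed

text \<open>Shifting keeps the source; these are the shift-invariant sets to which extremality is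
  applied.\<close>

lemma shift_in_sources_iff:
  assumes "\<alpha> \<in> boundary_paths E - vertex_paths E"
  shows "shift E \<alpha> \<in> {\<alpha> \<in> sing_paths E. path_src E \<alpha> \<in> B} \<longleftrightarrow> \<alpha> \<in> {\<alpha> \<in> sing_paths E. path_src E \<alpha> \<in> B}"
proof -
  have "\<beta> \<in> {\<alpha> \<in> sing_paths E. path_src E \<alpha> \<in> B} \<longleftrightarrow> (\<exists>v\<in>singular_vertices E \<inter> B. \<beta> \<in> paths_to E v)" for \<beta>
    by (auto simp: sing_paths_def paths_to_def)
  then show ?thesis using shift_in_paths_to_iff[OF assms] by simp
qed

section \<open>The sum of Dirac measures over the paths to a vertex\<close>

lemma sets_vertex_measure: "sets (vertex_measure E v) = sets \<B>"
  by (simp add: vertex_measure_def sum_measures_def sets.sigma_sets_eq sets.space_closed)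

lemma emeasure_vertex_measure:
  assumes "A \<in> sets \<B>"
  shows "emeasure (vertex_measure E v) A = emeasure (count_space UNIV) (A \<inter> paths_to E v)"
proof -
  have "emeasure (vertex_measure E v) A = (\<integral>\<^sup>+ \<alpha>. emeasure (return \<B> \<alpha>) A \<partial>count_space (paths_to E v))"
    unfolding vertex_measure_def using assms by (intro emeasure_sum_measures) auto
  also have "\<dots> = (\<integral>\<^sup>+ \<alpha>. indicator (A \<inter> paths_to E v) \<alpha> \<partial>count_space (paths_to E v))"
    using assms by (intro nn_integral_cong) (auto simp: indicator_def)
  also have "\<dots> = emeasure (count_space (paths_to E v)) (A \<inter> paths_to E v)"
    by (intro nn_integral_indicator) auto
  also have "\<dots> = emeasure (count_space UNIV) (A \<inter> paths_to E v)"
    by (simp add: emeasure_count_space)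
  finally show ?thesis .
qed

text \<open>A singleton is a Borel set on which the shift is injective, so invariance applies to it;
  the shifted path is one edge shorter and still ends at v.\<close>

lemma invariant_measure_singleton:
  assumes inv: "invariant_measure E \<nu>" and v: "v \<in> singular_vertices E" and \<alpha>: "\<alpha> \<in> paths_to E v"
  shows "emeasure \<nu> {\<alpha>} = emeasure \<nu> {Vtx v}"
proof -
  have "emeasure \<nu> {\<alpha>} = emeasure \<nu> {Vtx v}" if "\<alpha> \<in> paths_to E v" "\<alpha> \<in> paths_of_length E n" for n \<alpha>
    using that
  proof (induction n arbitrary: \<alpha>)
    case 0
    then have "\<alpha> = Vtx v" by (auto simp: paths_of_length_0 vertex_paths_def paths_to_def)
    then show ?case by simp
  next
    case (Suc n)
    have bd: "\<alpha> \<in> boundary_paths E"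
      using Suc.prems v paths_to_subset_sing_paths sing_paths_subset by blast
    have nv: "\<alpha> \<notin> vertex_paths E"
      using Suc.prems(2) by (auto simp: paths_of_length_Suc edge_paths_def vertex_paths_def)
    have "{\<alpha>} \<subseteq> boundary_paths E - vertex_paths E" "inj_on (shift E) {\<alpha>}" using bd nv by auto
    then have "emeasure \<nu> (shift E ` {\<alpha>}) = emeasure \<nu> {\<alpha>}"
      using inv singleton_borel[OF bd] unfolding invariant_measure_def by blast
    moreover have "emeasure \<nu> {shift E \<alpha>} = emeasure \<nu> {Vtx v}"
      using Suc.IH[of "shift E \<alpha>"] Suc.prems shift_in_paths_to_iff bd nv shift_paths_of_length by blast
    ultimately show ?case by simp
  qed
  moreover obtain n where "\<alpha> \<in> paths_of_length E n" using \<alpha> by (auto simp: paths_to_def fin_paths_def)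
  ultimately show ?thesis using \<alpha> by blast
qed

text \<open>A measure living on a countable set is the sum of its point masses, and these all equal
  the mass at \<open>Vtx v\<close>.\<close>

lemma invariant_measure_on_paths_to:
  assumes inv: "invariant_measure E \<nu>" and v: "v \<in> singular_vertices E"
    and null: "emeasure \<nu> (boundary_paths E - paths_to E v) = 0" and A: "A \<in> sets \<B>"
  shows "emeasure \<nu> A = emeasure \<nu> {Vtx v} * emeasure (vertex_measure E v) A"
proof -
  have sets: "sets \<nu> = sets \<B>" using inv by (simp add: invariant_measure_def)
  have P: "paths_to E v \<subseteq> boundary_paths E"
    using paths_to_subset_sing_paths[OF v] sing_paths_subset by blast
  have PB: "paths_to E v \<in> sets \<B>" using countable_borel[OF countable_paths_to P] .
  have AE: "A \<subseteq> boundary_paths E" using sets.sets_into_space[OF A] by (simp add: space_boundary_borel)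
  have "emeasure \<nu> A = emeasure \<nu> (A \<inter> paths_to E v) + emeasure \<nu> (A - paths_to E v)"
    using A PB by (subst plus_emeasure) (auto simp: sets Int_Diff_Un)
  moreover have "emeasure \<nu> (A - paths_to E v) \<le> emeasure \<nu> (boundary_paths E - paths_to E v)"
    using AE PB boundary_paths_borel by (intro emeasure_mono) (auto simp: sets)
  ultimately have "emeasure \<nu> A = emeasure \<nu> (A \<inter> paths_to E v)" using null by simp
  also have "\<dots> = (\<integral>\<^sup>+ \<alpha>. emeasure \<nu> {\<alpha>} \<partial>count_space (A \<inter> paths_to E v))"
    using P singleton_borel countable_paths_to by (intro emeasure_countable_singleton) (auto simp: sets)
  also have "\<dots> = (\<integral>\<^sup>+ \<alpha>. emeasure \<nu> {Vtx v} \<partial>count_space (A \<inter> paths_to E v))"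
    using invariant_measure_singleton[OF inv v] by (intro nn_integral_cong) auto
  also have "\<dots> = emeasure \<nu> {Vtx v} * emeasure (count_space UNIV) (A \<inter> paths_to E v)"
    by (simp add: emeasure_count_space)
  finally show ?thesis by (simp add: emeasure_vertex_measure[OF A])
qed

text \<open>Local finiteness yields an open cover of the boundary by cylinders over vertex sets,
  each meeting the paths to v in a finite set; finitely many of them cover \<open>K\<close>.\<close>

lemma finite_compactin_Int_paths_to:
  assumes v: "v \<in> locally_finite_singular_vertices E" and K: "compactin (boundary_topology E) K"
  shows "finite (K \<inter> paths_to E v)"
proof -
  let ?\<U> = "{cylinder E (Vtx ` V) | V. openin (vspace E) V \<and> finite (paths_from_to E V v)}"
  have "K \<subseteq> \<Union>?\<U>"
  proof
    fix \<alpha> assume "\<alpha> \<in> K"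
    then have bd: "\<alpha> \<in> boundary_paths E"
      using compactin_subset_topspace[OF K] by (auto simp: topspace_boundary_topology)
    then obtain V where "openin (vspace E) V" "path_rng E \<alpha> \<in> V" "finite (paths_from_to E V v)"
      using v path_rng_in_vspace unfolding locally_finite_singular_vertices_def by blast
    moreover from this bd have "\<alpha> \<in> cylinder E (Vtx ` V)" by (auto simp: cylinder_def)
    ultimately show "\<alpha> \<in> \<Union>?\<U>" by blast
  qed
  moreover have "\<forall>U\<in>?\<U>. openin (boundary_topology E) U" using openin_cylinder openin_Vtx_image by blast
  ultimately obtain \<F> where F: "finite \<F>" "\<F> \<subseteq> ?\<U>" "K \<subseteq> \<Union>\<F>"
    using compactinD[OF K, of ?\<U>] by meson
  have "finite (U \<inter> paths_to E v)" if U: "U \<in> \<F>" for U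
  proof -
    obtain V where V: "U = cylinder E (Vtx ` V)" "openin (vspace E) V" "finite (paths_from_to E V v)"
      using U F(2) by blast
    have "path_rng E \<alpha> \<in> V" if "\<alpha> \<in> U" for \<alpha>
    proof -
      obtain n where n: "enat n \<le> plen \<alpha>" "segment E n \<alpha> \<in> Vtx ` V" "\<alpha> \<in> boundary_paths E"
        using \<open>\<alpha> \<in> U\<close> by (auto simp: V(1) cylinder_iff)
      then show ?thesis using path_rng_segment[OF n(3,1)] by auto
    qed
    then have "U \<inter> paths_to E v \<subseteq> paths_from_to E V v" by (auto simp: paths_from_to_def)
    then show ?thesis using V(3) finite_subset by blast
  qed
  then have "finite (\<Union>U\<in>\<F>. U \<inter> paths_to E v)" using F(1) by blast
  moreover have "K \<inter> paths_to E v \<subseteq> (\<Union>U\<in>\<F>. U \<inter> paths_to E v)" using F(3) by blast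
  ultimately show ?thesis by (rule finite_subset[rotated])
qed

text \<open>Since the shift keeps sources, an injective shift on \<open>A\<close> maps the counted
  points of \<open>A\<close> bijectively onto those of its image.\<close>

lemma invariant_vertex_measure:
  assumes v: "v \<in> locally_finite_singular_vertices E"
  shows "invariant_measure E (vertex_measure E v)"
  unfolding invariant_measure_def
proof (intro conjI allI ballI impI)
  show "sets (vertex_measure E v) = sets \<B>" by (rule sets_vertex_measure)
  fix K assume "compactin (boundary_topology E) K"
  then have "finite (K \<inter> paths_to E v)" by (rule finite_compactin_Int_paths_to[OF v])
  \<comment> \<open>If \<open>K\<close> is not measurable, its \<open>emeasure\<close> is 0 by
    convention.\<close>
  then show "emeasure (vertex_measure E v) K < \<infinity>"
    by (cases "K \<in> sets \<B>") (simp_all add: emeasure_vertex_measure sets_vertex_measure emeasure_notin_sets of_nat_less_top)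
next
  fix A assume A: "A \<in> sets \<B>" "A \<subseteq> boundary_paths E - vertex_paths E" "inj_on (shift E) A"
  have "shift E ` A \<inter> paths_to E v = shift E ` (A \<inter> paths_to E v)"
    using shift_in_paths_to_iff A(2) by blast
  moreover have inj: "inj_on (shift E) (A \<inter> paths_to E v)" by (rule inj_on_subset[OF A(3)]) simp
  ultimately show "emeasure (vertex_measure E v) (shift E ` A) = emeasure (vertex_measure E v) A"
    using A(1) shift_image_borel[OF A(1,2)] card_image[OF inj] finite_image_iff[OF inj]
    by (simp add: emeasure_vertex_measure emeasure_count_space)
qed

lemma emeasure_vertex_measure_Vtx:
  assumes "u \<in> singular_vertices E"
  shows "emeasure (vertex_measure E v) {Vtx u} = (if u = v then 1 else 0)"
proof -
  have "Vtx u \<in> paths_to E u" using assms by (simp add: Vtx_in_paths_to_iff singular_in_vspace)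
  then have "{Vtx u} \<in> sets \<B>"
    using paths_to_subset_sing_paths[OF assms] sing_paths_subset by (intro singleton_borel) blast
  moreover have "{Vtx u} \<inter> paths_to E v = (if u = v then {Vtx u} else {})"
    using assms by (auto simp: Vtx_in_paths_to_iff singular_in_vspace)
  ultimately show ?thesis by (simp add: emeasure_vertex_measure emeasure_count_space)
qed

lemma vertex_measure_null:
  assumes "v \<in> singular_vertices E"
  shows "emeasure (vertex_measure E v) (boundary_paths E - paths_to E v) = 0"
proof -
  have "paths_to E v \<in> sets \<B>"
    using countable_borel[OF countable_paths_to] paths_to_subset_sing_paths[OF assms] sing_paths_subset by blast
  then have "boundary_paths E - paths_to E v \<in> sets \<B>" using boundary_paths_borel by blast
  then show ?thesis by (simp add: emeasure_vertex_measure Diff_Int2 Int_commute flip: Int_Diff)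
qed

lemma boundary_vertex_measure:
  assumes "v \<in> singular_vertices E"
  shows "boundary_measure E (vertex_measure E v)"
proof -
  have "(boundary_paths E - sing_paths E) \<inter> paths_to E v = {}"
    using paths_to_subset_sing_paths[OF assms] by blast
  then show ?thesis
    using boundary_paths_borel sing_paths_borel by (simp add: boundary_measure_def emeasure_vertex_measure)
qed

text \<open>The factor is the mass of \<open>Vtx v\<close>, which is a real number because the
  singleton is compact.\<close>

lemma invariant_eq_scale_vertex_measure:
  assumes inv: "invariant_measure E \<nu>" and v: "v \<in> singular_vertices E"
    and null: "emeasure \<nu> (boundary_paths E - paths_to E v) = 0"
  obtains c where "0 \<le> c" "\<nu> = scale_measure (ennreal c) (vertex_measure E v)"
proof -
  have "Vtx v \<in> boundary_paths E"
    using v paths_to_subset_sing_paths[OF v] sing_paths_subset Vtx_in_paths_to_iff[of v v] singular_in_vspace by blast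
  then have "compactin (boundary_topology E) {Vtx v}"
    by (simp add: topspace_boundary_topology)
  then have "emeasure \<nu> {Vtx v} < \<infinity>" using inv by (simp add: invariant_measure_def)
  then have c: "ennreal (enn2real (emeasure \<nu> {Vtx v})) = emeasure \<nu> {Vtx v}" by simp
  have "\<nu> = scale_measure (ennreal (enn2real (emeasure \<nu> {Vtx v}))) (vertex_measure E v)"
  proof (rule measure_eqI)
    show s: "sets \<nu> = sets (scale_measure (ennreal (enn2real (emeasure \<nu> {Vtx v}))) (vertex_measure E v))"
      using inv by (simp add: sets_vertex_measure invariant_measure_def)
    fix A assume "A \<in> sets \<nu>"
    then have "A \<in> sets \<B>" using inv by (simp add: invariant_measure_def)
    then show "emeasure \<nu> A = emeasure (scale_measure (ennreal (enn2real (emeasure \<nu> {Vtx v}))) (vertex_measure E v)) A"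
      using invariant_measure_on_paths_to[OF inv v null] by (simp add: c)
  qed
  then show thesis using that enn2real_nonneg by blast
qed

text \<open>Each summand vanishes wherever the sum does, hence lives on the paths to v and is a
  multiple of the sum.\<close>

lemma extremal_vertex_measure:
  assumes v: "v \<in> singular_vertices E"
  shows "extremal_measure E (vertex_measure E v)"
  unfolding extremal_measure_def
proof (intro allI impI)
  fix \<nu>1 \<nu>2 assume inv: "invariant_measure E \<nu>1" "invariant_measure E \<nu>2"
    and sum: "\<forall>A\<in>sets \<B>. emeasure (vertex_measure E v) A = emeasure \<nu>1 A + emeasure \<nu>2 A"
  have "paths_to E v \<in> sets \<B>"
    using countable_borel[OF countable_paths_to] paths_to_subset_sing_paths[OF v] sing_paths_subset by blast
  then have "boundary_paths E - paths_to E v \<in> sets \<B>" using boundary_paths_borel by blast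
  then have "emeasure \<nu>1 (boundary_paths E - paths_to E v) = 0" "emeasure \<nu>2 (boundary_paths E - paths_to E v) = 0"
    using sum vertex_measure_null[OF v] by auto
  then have "\<exists>c\<ge>0. \<nu>1 = scale_measure (ennreal c) (vertex_measure E v)"
    "\<exists>c\<ge>0. \<nu>2 = scale_measure (ennreal c) (vertex_measure E v)"
    by (metis invariant_eq_scale_vertex_measure[OF inv(1) v], metis invariant_eq_scale_vertex_measure[OF inv(2) v])
  then show "{\<nu>1, \<nu>2} \<subseteq> {scale_measure (ennreal c) (vertex_measure E v) |c. 0 \<le> c}" by blast
qed

text \<open>Because S is shift-invariant, the part in S of the shift of A is the shift of the part
  of A in S, so the restriction to S inherits invariance.\<close>

lemma invariant_density:
  assumes inv: "invariant_measure E \<nu>" and S: "S \<in> sets \<B>"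
    and shift: "\<And>\<alpha>. \<alpha> \<in> boundary_paths E - vertex_paths E \<Longrightarrow> shift E \<alpha> \<in> S \<longleftrightarrow> \<alpha> \<in> S"
  shows "invariant_measure E (density \<nu> (indicator S))"
proof -
  have sets: "sets \<nu> = sets \<B>" using inv by (simp add: invariant_measure_def)
  have em: "emeasure (density \<nu> (indicator S)) A = emeasure \<nu> (S \<inter> A)" if "A \<in> sets \<B>" for A
    using S that by (intro emeasure_restricted) (auto simp: sets)
  show ?thesis
    unfolding invariant_measure_def
  proof (intro conjI allI ballI impI)
    show "sets (density \<nu> (indicator S)) = sets \<B>" by (simp add: sets)
    fix K assume K: "compactin (boundary_topology E) K"
    show "emeasure (density \<nu> (indicator S)) K < \<infinity>"
    proof (cases "K \<in> sets \<B>")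
      case True
      then have "emeasure \<nu> (S \<inter> K) \<le> emeasure \<nu> K" by (intro emeasure_mono) (auto simp: sets)
      also have "\<dots> < \<infinity>" using inv K by (simp add: invariant_measure_def)
      finally show ?thesis using em True by simp
    qed (simp add: emeasure_notin_sets sets)
  next
    fix A assume A: "A \<in> sets \<B>" "A \<subseteq> boundary_paths E - vertex_paths E" "inj_on (shift E) A"
    have "S \<inter> shift E ` A = shift E ` (S \<inter> A)" using shift A(2) by blast
    moreover have "emeasure \<nu> (shift E ` (S \<inter> A)) = emeasure \<nu> (S \<inter> A)"
      using inv A S unfolding invariant_measure_def
      by (meson Int_lower2 inj_on_subset sets.Int subset_trans)
    ultimately show "emeasure (density \<nu> (indicator S)) (shift E ` A) = emeasure (density \<nu> (indicator S)) A"
      using A shift_image_borel by (simp add: em)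
  qed
qed

text \<open>The restrictions to S and to its complement are invariant and add up to the measure, so
  extremality makes the first a multiple of the whole.\<close>

lemma extremal_zero_full:
  assumes inv: "invariant_measure E \<nu>" and ext: "extremal_measure E \<nu>" and S: "S \<in> sets \<B>"
    and shift: "\<And>\<alpha>. \<alpha> \<in> boundary_paths E - vertex_paths E \<Longrightarrow> shift E \<alpha> \<in> S \<longleftrightarrow> \<alpha> \<in> S"
  shows "emeasure \<nu> S = 0 \<or> emeasure \<nu> (boundary_paths E - S) = 0"
proof -
  let ?S' = "boundary_paths E - S"
  have sets: "sets \<nu> = sets \<B>" using inv by (simp add: invariant_measure_def)
  have S': "?S' \<in> sets \<B>" using S boundary_paths_borel by blast
  have shift': "shift E \<alpha> \<in> ?S' \<longleftrightarrow> \<alpha> \<in> ?S'" if "\<alpha> \<in> boundary_paths E - vertex_paths E" for \<alpha>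
    using shift[OF that] shift_boundary_path that by blast
  have em: "emeasure (density \<nu> (indicator T)) A = emeasure \<nu> (T \<inter> A)" if "A \<in> sets \<B>" "T \<in> sets \<B>" for A T
    using that by (intro emeasure_restricted) (auto simp: sets)
  have "emeasure \<nu> A = emeasure (density \<nu> (indicator S)) A + emeasure (density \<nu> (indicator ?S')) A" if A: "A \<in> sets \<B>" for A
  proof -
    have "A = (S \<inter> A) \<union> (?S' \<inter> A)"
      using sets.sets_into_space[OF A] by (auto simp: space_boundary_borel)
    then have "emeasure \<nu> A = emeasure \<nu> ((S \<inter> A) \<union> (?S' \<inter> A))" by simp
    also have "\<dots> = emeasure \<nu> (S \<inter> A) + emeasure \<nu> (?S' \<inter> A)"
      using A S S' by (intro plus_emeasure[symmetric]) (auto simp: sets)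
    finally show ?thesis using em A S S' by simp
  qed
  then have "density \<nu> (indicator S) \<in> {scale_measure (ennreal c) \<nu> |c. 0 \<le> c}"
    using ext invariant_density[OF inv S shift] invariant_density[OF inv S' shift']
    unfolding extremal_measure_def by blast
  then obtain c where c: "0 \<le> c" "density \<nu> (indicator S) = scale_measure (ennreal c) \<nu>" by blast
  \<comment> \<open>If c = 0, the second equation makes \<open>S\<close> null; otherwise the first
    makes the complement null. The measure of \<open>S\<close> may be infinite, so c = 1 cannot be
    obtained by cancelling.\<close>
  have "ennreal c * emeasure \<nu> ?S' = emeasure \<nu> (S \<inter> ?S')" "ennreal c * emeasure \<nu> S = emeasure \<nu> (S \<inter> S)"
    using em[OF S' S] em[OF S S] by (simp_all add: c(2))
  moreover have "S \<inter> ?S' = {}" by blast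
  ultimately show ?thesis by (cases "ennreal c = 0") auto
qed

text \<open>For each basic open set B of vertices, either the paths with source in B or the
  remaining paths are null. Once these countably many null sets are removed, no basic open set tells
  the surviving sources apart, so there is only one.\<close>

lemma extremal_boundary_concentrated:
  assumes inv: "invariant_measure E \<nu>" and ext: "extremal_measure E \<nu>" and bm: "boundary_measure E \<nu>"
    and nz: "emeasure \<nu> (space \<nu>) \<noteq> 0"
  obtains v where "v \<in> singular_vertices E" "emeasure \<nu> (boundary_paths E - paths_to E v) = 0"
proof -
  have sets: "sets \<nu> = sets \<B>" using inv by (simp add: invariant_measure_def)
  then have sp: "space \<nu> = boundary_paths E" using sets_eq_imp_space_eq[OF sets] by (simp add: space_boundary_borel)
  obtain \<C> where C: "countable \<C>" "\<And>V. V \<in> \<C> \<Longrightarrow> openin (vspace E) V"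
    "\<And>U x. openin (vspace E) U \<Longrightarrow> x \<in> U \<Longrightarrow> \<exists>V\<in>\<C>. x \<in> V \<and> V \<subseteq> U"
    using second_countable_graph unfolding second_countable_graph_def second_countable_def by meson
  define S where "S B = {\<alpha> \<in> sing_paths E. path_src E \<alpha> \<in> B}" for B
  \<comment> \<open>The null one of the two complementary sets.\<close>
  define Z where "Z B = (if emeasure \<nu> (S B) = 0 then S B else boundary_paths E - S B)" for B
  define N where "N = (\<Union>B\<in>\<C>. Z B) \<union> (boundary_paths E - sing_paths E)"
  have SB: "S B \<in> sets \<B>" if "B \<in> \<C>" for B unfolding S_def using source_vimage_borel C(2)[OF that] .
  have "Z B \<in> null_sets \<nu>" if B: "B \<in> \<C>" for B
    using extremal_zero_full[OF inv ext SB[OF B]] shift_in_sources_iff SB[OF B] boundary_paths_borel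
    by (auto simp: Z_def null_sets_def sets S_def)
  then have "(\<Union>B\<in>\<C>. Z B) \<in> null_sets \<nu>" using C(1) by (intro null_sets_UN')
  moreover have "boundary_paths E - sing_paths E \<in> null_sets \<nu>"
    using bm boundary_paths_borel sing_paths_borel by (auto simp: boundary_measure_def null_sets_def sets)
  ultimately have N: "N \<in> null_sets \<nu>" unfolding N_def by blast
  \<comment> \<open>The measure is nonzero, so some path survives; its source is the vertex
    sought.\<close>
  have "\<not> boundary_paths E \<subseteq> N"
  proof
    assume "boundary_paths E \<subseteq> N"
    then have "emeasure \<nu> (boundary_paths E) \<le> emeasure \<nu> N" using N by (intro emeasure_mono) auto
    then show False using N nz sp by auto
  qed
  then obtain \<alpha> where a: "\<alpha> \<in> boundary_paths E" "\<alpha> \<notin> N" by blast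
  define v where "v = path_src E \<alpha>"
  have as: "\<alpha> \<in> sing_paths E" using a by (auto simp: N_def)
  then have v: "v \<in> singular_vertices E" by (simp add: v_def sing_paths_def)
  have "boundary_paths E - paths_to E v \<subseteq> N"
  proof
    fix \<beta> assume b: "\<beta> \<in> boundary_paths E - paths_to E v"
    show "\<beta> \<in> N"
    proof (rule ccontr)
      assume bN: "\<beta> \<notin> N"
      then have bs: "\<beta> \<in> sing_paths E" using b by (auto simp: N_def)
      define u where "u = path_src E \<beta>"
      have "u \<noteq> v" using b bs by (auto simp: u_def sing_paths_def paths_to_def)
      moreover have "u \<in> topspace (vspace E)" "v \<in> topspace (vspace E)"
        using v bs by (auto simp: u_def sing_paths_def singular_in_vspace)
      ultimately obtain U where U: "openin (vspace E) U" "v \<in> U" "u \<notin> U"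
        using Hausdorff_vspace unfolding Hausdorff_space_def disjnt_def by blast
      then obtain B where B: "B \<in> \<C>" "v \<in> B" "u \<notin> B" using C(3) by blast
      have "\<alpha> \<in> S B" "\<beta> \<notin> S B" using B as by (auto simp: S_def u_def v_def)
      moreover have "\<alpha> \<notin> Z B" "\<beta> \<notin> Z B" using a bN B(1) by (auto simp: N_def)
      ultimately show False using b by (auto simp: Z_def split: if_splits)
    qed
  qed
  then have "emeasure \<nu> (boundary_paths E - paths_to E v) \<le> emeasure \<nu> N"
    using N by (intro emeasure_mono) auto
  then have "emeasure \<nu> (boundary_paths E - paths_to E v) = 0" using N by auto
  then show thesis using that v by blast
qed

lemma locally_finite_of_invariant:
  assumes v: "v \<in> singular_vertices E" and c: "0 < c"
    and inv: "invariant_measure E (scale_measure (ennreal c) (vertex_measure E v))"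
  shows "v \<in> locally_finite_singular_vertices E"
  unfolding locally_finite_singular_vertices_def
proof (intro CollectI conjI ballI v)
  fix w assume "w \<in> topspace (vspace E)"
  \<comment> \<open>The compact \<open>K\<close> around \<open>V\<close> keeps the ranges of the
    paths within a compact set, as the extraction of a convergent subsequence demands.\<close>
  then obtain V K where V: "openin (vspace E) V" "compactin (vspace E) K" "w \<in> V" "V \<subseteq> K"
    using locally_compact_vspace unfolding locally_compact_space_def by blast
  have "finite (paths_from_to E V v)"
  proof (rule ccontr)
    assume inf: "infinite (paths_from_to E V v)"
    let ?T = "{xs. Edges xs \<in> paths_from_to E V v}"
    \<comment> \<open>Only one path to v has length 0, so infinitely many consist of edges.\<close>
    have "paths_from_to E V v \<subseteq> insert (Vtx v) (Edges ` ?T)"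
    proof
      fix \<alpha> assume a: "\<alpha> \<in> paths_from_to E V v"
      then have "\<alpha> \<in> fin_paths E" by (simp add: paths_from_to_def paths_to_def)
      then show "\<alpha> \<in> insert (Vtx v) (Edges ` ?T)"
        by (cases rule: fin_paths_cases) (use a in \<open>auto simp: paths_from_to_def paths_to_def\<close>)
    qed
    then have "infinite ?T" using inf by (meson finite.insertI finite_imageI finite_subset)
    then obtain xs :: "nat \<Rightarrow> 'e list" where xs: "inj xs" "range xs \<subseteq> ?T"
      using infinite_countable_subset by blast
    then have xs': "Edges (xs j) \<in> paths_from_to E V v" for j by blast
    have P: "Edges (xs j) \<in> paths_to E v" "rng E (hd (xs j)) \<in> K" for j
      using xs'[of j] V(4) by (auto simp: paths_from_to_def)
    obtain x r where r: "strict_mono (r :: nat \<Rightarrow> nat)"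
      "limitin (boundary_topology E) (\<lambda>j. Edges (xs (r j))) x sequentially"
      using convergent_subsequence_of_paths_to[OF P(1) v V(2) P(2)] .
    let ?R = "range (\<lambda>j. Edges (xs (r j)) :: ('v, 'e) gpath)"
    have sub: "?R \<subseteq> paths_to E v" using P by blast
    have Pb: "paths_to E v \<subseteq> boundary_paths E"
      using paths_to_subset_sing_paths[OF v] sing_paths_subset by blast
    have "compactin (boundary_topology E) (insert x ?R)"
      using sub Pb by (intro compactin_sequence_with_limit[OF r(2)]) (auto simp: topspace_boundary_topology)
    then have fin: "emeasure (scale_measure (ennreal c) (vertex_measure E v)) (insert x ?R) < \<infinity>"
      using inv by (simp add: invariant_measure_def)
    have "x \<in> boundary_paths E" using limitin_topspace[OF r(2)] by (simp add: topspace_boundary_topology)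
    \<comment> \<open>The limit \<open>x\<close> may be an infinite path or end at another vertex;
      the set is Borel because it is countable.\<close>
    then have "insert x ?R \<in> sets \<B>" using sub Pb by (intro countable_borel) auto
    moreover have "infinite (insert x ?R \<inter> paths_to E v)"
    proof -
      have "inj (\<lambda>j. Edges (xs (r j)) :: ('v, 'e) gpath)"
        using xs(1) strict_mono_eq[OF r(1)] by (auto simp: inj_def)
      then have "infinite ?R" by (rule range_inj_infinite)
      moreover have "?R \<subseteq> insert x ?R \<inter> paths_to E v" using sub by blast
      ultimately show ?thesis using finite_subset by blast
    qed
    ultimately have "emeasure (vertex_measure E v) (insert x ?R) = \<infinity>"
      by (simp add: emeasure_vertex_measure emeasure_count_space)
    then show False using fin c by (simp add: ennreal_mult_top)
  qed
  then show "\<exists>V. openin (vspace E) V \<and> w \<in> V \<and> finite (paths_from_to E V v)" using V by blast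
qed

section \<open>The bijection between vertices and rays\<close>

lemma vertex_measure_ray_extremal:
  assumes v: "v \<in> locally_finite_singular_vertices E"
  shows "measure_ray (vertex_measure E v) \<in> extremal_boundary_rays E"
proof -
  have vs: "v \<in> singular_vertices E" using v by (simp add: locally_finite_singular_vertices_def)
  have "emeasure (vertex_measure E v) {Vtx v} \<le> emeasure (vertex_measure E v) (space (vertex_measure E v))"
    by (rule emeasure_space)
  then have "emeasure (vertex_measure E v) (space (vertex_measure E v)) \<noteq> 0"
    using emeasure_vertex_measure_Vtx[OF vs, of v] by auto
  then show ?thesis
    using invariant_vertex_measure[OF v] extremal_vertex_measure[OF vs] boundary_vertex_measure[OF vs]
    unfolding extremal_boundary_rays_def by blast
qed

lemma extremal_boundary_ray_cases:
  assumes "R \<in> extremal_boundary_rays E"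
  obtains v where "v \<in> locally_finite_singular_vertices E" "R = measure_ray (vertex_measure E v)"
proof -
  obtain \<nu> where R: "R = measure_ray \<nu>" and inv: "invariant_measure E \<nu>" and ext: "extremal_measure E \<nu>"
    and bm: "boundary_measure E \<nu>" and nz: "emeasure \<nu> (space \<nu>) \<noteq> 0"
    using assms unfolding extremal_boundary_rays_def by blast
  obtain v where v: "v \<in> singular_vertices E" "emeasure \<nu> (boundary_paths E - paths_to E v) = 0"
    using extremal_boundary_concentrated[OF inv ext bm nz] .
  obtain c where c: "0 \<le> c" "\<nu> = scale_measure (ennreal c) (vertex_measure E v)"
    using invariant_eq_scale_vertex_measure[OF inv v] .
  \<comment> \<open>A nonzero measure forces a positive factor, so the measure and the sum span the
    same ray.\<close>
  have "c \<noteq> 0" using nz c(2) by auto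
  then have "0 < c" using c(1) by simp
  then show thesis
    using that[OF locally_finite_of_invariant[OF v(1) \<open>0 < c\<close>]] inv R c(2) measure_ray_scale_measure by metis
qed

text \<open>Equal rays mean proportional measures, and evaluation at \<open>Vtx u\<close> decides:
  the first measure is 1 there, the second is 0 unless u = v.\<close>

lemma inj_on_vertex_measure_ray:
  "inj_on (\<lambda>v. measure_ray (vertex_measure E v)) (locally_finite_singular_vertices E)"
proof (rule inj_onI)
  fix u v assume uv: "u \<in> locally_finite_singular_vertices E" "v \<in> locally_finite_singular_vertices E"
    "measure_ray (vertex_measure E u) = measure_ray (vertex_measure E v)"
  have u: "u \<in> singular_vertices E" using uv(1) by (simp add: locally_finite_singular_vertices_def)
  have "vertex_measure E u \<in> measure_ray (vertex_measure E u)"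
    unfolding measure_ray_def by (intro CollectI exI[of _ 1]) simp
  then obtain c where "vertex_measure E u = scale_measure (ennreal c) (vertex_measure E v)"
    unfolding uv(3) by (auto simp: measure_ray_def)
  then have "emeasure (vertex_measure E u) {Vtx u} = ennreal c * emeasure (vertex_measure E v) {Vtx u}"
    by (metis emeasure_scale_measure)
  then show "u = v" using emeasure_vertex_measure_Vtx[OF u] by (auto split: if_splits)
qed

end

theorem theorem3p2:
  fixes E :: "('v, 'e) topgraph"
  assumes "topological_graph E" and "second_countable_graph E"
  shows "\<exists>\<Phi>. bij_betw \<Phi> (locally_finite_singular_vertices E) (extremal_boundary_rays E) \<and>
           (\<forall>v\<in>locally_finite_singular_vertices E. \<Phi> v = measure_ray (vertex_measure E v))"
proof -
  interpret second_countable_top_graph E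
    by unfold_locales (fact assms)+
  have "bij_betw (\<lambda>v. measure_ray (vertex_measure E v)) (locally_finite_singular_vertices E) (extremal_boundary_rays E)"
    unfolding bij_betw_def
  proof (intro conjI equalityI subsetI)
    fix R assume "R \<in> extremal_boundary_rays E"
    then show "R \<in> (\<lambda>v. measure_ray (vertex_measure E v)) ` locally_finite_singular_vertices E"
      by (rule extremal_boundary_ray_cases) blast
  qed (use inj_on_vertex_measure_ray vertex_measure_ray_extremal in auto)
  then show ?thesis by blast
qed

end
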